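(* Let $n\ge 1$ and let $\mathcal P=(P_1,\dots,P_n)$ be an MSF polygonal, with $P_j=(2^{-\lambda_j},2^{-\lambda_j}m_j)$, $\lambda_j\in\mathbb Z$, $m_j\in\mathbb N_0$, and associated numbers $0=a_0<a_1<\dots<a_n=\frac12$. For $j=1,\dots,n$ set $I_j=[a_{j-1},a_j]+m_j$, and let $K^+=I_1\cup\dots\cup I_n$ and $K^-=-K^+$. Then $K=K^+\cup K^-$ is a symmetric wavelet set of $L^2(\mathbb R)$, and it is the disjoint union of $2n$ intervals. Moreover, writing $K(\mathcal P)$ for the wavelet set obtained in this way from $\mathcal P$, if $\mathcal P_1\neq\mathcal P_2$ are different MSF polygonals, then $K(\mathcal P_1)\ne K(\mathcal P_2)$.
   Context: Notation: $\mathbb N_0=\{0,1,2,\dots\}$. Fourier transform: $\widehat\psi(\xi)=\int_{\mathbb R}\psi(x)e^{-2\pi i x\xi}\,dx$. An orthonormal wavelet is a function $\psi\in L^2(\mathbb R)$ such that $\{2^{j/2}\psi(2^jx-k): j,k\in\mathbb Z\}$ is an orthonormal basis of $L^2(\mathbb R)$. A measurable set $K\subset\mathbb R$ is a wavelet set (of $L^2(\mathbb R)$) if there is an orthonormal wavelet $\psi$ with $|\widehat\psi|=\chi_K$ a.e. It is symmetric if $K\cap(-\infty,0]=-(K\cap[0,\infty))$. Let $D$ be the set of points $P[\lambda,m]=(2^{-\lambda},2^{-\lambda}m)$ of the plane with $\lambda\in\mathbb Z$, $m\in\mathbb N_0$. Let $\mathcal P=(P_1,\dots,P_n)$ be an ordered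 sequence of points in $D$, $P_j=P[\lambda_j,m_j]$. For $j=1,\dots,n-1$ let $$a_j=-\frac{m_j2^{-\lambda_j}-m_{j+1}2^{-\lambda_{j+1}}}{2^{-\lambda_j}-2^{-\lambda_{j+1}}}$$ (the negative of the slope of the line through $P_j$ and $P_{j+1}$; in particular one requires $\lambda_j\neq\lambda_{j+1}$), and put $a_0=0$, $a_n=\frac12$. Then $\mathcal P$ is called an MSF polygonal if $\lambda_1=0$, $4m_1=2^{-\lambda_n}(2m_n+1)$, and $0=a_0<a_1<\dots<a_n=\frac12$. *)

theory Defs
  imports "HOL-Analysis.Analysis" "HOL-Library.Disjoint_Sets"
begin

text \<open>
  Elements of \<open>L\<^sup>2(\<real>)\<close> are represented by functions; equality in \<open>L\<^sup>2(\<real>)\<close> is equality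
  almost everywhere.
\<close>

definition L2 :: "(real \<Rightarrow> complex) set" where
  "L2 = {f. f \<in> borel_measurable lebesgue \<and> integrable lebesgue (\<lambda>x. (cmod (f x))\<^sup>2)}"

definition L2_inner :: "(real \<Rightarrow> complex) \<Rightarrow> (real \<Rightarrow> complex) \<Rightarrow> complex" where
  "L2_inner f g = (LINT x|lebesgue. f x * cnj (g x))"

definition L2_norm :: "(real \<Rightarrow> complex) \<Rightarrow> real" where
  "L2_norm f = sqrt (LINT x|lebesgue. (cmod (f x))\<^sup>2)"

definition L2_converges :: "(nat \<Rightarrow> real \<Rightarrow> complex) \<Rightarrow> (real \<Rightarrow> complex) \<Rightarrow> bool" where
  "L2_converges F f \<longleftrightarrow>
     (\<forall>n. F n \<in> L2) \<and> f \<in> L2 \<and> (\<lambda>n. L2_norm (\<lambda>x. F n x - f x)) \<longlonglongrightarrow> 0"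

definition L1_fourier :: "(real \<Rightarrow> complex) \<Rightarrow> real \<Rightarrow> complex" where
  "L1_fourier f \<xi> = (LINT x|lebesgue. f x * exp (- 2 * of_real pi * \<i> * of_real x * of_real \<xi>))"

text \<open>
  A wavelet is in general not integrable, so its Fourier transform is understood in the sense
  of Plancherel, as the continuous extension to \<open>L\<^sup>2(\<real>)\<close> of the integral transform on
  \<open>L\<^sup>1(\<real>) \<inter> L\<^sup>2(\<real>)\<close>. The predicate below is the graph of this extension; the value \<open>g\<close> is
  determined by \<open>f\<close> up to a null set.
\<close>

definition has_fourier_transform :: "(real \<Rightarrow> complex) \<Rightarrow> (real \<Rightarrow> complex) \<Rightarrow> bool" where
  "has_fourier_transform f g \<longleftrightarrow>
     (\<exists>F. (\<forall>n. integrable lebesgue (F n)) \<and> L2_converges F f \<and>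
          L2_converges (\<lambda>n. L1_fourier (F n)) g)"

definition L2_orthonormal_basis :: "('i \<Rightarrow> real \<Rightarrow> complex) \<Rightarrow> bool" where
  "L2_orthonormal_basis e \<longleftrightarrow>
     (\<forall>i. e i \<in> L2) \<and>
     (\<forall>i i'. L2_inner (e i) (e i') = (if i = i' then 1 else 0)) \<and>
     (\<forall>f\<in>L2. \<forall>\<epsilon>>0. \<exists>S c. finite S \<and> L2_norm (\<lambda>x. f x - (\<Sum>i\<in>S. c i * e i x)) < \<epsilon>)"

definition orthonormal_wavelet :: "(real \<Rightarrow> complex) \<Rightarrow> bool" where
  "orthonormal_wavelet \<psi> \<longleftrightarrow> \<psi> \<in> L2 \<and>
     L2_orthonormal_basis
       (\<lambda>(j::int, k::int) x. of_real (2 powr (of_int j / 2)) * \<psi> (2 powi j * x - of_int k))"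

definition wavelet_set :: "real set \<Rightarrow> bool" where
  "wavelet_set K \<longleftrightarrow> K \<in> sets lebesgue \<and>
     (\<exists>\<psi> g. orthonormal_wavelet \<psi> \<and> has_fourier_transform \<psi> g \<and>
        (AE \<xi> in lebesgue. cmod (g \<xi>) = indicator K \<xi>))"

definition symmetric_set :: "real set \<Rightarrow> bool" where
  "symmetric_set K \<longleftrightarrow> K \<inter> {..0} = uminus ` (K \<inter> {0..})"

definition dyadic_point :: "int \<times> nat \<Rightarrow> real \<times> real" where
  "dyadic_point = (\<lambda>(l, m). (2 powi (- l), 2 powi (- l) * real m))"

definition dyadic_points :: "(real \<times> real) set" where
  "dyadic_points = range dyadic_point"

lemma inj_dyadic_point: "inj dyadic_point"
proof (rule injI)
  fix p q :: "int \<times> nat"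
  assume "dyadic_point p = dyadic_point q"
  then have 1: "(2::real) powi (- fst p) = 2 powi (- fst q)"
    and 2: "(2::real) powi (- fst p) * real (snd p) = 2 powi (- fst q) * real (snd q)"
    unfolding dyadic_point_def case_prod_beta prod.inject by blast+
  from 1 have "(2::real) powr of_int (- fst p) = 2 powr of_int (- fst q)"
    by (metis powr_real_of_int' zero_le_numeral zero_neq_numeral)
  then have l: "fst p = fst q" by (simp add: powr_inj)
  then have "real (snd p) = real (snd q)"
    using 2 by (metis mult_cancel_left power_int_not_zero zero_neq_numeral)
  with l show "p = q" by (simp add: prod_eq_iff)
qed

text \<open>
  A polygonal is a list of points of the plane; its \<open>j\<close>-th point, for \<open>1 \<le> j \<le> length ps\<close>, is
  \<open>ps ! (j - 1)\<close>. If that point is dyadic, its parameters are well defined because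
  \<^const>\<open>dyadic_point\<close> is injective.
\<close>

definition pt_lambda :: "(real \<times> real) list \<Rightarrow> nat \<Rightarrow> int" where
  "pt_lambda ps j = fst (inv dyadic_point (ps ! (j - 1)))"

definition pt_m :: "(real \<times> real) list \<Rightarrow> nat \<Rightarrow> nat" where
  "pt_m ps j = snd (inv dyadic_point (ps ! (j - 1)))"

lemma dyadic_point_parameters:
  assumes "set ps \<subseteq> dyadic_points" "1 \<le> j" "j \<le> length ps"
  shows "ps ! (j - 1) = (2 powi (- pt_lambda ps j), 2 powi (- pt_lambda ps j) * real (pt_m ps j))"
proof -
  have "ps ! (j - 1) \<in> range dyadic_point"
    using assms by (auto simp: dyadic_points_def)
  then have "dyadic_point (inv dyadic_point (ps ! (j - 1))) = ps ! (j - 1)"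
    by (rule f_inv_into_f)
  then show ?thesis
    by (simp add: dyadic_point_def pt_lambda_def pt_m_def case_prod_beta)
qed

definition knot :: "(real \<times> real) list \<Rightarrow> nat \<Rightarrow> real" where
  "knot ps j =
     (if j = 0 then 0
      else if j = length ps then 1 / 2
      else - ((real (pt_m ps j) * 2 powi (- pt_lambda ps j)
               - real (pt_m ps (j + 1)) * 2 powi (- pt_lambda ps (j + 1)))
              / (2 powi (- pt_lambda ps j) - 2 powi (- pt_lambda ps (j + 1)))))"

definition msf_polygonal :: "(real \<times> real) list \<Rightarrow> bool" where
  "msf_polygonal ps \<longleftrightarrow>
     1 \<le> length ps \<and> set ps \<subseteq> dyadic_points \<and>
     (\<forall>j\<in>{1..<length ps}. pt_lambda ps j \<noteq> pt_lambda ps (j + 1)) \<and>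
     pt_lambda ps 1 = 0 \<and>
     4 * real (pt_m ps 1) =
       2 powi (- pt_lambda ps (length ps)) * (2 * real (pt_m ps (length ps)) + 1) \<and>
     (\<forall>j<length ps. knot ps j < knot ps (j + 1))"

definition msf_interval :: "(real \<times> real) list \<Rightarrow> nat \<Rightarrow> real set" where
  "msf_interval ps j = (\<lambda>x. x + real (pt_m ps j)) ` {knot ps (j - 1)..knot ps j}"

definition msf_set_pos :: "(real \<times> real) list \<Rightarrow> real set" where
  "msf_set_pos ps = (\<Union>j\<in>{1..length ps}. msf_interval ps j)"

definition msf_set :: "(real \<times> real) list \<Rightarrow> real set" where
  "msf_set ps = msf_set_pos ps \<union> uminus ` msf_set_pos ps"

definition msf_intervals :: "(real \<times> real) list \<Rightarrow> real set set" where
  "msf_intervals ps =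
     msf_interval ps ` {1..length ps} \<union> (\<lambda>j. uminus ` msf_interval ps j) ` {1..length ps}"

end

theory Submission
  imports Defs "HOL-Probability.Sinc_Integral"
begin

text \<open>
  A bounded measurable set \<open>K\<close> is a wavelet set as soon as its integer translates and its dilates by powers of
  two each cover almost every point exactly once, and a polygonal is a device for producing
  such sets.

  That a polygonal does so is combinatorial. Modulo 1 the intervals of a polygonal are the
  cells between consecutive knots \<open>a\<^sub>0, \<dots>, a\<^sub>n\<close>, hence they fill \<open>[0, 1/2]\<close>, and their
  negatives fill \<open>[-1/2, 0]\<close>. The formula for \<open>a\<^sub>j\<close> says that the right end of \<open>2 powi (-
  \<lambda>\<^sub>j)\<close> times the \<open>j\<close>-th interval is the left end of \<open>2 powi (- \<lambda>\<^sub>j\<^sub>+\<^sub>1)\<close> times the next one.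
  The scaled intervals are therefore consecutive, and the conditions on the first and the last
  vertex make them fill \<open>[m\<^sub>1, 2 m\<^sub>1]\<close>, a fundamental domain for the dilations of the
  half-line. Conversely the set shows which integer translate of a cell belongs to it; this
  translate changes at every inner knot, so the set determines the knots and the \<open>m\<^sub>j\<close>, and
  then the agreement of the scaled ends determines the \<open>\<lambda>\<^sub>j\<close>, starting from \<open>\<lambda>\<^sub>1 = 0\<close>.

  That tiling sets are wavelet sets (\<open>wavelet_set_if_tiles\<close>) is analysis. Let \<open>\<psi>\<close> be the
  inverse Fourier transform of the indicator of \<open>K\<close>. The transforms of its dilated translates
  are dilates of exponentials restricted to \<open>K\<close>. The exponentials with integer frequencies
  form an orthonormal basis on the unit interval, hence on every set that tiles by
  translations, and since the dilates of \<open>K\<close> partition the line, the dilated families together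
  form an orthonormal basis. The Fourier transform carries this back to the wavelet system.

  The transport rests on Plancherel's theorem for functions of bounded support
  (\<open>plancherel_norm\<close>). It comes from the one integral of \<open>(sin t / t)\<^sup>2\<close>, which gives the norm
  of the transform of an interval; polarization extends this to step functions and density to
  all functions of bounded support. Inversion (\<open>fourier_inversion\<close>) is then a computation with
  norms: truncating the transform of \<open>g\<close> and transforming back misses \<open>g\<close> by exactly the norm
  of the part cut off.
\<close>

section \<open>The space of square-integrable functions\<close>

lemma L2_measurable: "f \<in> L2 \<Longrightarrow> f \<in> borel_measurable lebesgue"
  by (simp add: L2_def)

lemma L2_integrable: "f \<in> L2 \<Longrightarrow> integrable lebesgue (\<lambda>x. (cmod (f x))\<^sup>2)"
  by (simp add: L2_def)

lemma L2_dominated: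
  assumes "g \<in> L2" "f \<in> borel_measurable lebesgue"
    and "AE x in lebesgue. cmod (f x) \<le> cmod (g x)"
  shows "f \<in> L2"
proof -
  have [measurable]: "f \<in> borel_measurable lebesgue" by fact
  have "integrable lebesgue (\<lambda>x. (cmod (f x))\<^sup>2)"
    by (rule Bochner_Integration.integrable_bound[OF L2_integrable[OF assms(1)]])
       (use assms(3) in \<open>auto simp: power_mono\<close>)
  then show ?thesis using assms(2) by (simp add: L2_def)
qed

lemma L2_zero [simp]: "(\<lambda>_. 0) \<in> L2"
  by (simp add: L2_def)

lemma L2_add:
  assumes "f \<in> L2" "g \<in> L2"
  shows "(\<lambda>x. f x + g x) \<in> L2"
proof -
  have [measurable]: "f \<in> borel_measurable lebesgue" "g \<in> borel_measurable lebesgue"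
    using assms by (auto dest: L2_measurable)
  have bound: "(cmod (a + b))\<^sup>2 \<le> 2 * (cmod a)\<^sup>2 + 2 * (cmod b)\<^sup>2" for a b
  proof -
    have "(cmod (a + b))\<^sup>2 \<le> (cmod a + cmod b)\<^sup>2"
      by (intro power_mono norm_triangle_ineq) auto
    also have "\<dots> \<le> 2 * (cmod a)\<^sup>2 + 2 * (cmod b)\<^sup>2"
      using zero_le_power2[of "cmod a - cmod b"] by (simp add: power2_eq_square algebra_simps)
    finally show ?thesis .
  qed
  have "integrable lebesgue (\<lambda>x. (cmod (f x + g x))\<^sup>2)"
    by (rule Bochner_Integration.integrable_bound[where f =
          "\<lambda>x. 2 * (cmod (f x))\<^sup>2 + 2 * (cmod (g x))\<^sup>2"])
       (auto intro!: L2_integrable assms bound)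
  then show ?thesis by (simp add: L2_def)
qed

lemma L2_cmult:
  assumes "f \<in> L2"
  shows "(\<lambda>x. c * f x) \<in> L2"
  using L2_measurable[OF assms] L2_integrable[OF assms]
  by (auto simp: L2_def norm_mult power_mult_distrib)

lemma L2_diff: "f \<in> L2 \<Longrightarrow> g \<in> L2 \<Longrightarrow> (\<lambda>x. f x - g x) \<in> L2"
  using L2_add[of f "\<lambda>x. (-1) * g x"] L2_cmult[of g "-1"] by simp

lemma L2_norm_nonneg: "0 \<le> L2_norm f"
  by (simp add: L2_norm_def)

lemma L2_norm_power2: "(L2_norm f)\<^sup>2 = (LINT x|lebesgue. (cmod (f x))\<^sup>2)"
  by (simp add: L2_norm_def)

lemma L2_norm_zero [simp]: "L2_norm (\<lambda>_. 0) = 0"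
  by (simp add: L2_norm_def)

lemma L2_norm_cong_AE:
  assumes "f \<in> borel_measurable lebesgue" "g \<in> borel_measurable lebesgue"
    and "AE x in lebesgue. cmod (f x) = cmod (g x)"
  shows "L2_norm f = L2_norm g"
proof -
  have [measurable]: "f \<in> borel_measurable lebesgue" "g \<in> borel_measurable lebesgue" by fact+
  show ?thesis unfolding L2_norm_def
    by (rule arg_cong[where f = sqrt], rule integral_cong_AE) (use assms(3) in auto)
qed

lemma L2_norm_mono:
  assumes "f \<in> borel_measurable lebesgue" "g \<in> L2"
    and "AE x in lebesgue. cmod (f x) \<le> cmod (g x)"
  shows "L2_norm f \<le> L2_norm g"
  unfolding L2_norm_def
  by (intro real_sqrt_le_mono integral_mono_AE L2_integrable assms L2_dominated[OF assms(2,1,3)])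
     (use assms(3) in \<open>auto simp: power_mono\<close>)

lemma L2_norm_cmult: "L2_norm (\<lambda>x. c * f x) = cmod c * L2_norm f"
  by (simp add: L2_norm_def norm_mult power_mult_distrib real_sqrt_mult)

lemma L2_norm_minus_commute: "L2_norm (\<lambda>x. f x - g x) = L2_norm (\<lambda>x. g x - f x)"
  by (simp add: L2_norm_def norm_minus_commute)

lemma L2_norm_mult_integrable:
  assumes "f \<in> L2" "g \<in> L2"
  shows "integrable lebesgue (\<lambda>x. cmod (f x) * cmod (g x))"
proof -
  have [measurable]: "f \<in> borel_measurable lebesgue" "g \<in> borel_measurable lebesgue"
    using assms by (auto dest: L2_measurable)
  have *: "a * b \<le> a\<^sup>2 + b\<^sup>2" if "0 \<le> a" "0 \<le> b" for a b :: real
    using zero_le_power2[of "a - b"] mult_nonneg_nonneg[OF that]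
    by (simp add: power2_eq_square algebra_simps)
  show ?thesis
    by (rule Bochner_Integration.integrable_bound[where f =
          "\<lambda>x. (cmod (f x))\<^sup>2 + (cmod (g x))\<^sup>2"])
       (auto intro!: L2_integrable assms * simp: abs_mult)
qed

lemma borel_measurable_cnj [measurable]: "cnj \<in> borel_measurable borel"
  by (intro borel_measurable_continuous_onI continuous_intros)

lemma L2_inner_integrable:
  assumes "f \<in> L2" "g \<in> L2"
  shows "integrable lebesgue (\<lambda>x. f x * cnj (g x))"
proof -
  have [measurable]: "f \<in> borel_measurable lebesgue" "g \<in> borel_measurable lebesgue"
    using assms by (auto dest: L2_measurable)
  show ?thesis
    by (rule Bochner_Integration.integrable_bound[OF L2_norm_mult_integrable[OF assms]])
       (auto simp: norm_mult)
qed

lemma L2_Cauchy_Schwarz_integral: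
  assumes "f \<in> L2" "g \<in> L2"
  shows "(LINT x|lebesgue. cmod (f x) * cmod (g x)) \<le> L2_norm f * L2_norm g"
proof -
  define I where "I = (LINT x|lebesgue. cmod (f x) * cmod (g x))"
  define A where "A = (L2_norm f)\<^sup>2"
  define B where "B = (L2_norm g)\<^sup>2"
  have AB: "A \<ge> 0" "B \<ge> 0" by (simp_all add: A_def B_def)
  have quad: "0 \<le> s\<^sup>2 * A - 2 * s * I + B" for s
  proof -
    have "0 \<le> (LINT x|lebesgue. (s * cmod (f x) - cmod (g x))\<^sup>2)"
      by (rule Bochner_Integration.integral_nonneg) simp
    also have "\<dots> = (LINT x|lebesgue. s\<^sup>2 * (cmod (f x))\<^sup>2 - 2 * s * (cmod (f x) * cmod (g x))
        + (cmod (g x))\<^sup>2)"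
      by (rule Bochner_Integration.integral_cong) (auto simp: power2_eq_square algebra_simps)
    also have "\<dots> = s\<^sup>2 * A - 2 * s * I + B"
      unfolding A_def B_def I_def L2_norm_power2
      using L2_integrable[OF assms(1)] L2_integrable[OF assms(2)] L2_norm_mult_integrable[OF assms]
      by simp
    finally show ?thesis .
  qed
  have "I\<^sup>2 \<le> A * B"
  proof (cases "A = 0")
    case True
    have "I = 0"
    proof (rule ccontr)
      assume "I \<noteq> 0"
      then have "2 * ((B + 1) / (2 * I)) * I = B + 1" by simp
      then show False using quad[of "(B + 1) / (2 * I)"] True by simp
    qed
    then show ?thesis using True by simp
  next
    case False
    then show ?thesis
      using quad[of "I / A"] AB by (simp add: field_simps power2_eq_square)
  qed
  also have "\<dots> = (L2_norm f * L2_norm g)\<^sup>2"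
    by (simp add: A_def B_def power_mult_distrib)
  finally show ?thesis unfolding I_def
    by (rule power2_le_imp_le) (simp add: L2_norm_nonneg)
qed

lemma L2_norm_triangle:
  assumes "f \<in> L2" "g \<in> L2"
  shows "L2_norm (\<lambda>x. f x + g x) \<le> L2_norm f + L2_norm g"
proof (rule power2_le_imp_le)
  have "(L2_norm (\<lambda>x. f x + g x))\<^sup>2
      \<le> (LINT x|lebesgue. (cmod (f x))\<^sup>2 + 2 * (cmod (f x) * cmod (g x)) + (cmod (g x))\<^sup>2)"
    unfolding L2_norm_power2
  proof (rule integral_mono)
    show "(cmod (f x + g x))\<^sup>2 \<le> (cmod (f x))\<^sup>2 + 2 * (cmod (f x) * cmod (g x)) + (cmod (g x))\<^sup>2"
      for x
    proof -
      have "(cmod (f x + g x))\<^sup>2 \<le> (cmod (f x) + cmod (g x))\<^sup>2"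
        by (intro power_mono norm_triangle_ineq) auto
      then show ?thesis by (simp add: power2_eq_square algebra_simps)
    qed
  qed (use L2_integrable[OF assms(1)] L2_integrable[OF assms(2)] L2_norm_mult_integrable[OF assms]
      L2_integrable[OF L2_add[OF assms]] in auto)
  also have "\<dots> = (L2_norm f)\<^sup>2 + 2 * (LINT x|lebesgue. cmod (f x) * cmod (g x)) + (L2_norm g)\<^sup>2"
    unfolding L2_norm_power2
    using L2_integrable[OF assms(1)] L2_integrable[OF assms(2)] L2_norm_mult_integrable[OF assms]
    by simp
  also have "\<dots> \<le> (L2_norm f + L2_norm g)\<^sup>2"
    using L2_Cauchy_Schwarz_integral[OF assms] by (simp add: power2_eq_square algebra_simps)
  finally show "(L2_norm (\<lambda>x. f x + g x))\<^sup>2 \<le> (L2_norm f + L2_norm g)\<^sup>2" .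
qed (simp add: L2_norm_nonneg)

lemma L2_norm_triangle_diff:
  assumes "f \<in> L2" "g \<in> L2" "h \<in> L2"
  shows "L2_norm (\<lambda>x. f x - h x) \<le> L2_norm (\<lambda>x. f x - g x) + L2_norm (\<lambda>x. g x - h x)"
  using L2_norm_triangle[OF L2_diff[OF assms(1,2)] L2_diff[OF assms(2,3)]] by simp

lemma L2_norm_le_add_diff:
  assumes "f \<in> L2" "g \<in> L2"
  shows "L2_norm f \<le> L2_norm g + L2_norm (\<lambda>x. f x - g x)"
  using L2_norm_triangle[OF assms(2) L2_diff[OF assms]] by simp

lemma L2_inner_add_left:
  "f \<in> L2 \<Longrightarrow> g \<in> L2 \<Longrightarrow> h \<in> L2 \<Longrightarrow>
    L2_inner (\<lambda>x. f x + g x) h = L2_inner f h + L2_inner g h"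
  unfolding L2_inner_def
  using L2_inner_integrable[of f h] L2_inner_integrable[of g h] by (simp add: ring_distribs)

lemma L2_inner_cmult_left: "L2_inner (\<lambda>x. c * f x) h = c * L2_inner f h"
  by (simp add: L2_inner_def mult.assoc)

lemma L2_inner_cnj: "cnj (L2_inner f g) = L2_inner g f"
  unfolding L2_inner_def
  by (subst Bochner_Integration.integral_cnj[symmetric]) (simp add: mult.commute)

lemma L2_inner_add_right:
  assumes "f \<in> L2" "g \<in> L2" "h \<in> L2"
  shows "L2_inner h (\<lambda>x. f x + g x) = L2_inner h f + L2_inner h g"
  using arg_cong[OF L2_inner_add_left[OF assms], of cnj] by (simp add: L2_inner_cnj)

lemma L2_inner_cmult_right: "L2_inner h (\<lambda>x. c * f x) = cnj c * L2_inner h f"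
  using arg_cong[OF L2_inner_cmult_left[of c f h], of cnj] by (simp add: L2_inner_cnj)

lemma L2_inner_diff_left:
  "f \<in> L2 \<Longrightarrow> g \<in> L2 \<Longrightarrow> h \<in> L2 \<Longrightarrow>
    L2_inner (\<lambda>x. f x - g x) h = L2_inner f h - L2_inner g h"
  using L2_inner_add_left[of f "\<lambda>x. (-1) * g x" h] L2_cmult[of g "-1"]
    L2_inner_cmult_left[of "-1" g h] by simp

lemma L2_inner_diff_right:
  "f \<in> L2 \<Longrightarrow> g \<in> L2 \<Longrightarrow> h \<in> L2 \<Longrightarrow>
    L2_inner h (\<lambda>x. f x - g x) = L2_inner h f - L2_inner h g"
  using L2_inner_add_right[of f "\<lambda>x. (-1) * g x" h] L2_cmult[of g "-1"]
    L2_inner_cmult_right[of h "-1" g] by simp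

lemma L2_inner_self: "L2_inner f f = of_real ((L2_norm f)\<^sup>2)"
proof -
  have "L2_inner f f = (LINT x|lebesgue. of_real ((cmod (f x))\<^sup>2))"
    unfolding L2_inner_def by (simp only: complex_norm_square)
  then show ?thesis unfolding L2_norm_power2 by (simp only: integral_complex_of_real)
qed

lemma L2_norm_diff_power2:
  assumes "f \<in> L2" "g \<in> L2"
  shows "(L2_norm (\<lambda>x. f x - g x))\<^sup>2 = (L2_norm f)\<^sup>2 - 2 * Re (L2_inner f g) + (L2_norm g)\<^sup>2"
proof -
  have "of_real ((L2_norm (\<lambda>x. f x - g x))\<^sup>2) = L2_inner (\<lambda>x. f x - g x) (\<lambda>x. f x - g x)"
    by (simp only: L2_inner_self)
  also have "\<dots> = L2_inner f f - L2_inner f g - (cnj (L2_inner f g) - L2_inner g g)"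
    using assms by (simp add: L2_inner_diff_left L2_inner_diff_right L2_diff L2_inner_cnj)
  finally have "Re (of_real ((L2_norm (\<lambda>x. f x - g x))\<^sup>2))
      = Re (L2_inner f f - L2_inner f g - (cnj (L2_inner f g) - L2_inner g g))" by (rule arg_cong)
  then show ?thesis by (simp add: L2_inner_self)
qed

text \<open>
  The square of \<open>cmod (F n x - f x)\<close> is bounded by \<open>4 * (cmod (g x))\<^sup>2\<close>, so this is the
  dominated convergence theorem for these squares.
\<close>

lemma L2_dominated_convergence:
  assumes "g \<in> L2" "\<And>n. F n \<in> borel_measurable lebesgue" "f \<in> borel_measurable lebesgue"
    and lim: "AE x in lebesgue. (\<lambda>n. F n x) \<longlonglongrightarrow> f x"
    and bound: "\<And>n. AE x in lebesgue. cmod (F n x) \<le> cmod (g x)"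
  shows "L2_converges F f"
proof -
  have [measurable]: "F n \<in> borel_measurable lebesgue" "f \<in> borel_measurable lebesgue"
    "g \<in> borel_measurable lebesgue" for n
    using assms by (auto dest: L2_measurable)
  have bound_f: "AE x in lebesgue. cmod (f x) \<le> cmod (g x)"
  proof -
    have "AE x in lebesgue. \<forall>n. cmod (F n x) \<le> cmod (g x)"
      using bound by (simp add: AE_all_countable)
    with lim show ?thesis
    proof eventually_elim
      case (elim x)
      show ?case
        by (rule Lim_bounded[OF tendsto_norm[OF elim(1)]]) (use elim in auto)
    qed
  qed
  have "(\<lambda>n. LINT x|lebesgue. (cmod (F n x - f x))\<^sup>2) \<longlonglongrightarrow> integral\<^sup>L lebesgue (\<lambda>_ :: real. 0 :: real)"
  proof (rule Bochner_Integration.integral_dominated_convergence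
        [where w = "\<lambda>x. 4 * (cmod (g x))\<^sup>2"])
    show "integrable lebesgue (\<lambda>x. 4 * (cmod (g x))\<^sup>2)"
      using L2_integrable[OF assms(1)] by simp
    show "AE x in lebesgue. (\<lambda>n. (cmod (F n x - f x))\<^sup>2) \<longlonglongrightarrow> 0"
      using lim
    proof eventually_elim
      case (elim x)
      have "(\<lambda>n. (cmod (F n x - f x))\<^sup>2) \<longlonglongrightarrow> (cmod (f x - f x))\<^sup>2"
        by (intro tendsto_intros elim)
      then show ?case by simp
    qed
    show "AE x in lebesgue. norm ((cmod (F n x - f x))\<^sup>2) \<le> 4 * (cmod (g x))\<^sup>2" for n
      using bound[of n] bound_f
    proof eventually_elim
      case (elim x)
      have "(cmod (F n x - f x))\<^sup>2 \<le> (2 * cmod (g x))\<^sup>2"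
        by (rule power_mono) (use norm_triangle_ineq4[of "F n x" "f x"] elim in auto)
      then show ?case by (simp add: power_mult_distrib)
    qed
  qed auto
  then have "(\<lambda>n. L2_norm (\<lambda>x. F n x - f x)) \<longlonglongrightarrow> sqrt 0"
    unfolding L2_norm_def by (intro tendsto_real_sqrt) simp
  then show ?thesis
    unfolding L2_converges_def
    using L2_dominated[OF assms(1) _ bound] L2_dominated[OF assms(1) _ bound_f] by auto
qed

section \<open>Linear spans and their closures\<close>

inductive_set lin_span :: "(real \<Rightarrow> complex) set \<Rightarrow> (real \<Rightarrow> complex) set"
  for E where
  base: "f \<in> E \<Longrightarrow> f \<in> lin_span E"
| zero: "(\<lambda>_. 0) \<in> lin_span E"
| add: "f \<in> lin_span E \<Longrightarrow> g \<in> lin_span E \<Longrightarrow> (\<lambda>x. f x + g x) \<in> lin_span E"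
| cmult: "f \<in> lin_span E \<Longrightarrow> (\<lambda>x. c * f x) \<in> lin_span E"

definition closed_span :: "(real \<Rightarrow> complex) set \<Rightarrow> (real \<Rightarrow> complex) set" where
  "closed_span E = {f \<in> L2. \<forall>\<epsilon>>0. \<exists>g\<in>lin_span E. L2_norm (\<lambda>x. f x - g x) < \<epsilon>}"

lemma lin_span_L2:
  assumes "E \<subseteq> L2"
  shows "lin_span E \<subseteq> L2"
proof
  fix f assume "f \<in> lin_span E"
  then show "f \<in> L2" by induction (use assms in \<open>auto intro: L2_add L2_cmult\<close>)
qed

lemma lin_span_sum:
  assumes "finite S" "\<And>i. i \<in> S \<Longrightarrow> f i \<in> lin_span E"
  shows "(\<lambda>x. \<Sum>i\<in>S. f i x) \<in> lin_span E"
  using assms by (induction S rule: finite_induct) (auto intro: lin_span.intros)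

text \<open>
  Rewrites a combination of functions as one over indices, which is the form in which an
  orthonormal basis is required to approximate.
\<close>

lemma lin_span_range_sum:
  assumes "f \<in> lin_span (range e)"
  shows "\<exists>S c. finite S \<and> f = (\<lambda>x. \<Sum>i\<in>S. c i * e i x)"
  using assms
proof induction
  case (base f)
  then obtain i where "f = e i" by auto
  then show ?case by (intro exI[of _ "{i}"] exI[of _ "\<lambda>_. 1"]) auto
next
  case zero
  show ?case by (intro exI[of _ "{}"]) auto
next
  case (add f g)
  then obtain S c T d where *: "finite S" "f = (\<lambda>x. \<Sum>i\<in>S. c i * e i x)"
    "finite T" "g = (\<lambda>x. \<Sum>i\<in>T. d i * e i x)" by blast
  define c' where "c' i = (if i \<in> S then c i else 0)" for i
  define d' where "d' i = (if i \<in> T then d i else 0)" for i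
  have "f x = (\<Sum>i\<in>S \<union> T. c' i * e i x)" for x
    unfolding *(2) by (rule sum.mono_neutral_cong_left) (use * in \<open>auto simp: c'_def\<close>)
  moreover have "g x = (\<Sum>i\<in>S \<union> T. d' i * e i x)" for x
    unfolding *(4) by (rule sum.mono_neutral_cong_left) (use * in \<open>auto simp: d'_def\<close>)
  ultimately show ?case
    using * by (intro exI[of _ "S \<union> T"] exI[of _ "\<lambda>i. c' i + d' i"])
      (auto simp: ring_distribs sum.distrib)
next
  case (cmult f a)
  then obtain S c where "finite S" "f = (\<lambda>x. \<Sum>i\<in>S. c i * e i x)" by blast
  then show ?case
    by (intro exI[of _ S] exI[of _ "\<lambda>i. a * c i"]) (auto simp: sum_distrib_left mult.assoc)
qed

lemma closed_span_L2: "closed_span E \<subseteq> L2"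
  by (auto simp: closed_span_def)

lemma closed_spanI:
  assumes "f \<in> L2" "\<And>\<epsilon>. \<epsilon> > 0 \<Longrightarrow> \<exists>g\<in>lin_span E. L2_norm (\<lambda>x. f x - g x) < \<epsilon>"
  shows "f \<in> closed_span E"
  using assms by (auto simp: closed_span_def)

lemma closed_span_approx:
  assumes "f \<in> closed_span E" "\<epsilon> > 0"
  obtains g where "g \<in> lin_span E" "L2_norm (\<lambda>x. f x - g x) < \<epsilon>"
  using assms by (auto simp: closed_span_def)

lemma lin_span_subset_closed_span:
  assumes "E \<subseteq> L2"
  shows "lin_span E \<subseteq> closed_span E"
proof
  fix f assume f: "f \<in> lin_span E"
  show "f \<in> closed_span E"
    using lin_span_L2[OF assms] f by (intro closed_spanI) (auto intro!: bexI[of _ f])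
qed

lemma closed_span_limit:
  assumes "E \<subseteq> L2" "f \<in> L2"
    and "\<And>\<epsilon>. \<epsilon> > 0 \<Longrightarrow> \<exists>g\<in>closed_span E. L2_norm (\<lambda>x. f x - g x) < \<epsilon>"
  shows "f \<in> closed_span E"
proof (rule closed_spanI[OF assms(2)])
  fix \<epsilon> :: real assume "\<epsilon> > 0"
  then obtain g where g: "g \<in> closed_span E" "L2_norm (\<lambda>x. f x - g x) < \<epsilon> / 2"
    using assms(3)[of "\<epsilon> / 2"] by auto
  obtain h where h: "h \<in> lin_span E" "L2_norm (\<lambda>x. g x - h x) < \<epsilon> / 2"
    using closed_span_approx[OF g(1)] \<open>\<epsilon> > 0\<close> by (metis half_gt_zero)
  have "L2_norm (\<lambda>x. f x - h x) < \<epsilon>"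
    using L2_norm_triangle_diff[of f g h] assms(2) g h closed_span_L2 lin_span_L2[OF assms(1)]
    by fastforce
  then show "\<exists>h\<in>lin_span E. L2_norm (\<lambda>x. f x - h x) < \<epsilon>" using h by blast
qed

lemma closed_span_converges:
  assumes "E \<subseteq> L2" "L2_converges F f" "\<And>n. F n \<in> closed_span E"
  shows "f \<in> closed_span E"
proof (rule closed_span_limit[OF assms(1)])
  show "f \<in> L2" using assms(2) by (simp add: L2_converges_def)
  fix \<epsilon> :: real assume "\<epsilon> > 0"
  moreover have "(\<lambda>n. L2_norm (\<lambda>x. F n x - f x)) \<longlonglongrightarrow> 0"
    using assms(2) by (simp add: L2_converges_def)
  ultimately obtain n where "L2_norm (\<lambda>x. F n x - f x) < \<epsilon>"
    by (metis (no_types, lifting) eventually_sequentially order.refl order_tendstoD(2))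
  then show "\<exists>g\<in>closed_span E. L2_norm (\<lambda>x. f x - g x) < \<epsilon>"
    using assms(3) by (auto simp: L2_norm_minus_commute[of f] intro!: bexI[of _ "F n"])
qed

lemma closed_span_add:
  assumes "E \<subseteq> L2" "f \<in> closed_span E" "g \<in> closed_span E"
  shows "(\<lambda>x. f x + g x) \<in> closed_span E"
proof (rule closed_spanI)
  show "(\<lambda>x. f x + g x) \<in> L2" using assms closed_span_L2 by (blast intro: L2_add)
  fix \<epsilon> :: real assume "\<epsilon> > 0"
  obtain f' where f': "f' \<in> lin_span E" "L2_norm (\<lambda>x. f x - f' x) < \<epsilon> / 2"
    using closed_span_approx[OF assms(2)] \<open>\<epsilon> > 0\<close> by (metis half_gt_zero)
  obtain g' where g': "g' \<in> lin_span E" "L2_norm (\<lambda>x. g x - g' x) < \<epsilon> / 2"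
    using closed_span_approx[OF assms(3)] \<open>\<epsilon> > 0\<close> by (metis half_gt_zero)
  have "(\<lambda>x. f x - f' x) \<in> L2" "(\<lambda>x. g x - g' x) \<in> L2"
    using assms f' g' closed_span_L2 lin_span_L2[OF assms(1)] by (blast intro: L2_diff)+
  from L2_norm_triangle[OF this]
  have "L2_norm (\<lambda>x. (f x + g x) - (f' x + g' x)) < \<epsilon>"
    using f' g' by (simp add: algebra_simps)
  then show "\<exists>h\<in>lin_span E. L2_norm (\<lambda>x. (f x + g x) - h x) < \<epsilon>"
    using lin_span.add[OF f'(1) g'(1)] by (rule bexI)
qed

lemma closed_span_cmult:
  assumes "E \<subseteq> L2" "f \<in> closed_span E"
  shows "(\<lambda>x. c * f x) \<in> closed_span E"
proof (rule closed_spanI)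
  show "(\<lambda>x. c * f x) \<in> L2" using assms closed_span_L2 by (blast intro: L2_cmult)
  fix \<epsilon> :: real assume "\<epsilon> > 0"
  then have "\<epsilon> / (cmod c + 1) > 0" by (simp add: add_nonneg_pos)
  then obtain f' where f': "f' \<in> lin_span E" "L2_norm (\<lambda>x. f x - f' x) < \<epsilon> / (cmod c + 1)"
    using closed_span_approx[OF assms(2)] by metis
  have "L2_norm (\<lambda>x. c * f x - c * f' x) = cmod c * L2_norm (\<lambda>x. f x - f' x)"
    using L2_norm_cmult[of c "\<lambda>x. f x - f' x"] by (simp add: right_diff_distrib)
  also have "\<dots> \<le> (cmod c + 1) * L2_norm (\<lambda>x. f x - f' x)"
    by (intro mult_right_mono) (auto simp: L2_norm_nonneg)
  also have "\<dots> < \<epsilon>"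
    using f'(2) by (subst (asm) pos_less_divide_eq) (simp_all add: mult.commute add_nonneg_pos)
  finally show "\<exists>h\<in>lin_span E. L2_norm (\<lambda>x. c * f x - h x) < \<epsilon>"
    using lin_span.cmult[OF f'(1), of c] by (rule bexI)
qed

lemma closed_span_zero: "E \<subseteq> L2 \<Longrightarrow> (\<lambda>_. 0) \<in> closed_span E"
  using lin_span_subset_closed_span lin_span.zero by blast

lemma closed_span_sum:
  assumes "E \<subseteq> L2" "finite S" "\<And>i. i \<in> S \<Longrightarrow> f i \<in> closed_span E"
  shows "(\<lambda>x. \<Sum>i\<in>S. f i x) \<in> closed_span E"
  using assms(2,3)
  by (induction S rule: finite_induct)
     (use assms(1) in \<open>auto intro: closed_span_zero closed_span_add\<close>)

text \<open>
  Density of one family follows from density of another as soon as the second is approximated by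
  the first.
\<close>

lemma closed_span_minimal:
  assumes "E' \<subseteq> L2" "E \<subseteq> closed_span E'"
  shows "closed_span E \<subseteq> closed_span E'"
proof
  fix f assume f: "f \<in> closed_span E"
  have *: "g \<in> closed_span E'" if "g \<in> lin_span E" for g
    using that
    by induction (use assms in \<open>auto intro: closed_span_zero closed_span_add closed_span_cmult\<close>)
  show "f \<in> closed_span E'"
  proof (rule closed_span_limit[OF assms(1)])
    show "f \<in> L2" using f closed_span_L2 by auto
    fix \<epsilon> :: real assume "\<epsilon> > 0"
    then obtain g where "g \<in> lin_span E" "L2_norm (\<lambda>x. f x - g x) < \<epsilon>"
      using closed_span_approx[OF f] by blast
    with * show "\<exists>g\<in>closed_span E'. L2_norm (\<lambda>x. f x - g x) < \<epsilon>" by blast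
  qed
qed

lemma closed_span_cong_AE:
  assumes "E \<subseteq> L2" "g \<in> closed_span E" "f \<in> borel_measurable lebesgue"
    and "AE x in lebesgue. f x = g x"
  shows "f \<in> closed_span E"
proof (rule closed_span_limit[OF assms(1)])
  have g: "g \<in> L2" using assms(2) closed_span_L2 by auto
  show f: "f \<in> L2"
    by (rule L2_dominated[OF g assms(3)]) (use assms(4) in auto)
  have "L2_norm (\<lambda>x. f x - g x) = L2_norm (\<lambda>_. 0)"
    by (rule L2_norm_cong_AE) (use assms(4) L2_measurable[OF L2_diff[OF f g]] in auto)
  then show "\<exists>g\<in>closed_span E. L2_norm (\<lambda>x. f x - g x) < \<epsilon>" if "\<epsilon> > 0" for \<epsilon>
    using that assms(2) by (intro bexI[of _ g]) auto
qed

text \<open>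
  Operators are only ever given on a linear subspace \<open>W\<close> (integrable functions, say), where they
  are norm-decreasing.  Such an operator carries approximations to approximations; this one
  transfer principle is used for the Fourier transform, for dilations and for the passage
  from the unit interval to a set that tiles by translations.
\<close>

definition L2_contraction :: "(real \<Rightarrow> complex) set \<Rightarrow> ((real \<Rightarrow> complex) \<Rightarrow> real \<Rightarrow> complex) \<Rightarrow> bool"
  where "L2_contraction W U \<longleftrightarrow> W \<subseteq> L2 \<and>
    (\<forall>f\<in>W. \<forall>g\<in>W. (\<lambda>x. f x + g x) \<in> W \<and> U (\<lambda>x. f x + g x) = (\<lambda>x. U f x + U g x)) \<and>
    (\<forall>f\<in>W. \<forall>c. (\<lambda>x. c * f x) \<in> W \<and> U (\<lambda>x. c * f x) = (\<lambda>x. c * U f x)) \<and>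
    (\<forall>f\<in>W. U f \<in> L2 \<and> L2_norm (U f) \<le> L2_norm f)"

lemma L2_contractionD:
  assumes "L2_contraction W U" "f \<in> W"
  shows "f \<in> L2" "U f \<in> L2" "L2_norm (U f) \<le> L2_norm f"
    and "(\<lambda>x. c * f x) \<in> W" "U (\<lambda>x. c * f x) = (\<lambda>x. c * U f x)"
    and "g \<in> W \<Longrightarrow> (\<lambda>x. f x + g x) \<in> W"
    and "g \<in> W \<Longrightarrow> U (\<lambda>x. f x + g x) = (\<lambda>x. U f x + U g x)"
  using assms by (auto simp: L2_contraction_def)

lemma L2_contraction_diff:
  assumes "L2_contraction W U" "f \<in> W" "g \<in> W"
  shows "(\<lambda>x. f x - g x) \<in> W" "U (\<lambda>x. f x - g x) = (\<lambda>x. U f x - U g x)"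
proof -
  note neg = L2_contractionD(4,5)[OF assms(1,3), of "-1"]
  show "(\<lambda>x. f x - g x) \<in> W" "U (\<lambda>x. f x - g x) = (\<lambda>x. U f x - U g x)"
    using L2_contractionD(6,7)[OF assms(1,2) neg(1)] unfolding neg(2) by simp_all
qed

lemma closed_span_contraction:
  assumes U: "L2_contraction W U" and E: "E \<subseteq> W" and f: "f \<in> W" "f \<in> closed_span E"
  shows "U f \<in> closed_span (U ` E)"
proof (rule closed_spanI)
  show "U f \<in> L2" by (rule L2_contractionD(2)[OF U f(1)])
  have span: "g \<in> W \<and> U g \<in> lin_span (U ` E)" if "g \<in> lin_span E" for g
    using that
  proof induction
    case (base g)
    then show ?case using E by (auto intro: lin_span.base)
  next
    case zero
    show ?case
      using L2_contractionD(4,5)[OF U f(1), of 0] by (simp add: lin_span.zero)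
  next
    case (add g h)
    then have *: "g \<in> W" "h \<in> W" by auto
    show ?case
      using L2_contractionD(6,7)[OF U *] add by (auto intro: lin_span.add)
  next
    case (cmult g c)
    then have "g \<in> W" by auto
    from L2_contractionD(4,5)[OF U this, of c] cmult show ?case by (auto intro: lin_span.cmult)
  qed
  fix \<epsilon> :: real assume "\<epsilon> > 0"
  then obtain g where g: "g \<in> lin_span E" "L2_norm (\<lambda>x. f x - g x) < \<epsilon>"
    using closed_span_approx[OF f(2)] by blast
  then have *: "g \<in> W" "U g \<in> lin_span (U ` E)" using span by auto
  have "L2_norm (\<lambda>x. U f x - U g x) \<le> L2_norm (\<lambda>x. f x - g x)"
    using L2_contractionD(3)[OF U L2_contraction_diff(1)[OF U f(1) *(1)]]
    unfolding L2_contraction_diff(2)[OF U f(1) *(1)] .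
  with g * show "\<exists>h\<in>lin_span (U ` E). L2_norm (\<lambda>x. U f x - h x) < \<epsilon>"
    by (intro bexI[of _ "U g"]) auto
qed

text \<open>
  Polarization: the real part of an inner product is read off from the norms of the two functions
  and of their difference, the imaginary part is the real part after multiplication by \<open>\<i>\<close>.
\<close>

lemma L2_isometry_inner:
  assumes U: "L2_contraction W U" and norm: "\<And>f. f \<in> W \<Longrightarrow> L2_norm (U f) = L2_norm f"
    and f: "f \<in> W" and g: "g \<in> W"
  shows "L2_inner (U f) (U g) = L2_inner f g"
proof -
  note D = L2_contractionD[OF U]
  have re: "Re (L2_inner (U f) (U h)) = Re (L2_inner f h)" if h: "h \<in> W" for h
  proof -
    note diff = L2_contraction_diff[OF U f h]
    have "(L2_norm (\<lambda>x. U f x - U h x))\<^sup>2 = (L2_norm (\<lambda>x. f x - h x))\<^sup>2"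
      using norm[OF diff(1)] by (simp add: diff(2))
    then show ?thesis
      using L2_norm_diff_power2[OF D(1)[OF f] D(1)[OF h]]
        L2_norm_diff_power2[OF D(2)[OF f] D(2)[OF h]] norm[OF f] norm[OF h] by simp
  qed
  have "Im (L2_inner (U f) (U g)) = Im (L2_inner f g)"
    using re[OF D(4)[OF g, of \<i>]] unfolding D(5)[OF g, of \<i>]
    by (simp add: L2_inner_cmult_right)
  with re[OF g] show ?thesis by (simp add: complex_eq_iff)
qed

section \<open>Changes of variable and density of step functions\<close>

lemma measurable_lebesgue_real_affine:
  fixes c t :: real
  assumes "c \<noteq> 0"
  shows "(\<lambda>x. t + c * x) \<in> lebesgue \<rightarrow>\<^sub>M lebesgue"
  using lebesgue_affine_measurable[where c = "\<lambda>x::real. c"] assms by simp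

lemma borel_measurable_lebesgue_real_affine:
  fixes f :: "real \<Rightarrow> 'a :: topological_space"
  assumes "f \<in> borel_measurable lebesgue" "c \<noteq> 0"
  shows "(\<lambda>x. f (t + c * x)) \<in> borel_measurable lebesgue"
  using measurable_compose[OF measurable_lebesgue_real_affine[OF assms(2)] assms(1)] .

lemma L2_affine:
  assumes "f \<in> L2" "c \<noteq> 0"
  shows "(\<lambda>x. f (t + c * x)) \<in> L2"
    and "(L2_norm (\<lambda>x. f (t + c * x)))\<^sup>2 = (L2_norm f)\<^sup>2 / \<bar>c\<bar>"
proof -
  show "(\<lambda>x. f (t + c * x)) \<in> L2"
    using assms lebesgue_integrable_real_affine_iff[OF assms(2), of "\<lambda>x. (cmod (f x))\<^sup>2" t]
    by (auto simp: L2_def borel_measurable_lebesgue_real_affine)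
  show "(L2_norm (\<lambda>x. f (t + c * x)))\<^sup>2 = (L2_norm f)\<^sup>2 / \<bar>c\<bar>"
    using lebesgue_integral_real_affine[OF assms(2), of "\<lambda>x. (cmod (f x))\<^sup>2" t] assms(2)
    by (simp add: L2_norm_power2)
qed

lemma L2_indicator:
  assumes "A \<in> sets lebesgue" "A \<subseteq> {a..b}"
  shows "(indicator A :: real \<Rightarrow> complex) \<in> L2"
    and "(L2_norm (indicator A))\<^sup>2 = measure lebesgue A"
proof -
  have "emeasure lebesgue A \<le> emeasure lebesgue {a..b}"
    by (rule emeasure_mono) (use assms in auto)
  also have "\<dots> < \<infinity>" by (simp add: emeasure_lborel_Icc_eq)
  finally have fin: "emeasure lebesgue A < \<infinity>" .
  have eq: "(cmod (indicator A x))\<^sup>2 = indicator A x" for x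
    by (simp add: indicator_def)
  show "(indicator A :: real \<Rightarrow> complex) \<in> L2"
    using assms(1) fin by (auto simp: L2_def eq)
  show "(L2_norm (indicator A))\<^sup>2 = measure lebesgue A"
    unfolding L2_norm_power2 eq using assms(1) fin by simp
qed

text \<open>
  Half-open intervals, because then the difference of two nested intervals with a common end is
  again one of them and not merely up to a null set.
\<close>

definition step_indicators :: "(real \<Rightarrow> complex) set" where
  "step_indicators = {indicator {a<..b} | a b. True}"

lemma step_indicators_L2: "step_indicators \<subseteq> L2"
proof -
  have "(indicator {a<..b} :: real \<Rightarrow> complex) \<in> L2" for a b
    by (rule L2_indicator(1)[of _ a b]) auto
  then show ?thesis by (auto simp: step_indicators_def)
qed

text \<open>
  The rays \<open>{..a}\<close> generate the Borel sets and are stable under intersection, so it suffices to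
  pass to complements and to disjoint unions.  Inside a bounded window both only take a
  difference or a dominated limit of indicators.
\<close>

lemma indicator_borel_in_closed_span:
  fixes A :: "real set"
  assumes "A \<in> sets borel"
  shows "indicator (A \<inter> {- N<..N}) \<in> closed_span step_indicators"
proof -
  let ?J = "{- N<..N}" and ?C = "closed_span step_indicators"
  have base: "indicator {a<..b} \<in> ?C" for a b :: real
    using lin_span_subset_closed_span[OF step_indicators_L2]
    by (auto simp: step_indicators_def intro!: lin_span.base)
  have eq: "sets borel = sigma_sets UNIV (range (\<lambda>a::real. {..a}))"
    by (subst borel_eq_atMost) simp
  have stable: "Int_stable (range (\<lambda>a::real. {..a}))"
    by (auto simp: Int_stable_def)
  have closed: "range (\<lambda>a::real. {..a}) \<subseteq> Pow UNIV" by simp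
  from stable closed assms[unfolded eq] show ?thesis
  proof (induction rule: sigma_sets_induct_disjoint)
    case (basic A)
    then obtain a where "A = {..a}" by auto
    then have "A \<inter> ?J = {- N<..min a N}" by auto
    then show ?case using base by simp
  next
    case empty
    show ?case using closed_span_zero[OF step_indicators_L2] by (simp add: indicator_def[abs_def])
  next
    case (compl A)
    have "(\<lambda>x. indicator ?J x + (-1) * indicator (A \<inter> ?J) x) \<in> ?C"
      by (intro closed_span_add closed_span_cmult step_indicators_L2 base compl)
    moreover have "(\<lambda>x. indicator ?J x + (-1) * indicator (A \<inter> ?J) x :: complex)
        = indicator ((UNIV - A) \<inter> ?J)"
      by (auto simp: indicator_def)
    ultimately show ?case by simp
  next
    case (union A)
    let ?F = "\<lambda>n. indicator ((\<Union>i<n. A i) \<inter> ?J) :: real \<Rightarrow> complex"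
    have A: "A i \<in> sets lebesgue" for i
      using union(2) by (auto simp: eq[symmetric] sets_completionI_sets)
    have "?F n \<in> ?C" for n
    proof (induction n)
      case 0
      show ?case using closed_span_zero[OF step_indicators_L2] by (simp add: indicator_def[abs_def])
    next
      case (Suc n)
      have "A n \<inter> A i = {}" if "i < n" for i
        using union(1) that by (simp add: disjoint_family_on_def)
      then have disj: "((\<Union>i<n. A i) \<inter> ?J) \<inter> (A n \<inter> ?J) = {}" by blast
      have "(\<Union>i<Suc n. A i) \<inter> ?J = ((\<Union>i<n. A i) \<inter> ?J) \<union> (A n \<inter> ?J)"
        unfolding lessThan_Suc by blast
      then have "?F (Suc n) = (\<lambda>x. ?F n x + indicator (A n \<inter> ?J) x)"
        by (simp only: indicator_add[OF disj])
      moreover have "(\<lambda>x. ?F n x + indicator (A n \<inter> ?J) x) \<in> ?C"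
        by (intro closed_span_add step_indicators_L2 union Suc)
      ultimately show ?case by simp
    qed
    moreover have "L2_converges ?F (indicator ((\<Union>i. A i) \<inter> ?J))"
    proof (rule L2_dominated_convergence[where g = "indicator ?J"])
      show "AE x in lebesgue. (\<lambda>n. ?F n x) \<longlonglongrightarrow> indicator ((\<Union>i. A i) \<inter> ?J) x"
        unfolding Int_UN_distrib2 UN_simps(4)[symmetric]
        by (intro AE_I2) (simp only: Int_commute[of _ ?J] Int_UN_distrib LIMSEQ_indicator_UN)
      show "(indicator ?J :: real \<Rightarrow> complex) \<in> L2"
        using base closed_span_L2 by blast
      show "AE x in lebesgue. cmod (?F n x) \<le> cmod (indicator ?J x)" for n
        by (auto simp: indicator_def)
      have "(\<Union>i<n. A i) \<inter> ?J \<in> sets lebesgue" for n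
        using A by (intro sets.Int sets.finite_UN) auto
      then show "?F n \<in> borel_measurable lebesgue" for n by (rule borel_measurable_indicator)
      have "(\<Union>i. A i) \<inter> ?J \<in> sets lebesgue"
        using A by (intro sets.Int sets.countable_UN) auto
      then show "(indicator ((\<Union>i. A i) \<inter> ?J) :: real \<Rightarrow> complex) \<in> borel_measurable lebesgue"
        by (rule borel_measurable_indicator)
    qed
    ultimately show ?case by (rule closed_span_converges[OF step_indicators_L2, rotated])
  qed
qed

lemma indicator_lebesgue_in_closed_span:
  assumes "A \<in> sets lebesgue"
  shows "indicator (A \<inter> {- N<..N}) \<in> closed_span step_indicators"
proof -
  obtain S N' N'' where *: "A = S \<union> N'" "N' \<subseteq> N''" "N'' \<in> null_sets lborel" "S \<in> sets lborel"
    using assms by (rule sets_completionE)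
  have "AE x in lebesgue. x \<notin> N''"
    using *(3) by (intro AE_not_in) (rule null_sets_completionI)
  then have ae: "AE x in lebesgue. indicator (A \<inter> {- N<..N}) x = (indicator (S \<inter> {- N<..N}) x :: complex)"
    by eventually_elim (use * in \<open>auto simp: indicator_def\<close>)
  show ?thesis
    by (rule closed_span_cong_AE[OF step_indicators_L2 indicator_borel_in_closed_span _ ae])
       (use * assms in \<open>auto intro!: borel_measurable_indicator sets.Int\<close>)
qed

text \<open>
  A measurable function is a limit of simple functions bounded by twice its modulus.  Cut off to
  growing windows, these are finite combinations of indicators of bounded measurable sets.
\<close>

theorem step_indicators_dense: "closed_span step_indicators = L2"
proof (intro equalityI closed_span_L2 subsetI)
  fix f assume f: "f \<in> L2"
  obtain s where s: "\<And>i. simple_function lebesgue (s i)" "\<And>x. (\<lambda>i. s i x) \<longlonglongrightarrow> f x"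
    "\<And>i x. cmod (s i x) \<le> 2 * cmod (f x)"
    using borel_measurable_implies_sequence_metric[OF L2_measurable[OF f], of 0]
    by (auto simp: dist_complex_def)
  define F where "F n x = s n x * indicator {- real n<..real n} x" for n x
  have "F n \<in> closed_span step_indicators" for n
  proof -
    let ?J = "{- real n<..real n}"
    have sf: "finite (range (s n))" "\<And>y. s n -` {y} \<in> sets lebesgue"
      using simple_functionD[OF s(1)[of n]] by auto
    have "F n = (\<lambda>x. \<Sum>y\<in>range (s n). y * indicator (s n -` {y} \<inter> ?J) x)"
    proof
      fix x
      have "(\<Sum>y\<in>range (s n). y * indicator (s n -` {y} \<inter> ?J) x)
          = (\<Sum>y\<in>range (s n). if y = s n x then y * indicator ?J x else 0)"
        by (rule sum.cong) (auto simp: indicator_def)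
      then show "F n x = (\<Sum>y\<in>range (s n). y * indicator (s n -` {y} \<inter> ?J) x)"
        using sf(1) by (simp add: F_def)
    qed
    also have "\<dots> \<in> closed_span step_indicators"
      by (intro closed_span_sum closed_span_cmult step_indicators_L2 sf
          indicator_lebesgue_in_closed_span)
    finally show ?thesis .
  qed
  moreover have "L2_converges F f"
  proof (rule L2_dominated_convergence[OF L2_cmult[OF f, of 2]])
    show "F n \<in> borel_measurable lebesgue" for n
      unfolding F_def[abs_def] using borel_measurable_simple_function[OF s(1)[of n]]
      by (intro borel_measurable_times borel_measurable_indicator) auto
    show "f \<in> borel_measurable lebesgue" by (rule L2_measurable[OF f])
    show "AE x in lebesgue. cmod (F n x) \<le> cmod (2 * f x)" for n
      using s(3) by (auto simp: F_def norm_mult indicator_def)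
    have "(\<lambda>n. F n x) \<longlonglongrightarrow> f x" for x
    proof -
      obtain k :: nat where k: "\<bar>x\<bar> < real k" using reals_Archimedean2 by blast
      have "eventually (\<lambda>n. s n x = F n x) sequentially"
        using eventually_ge_at_top[of k]
        by eventually_elim (use k in \<open>auto simp: F_def indicator_def\<close>)
      then show ?thesis by (rule Lim_transform_eventually[OF s(2)])
    qed
    then show "AE x in lebesgue. (\<lambda>n. F n x) \<longlonglongrightarrow> f x" by simp
  qed
  ultimately show "f \<in> closed_span step_indicators"
    by (rule closed_span_converges[OF step_indicators_L2, rotated])
qed

section \<open>The Fourier transform of integrable functions\<close>

lemma borel_measurable_lebesgueI:
  "f \<in> borel_measurable borel \<Longrightarrow> f \<in> borel_measurable lebesgue"
  by (simp add: measurable_completion)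

text \<open>
  The exponential in \<^const>\<open>L1_fourier\<close>, written as a point of the unit circle.
\<close>

definition fourier_char :: "real \<Rightarrow> real \<Rightarrow> complex" where
  "fourier_char \<xi> x = cis (- 2 * pi * (x * \<xi>))"

lemma norm_fourier_char [simp]: "cmod (fourier_char \<xi> x) = 1"
  by (simp add: fourier_char_def)

lemma fourier_char_commute: "fourier_char \<xi> x = fourier_char x \<xi>"
  by (simp add: fourier_char_def mult.commute)

lemma fourier_char_add: "fourier_char \<xi> (x + y) = fourier_char \<xi> x * fourier_char \<xi> y"
  by (simp add: fourier_char_def cis_mult algebra_simps)

lemma fourier_char_add_left: "fourier_char (\<xi> + \<eta>) x = fourier_char \<xi> x * fourier_char \<eta> x"
  by (simp add: fourier_char_def cis_mult algebra_simps)

lemma cnj_fourier_char: "cnj (fourier_char \<xi> x) = fourier_char (- \<xi>) x"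
  by (simp add: fourier_char_def cis_cnj)

lemma fourier_char_minus_right: "fourier_char \<xi> (- x) = fourier_char (- \<xi>) x"
  by (simp add: fourier_char_def)

lemma fourier_char_mult_right: "fourier_char \<xi> (c * x) = fourier_char (c * \<xi>) x"
  by (simp add: fourier_char_def mult_ac)

lemma fourier_char_0 [simp]: "fourier_char 0 x = 1"
  by (simp add: fourier_char_def)

lemma fourier_char_of_int: "fourier_char (of_int k) (of_int l) = 1"
proof -
  have "cis (2 * pi * of_int (- (l * k))) = 1" by (rule cis_multiple_2pi) auto
  then show ?thesis by (simp add: fourier_char_def mult_ac)
qed

lemma continuous_fourier_char: "continuous_on A (fourier_char \<xi>)"
  unfolding fourier_char_def by (intro continuous_intros)

lemma measurable_fourier_char [measurable]: "fourier_char \<xi> \<in> borel_measurable lebesgue"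
  by (intro borel_measurable_lebesgueI borel_measurable_continuous_onI continuous_fourier_char)

lemma L1_fourier_eq: "L1_fourier f \<xi> = (LINT x|lebesgue. f x * fourier_char \<xi> x)"
proof -
  have "exp (- 2 * of_real pi * \<i> * of_real x * of_real \<xi>) = fourier_char \<xi> x" for x
    by (simp add: fourier_char_def cis_conv_exp mult_ac)
  then show ?thesis by (simp only: L1_fourier_def)
qed

lemma fourier_integrand_integrable:
  assumes "integrable lebesgue f"
  shows "integrable lebesgue (\<lambda>x. f x * fourier_char \<xi> x)"
proof -
  have [measurable]: "f \<in> borel_measurable lebesgue" using assms by auto
  show ?thesis
    by (rule Bochner_Integration.integrable_bound[OF integrable_norm[OF assms]])
       (auto simp: norm_mult)
qed

lemma L1_fourier_add:
  assumes "integrable lebesgue f" "integrable lebesgue g"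
  shows "L1_fourier (\<lambda>x. f x + g x) = (\<lambda>\<xi>. L1_fourier f \<xi> + L1_fourier g \<xi>)"
proof
  fix \<xi>
  show "L1_fourier (\<lambda>x. f x + g x) \<xi> = L1_fourier f \<xi> + L1_fourier g \<xi>"
    unfolding L1_fourier_eq distrib_right
    by (rule Bochner_Integration.integral_add) (intro fourier_integrand_integrable assms)+
qed

lemma L1_fourier_cmult: "L1_fourier (\<lambda>x. c * f x) = (\<lambda>\<xi>. c * L1_fourier f \<xi>)"
  unfolding L1_fourier_eq mult.assoc[of c] by simp

lemma L1_fourier_diff:
  assumes "integrable lebesgue f" "integrable lebesgue g"
  shows "L1_fourier (\<lambda>x. f x - g x) = (\<lambda>\<xi>. L1_fourier f \<xi> - L1_fourier g \<xi>)"
  using L1_fourier_add[OF assms(1) integrable_mult_right[of "-1" lebesgue g]] assms(2)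
    L1_fourier_cmult[of "-1" g] by simp

lemma L1_fourier_bound: "cmod (L1_fourier f \<xi>) \<le> (LINT x|lebesgue. cmod (f x))"
  unfolding L1_fourier_eq
  by (rule order_trans[OF integral_norm_bound]) (simp add: norm_mult)

lemma L1_fourier_reflect: "L1_fourier (\<lambda>x. f (- x)) \<xi> = L1_fourier f (- \<xi>)"
  unfolding L1_fourier_eq
  using lebesgue_integral_real_affine[of "-1"
      "\<lambda>x. f x * fourier_char (- \<xi>) x" 0]
  by (simp add: fourier_char_minus_right)

lemma L1_fourier_cnj: "L1_fourier (\<lambda>x. cnj (f x)) \<xi> = cnj (L1_fourier f (- \<xi>))"
  unfolding L1_fourier_eq
  by (subst Bochner_Integration.integral_cnj[symmetric]) (simp add: cnj_fourier_char)

lemma sigma_finite_lebesgue: "sigma_finite_measure (lebesgue :: real measure)"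
proof
  let ?A = "range (\<lambda>n::nat. {- real n..real n})"
  have "x \<in> \<Union> ?A" for x
  proof -
    obtain n :: nat where "\<bar>x\<bar> < real n" using reals_Archimedean2 by blast
    then show ?thesis by (auto intro!: exI[of _ n])
  qed
  then show "\<exists>A. countable A \<and> A \<subseteq> sets lebesgue \<and> \<Union> A = space lebesgue \<and>
      (\<forall>a\<in>A. emeasure (lebesgue :: real measure) a \<noteq> \<infinity>)"
    by (intro exI[of _ ?A]) (auto simp: emeasure_lborel_Icc_eq)
qed

lemma measurable_fourier_kernel:
  assumes "f \<in> borel_measurable lebesgue"
  shows "(\<lambda>(\<xi>, x). f x * fourier_char \<xi> x) \<in> borel_measurable (lebesgue \<Otimes>\<^sub>M lebesgue)"
proof -
  have id: "(\<lambda>x. x) \<in> borel_measurable (lebesgue :: real measure)"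
    by (rule borel_measurable_lebesgueI) simp
  have "(\<lambda>p. snd p * fst p :: real) \<in> borel_measurable (lebesgue \<Otimes>\<^sub>M lebesgue)"
    by (intro borel_measurable_times measurable_compose[OF measurable_fst id]
        measurable_compose[OF measurable_snd id])
  moreover have "(\<lambda>t. cis (- 2 * pi * t)) \<in> borel_measurable borel"
    by (intro borel_measurable_continuous_onI continuous_intros)
  ultimately have "(\<lambda>p. fourier_char (fst p) (snd p)) \<in> borel_measurable (lebesgue \<Otimes>\<^sub>M lebesgue)"
    unfolding fourier_char_def by (rule measurable_compose)
  then show ?thesis
    unfolding case_prod_beta
    by (intro borel_measurable_times measurable_compose[OF measurable_snd assms])
qed

lemma measurable_L1_fourier:
  assumes "f \<in> borel_measurable lebesgue"
  shows "L1_fourier f \<in> borel_measurable lebesgue"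
proof -
  interpret sigma_finite_measure "lebesgue :: real measure" by (rule sigma_finite_lebesgue)
  show ?thesis unfolding L1_fourier_eq[abs_def]
    by (rule borel_measurable_lebesgue_integral[OF measurable_fourier_kernel[OF assms]])
qed

text \<open>
  Both sides are the integral of \<open>f x * g \<xi>\<close> against the same kernel, by Fubini.
\<close>

lemma L1_fourier_multiplication_formula:
  assumes f: "integrable lebesgue f" and g: "integrable lebesgue g"
  shows "(LINT \<xi>|lebesgue. L1_fourier f \<xi> * g \<xi>) = (LINT x|lebesgue. f x * L1_fourier g x)"
proof -
  interpret L: sigma_finite_measure "lebesgue :: real measure" by (rule sigma_finite_lebesgue)
  interpret pair_sigma_finite "lebesgue :: real measure" "lebesgue :: real measure" ..
  have [measurable]: "f \<in> borel_measurable lebesgue" "g \<in> borel_measurable lebesgue"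
    using f g by auto
  define k where "k \<xi> x = g \<xi> * (f x * fourier_char \<xi> x)" for \<xi> x
  have "integrable (lebesgue \<Otimes>\<^sub>M lebesgue) (case_prod k)"
  proof (rule Fubini_integrable)
    have "(\<lambda>p. g (fst p) * (case p of (\<xi>, x) \<Rightarrow> f x * fourier_char \<xi> x))
        \<in> borel_measurable (lebesgue \<Otimes>\<^sub>M lebesgue)"
      using measurable_fourier_kernel[of f]
      by (intro borel_measurable_times measurable_compose[OF measurable_fst]) auto
    then show "case_prod k \<in> borel_measurable (lebesgue \<Otimes>\<^sub>M lebesgue)"
      unfolding case_prod_beta' k_def by simp
    have "integrable lebesgue (\<lambda>\<xi>. cmod (g \<xi>) * (LINT x|lebesgue. cmod (f x)))"
      using g by simp
    then show "integrable lebesgue (\<lambda>\<xi>. LINT x|lebesgue. norm (case (\<xi>, x) of (\<xi>, x) \<Rightarrow> k \<xi> x))"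
      by (simp add: norm_mult k_def)
    show "AE \<xi> in lebesgue. integrable lebesgue (\<lambda>x. case (\<xi>, x) of (\<xi>, x) \<Rightarrow> k \<xi> x)"
      using fourier_integrand_integrable[OF f] by (simp add: k_def)
  qed
  then have "(LINT x|lebesgue. LINT \<xi>|lebesgue. k \<xi> x) = (LINT \<xi>|lebesgue. LINT x|lebesgue. k \<xi> x)"
    by (rule Fubini_integral)
  moreover have "(LINT \<xi>|lebesgue. k \<xi> x) = f x * L1_fourier g x" for x
  proof -
    have "(LINT \<xi>|lebesgue. k \<xi> x)
        = (LINT \<xi>|lebesgue. f x * (g \<xi> * fourier_char x \<xi>))"
      by (rule Bochner_Integration.integral_cong)
         (auto simp: k_def fourier_char_commute[of x] mult_ac)
    then show ?thesis by (simp add: L1_fourier_eq)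
  qed
  moreover have "(LINT x|lebesgue. k \<xi> x) = L1_fourier f \<xi> * g \<xi>" for \<xi>
    by (simp add: L1_fourier_eq k_def mult.commute)
  ultimately show ?thesis by simp
qed

definition inverse_fourier :: "(real \<Rightarrow> complex) \<Rightarrow> real \<Rightarrow> complex" where
  "inverse_fourier f x = L1_fourier f (- x)"

text \<open>
  The multiplication formula, with \<open>g\<close> replaced by its reflected conjugate.
\<close>

lemma inverse_fourier_adjoint:
  assumes "integrable lebesgue f" "integrable lebesgue g"
  shows "L2_inner (inverse_fourier f) g = L2_inner f (L1_fourier g)"
proof -
  have "L2_inner (inverse_fourier f) g = (LINT x|lebesgue. L1_fourier f (- x) * cnj (g x))"
    by (simp add: L2_inner_def inverse_fourier_def)
  also have "\<dots> = (LINT x|lebesgue. L1_fourier f x * cnj (g (- x)))"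
    using lebesgue_integral_real_affine[of "-1" "\<lambda>x. L1_fourier f x * cnj (g (- x))" 0] by simp
  also have "\<dots> = (LINT x|lebesgue. f x * L1_fourier (\<lambda>x. cnj (g (- x))) x)"
    using assms(2) lebesgue_integrable_real_affine_iff[of "-1" "\<lambda>x. cnj (g x)" 0]
    by (intro L1_fourier_multiplication_formula assms(1)) simp
  also have "\<dots> = L2_inner f (L1_fourier g)"
    by (simp add: L2_inner_def L1_fourier_cnj[of "\<lambda>x. g (- x)"] L1_fourier_reflect)
  finally show ?thesis .
qed

section \<open>Indicators of intervals\<close>

text \<open>
  Integration by parts of \<open>(sin t)\<^sup>2 / t\<^sup>2\<close>.  The boundary term \<open>(sin t)\<^sup>2 / t\<close> is written as
  \<open>t * (sinc t)\<^sup>2\<close> so that it is differentiable at 0 as well; there the derivative comes from the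
  continuity of \<open>sinc\<close>.
\<close>

lemma has_real_derivative_sinc_squared_antiderivative:
  "((\<lambda>t. Si (2 * t) - t * (sinc t)\<^sup>2) has_real_derivative (sinc t)\<^sup>2) (at t)"
proof -
  have Si: "((\<lambda>t. Si (2 * t)) has_real_derivative (sinc (2 * t) * 2)) (at t)"
    by (rule DERIV_chain2[OF DERIV_Si]) (auto intro!: derivative_eq_intros)
  show ?thesis
  proof (cases "t = 0")
    case True
    have "((\<lambda>t. t * (sinc t)\<^sup>2) has_real_derivative 1) (at 0)"
      unfolding DERIV_caratheodory_within
      by (intro exI[of _ "\<lambda>t. (sinc t)\<^sup>2"]) (auto intro!: continuous_power isCont_sinc)
    from DERIV_diff[OF Si[unfolded True] this] show ?thesis using True by simp
  next
    case False
    have "((\<lambda>t. (sin t)\<^sup>2 / t) has_real_derivative (2 * sin t * cos t / t - (sin t)\<^sup>2 / t\<^sup>2)) (at t)"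
      using False by (auto intro!: derivative_eq_intros simp: field_simps power2_eq_square)
    then have "((\<lambda>t. t * (sinc t)\<^sup>2) has_real_derivative
        (2 * sin t * cos t / t - (sin t)\<^sup>2 / t\<^sup>2)) (at t)"
      by (rule has_field_derivative_transform_within_open[where S = "- {0}"])
         (use False in \<open>auto simp: power2_eq_square\<close>)
    from DERIV_diff[OF Si this] show ?thesis
      using False by (simp add: sin_double power_divide)
  qed
qed

lemma nn_integral_sinc_squared: "(\<integral>\<^sup>+t. ennreal ((sinc t)\<^sup>2) \<partial>lborel) = ennreal pi"
proof -
  have "filterlim (\<lambda>t::real. 2 * t) at_top at_top"
    by (rule filterlim_tendsto_pos_mult_at_top[OF tendsto_const _ filterlim_ident]) simp
  then have "((\<lambda>t. Si (2 * t)) \<longlongrightarrow> pi / 2) at_top"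
    by (rule filterlim_compose[OF Si_at_top])
  moreover have "((\<lambda>t. t * (sinc t)\<^sup>2) \<longlongrightarrow> 0) at_top"
  proof (rule Lim_null_comparison)
    show "\<forall>\<^sub>F t in at_top. norm (t * (sinc t)\<^sup>2) \<le> inverse t"
      using eventually_gt_at_top[of 0]
    proof eventually_elim
      case (elim t)
      have "(sin t)\<^sup>2 \<le> 1" by (simp add: abs_square_le_1)
      then show ?case using elim by (simp add: power2_eq_square divide_simps)
    qed
    show "((\<lambda>t::real. inverse t) \<longlongrightarrow> 0) at_top"
      by (rule tendsto_inverse_0_at_top) (rule filterlim_ident)
  qed
  ultimately have "((\<lambda>t. Si (2 * t) - t * (sinc t)\<^sup>2) \<longlongrightarrow> pi / 2 - 0) at_top"
    by (rule tendsto_diff)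
  from nn_integral_FTC_atLeast[OF _ has_real_derivative_sinc_squared_antiderivative _ this]
  have half: "(\<integral>\<^sup>+t. ennreal ((sinc t)\<^sup>2) * indicator {0..} t \<partial>lborel) = ennreal (pi / 2)"
    by (simp add: Si_def zero_ereal_def)
  have "(\<integral>\<^sup>+t. ennreal ((sinc t)\<^sup>2) * indicator {0..} t \<partial>lborel)
      = ennreal \<bar>- 1\<bar> * (\<integral>\<^sup>+t. ennreal ((sinc (0 + (- 1) * t))\<^sup>2) * indicator {0..} (0 + (- 1) * t) \<partial>lborel)"
    by (rule nn_integral_real_affine) auto
  also have "\<dots> = (\<integral>\<^sup>+t. ennreal ((sinc t)\<^sup>2) * indicator {0..} (- t) \<partial>lborel)"
  proof -
    have "0 + (- 1) * t = - t" for t :: real by simp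
    then show ?thesis by (simp only: sinc_neg) simp
  qed
  finally have "(\<integral>\<^sup>+t. ennreal ((sinc t)\<^sup>2) * indicator {0..} t \<partial>lborel)
      = (\<integral>\<^sup>+t. ennreal ((sinc t)\<^sup>2) * indicator {0..} (- t) \<partial>lborel)" .
  with half have half': "(\<integral>\<^sup>+t. ennreal ((sinc t)\<^sup>2) * indicator {0..} (- t) \<partial>lborel) = ennreal (pi / 2)"
    by simp
  have "(\<integral>\<^sup>+t. ennreal ((sinc t)\<^sup>2) \<partial>lborel)
      = (\<integral>\<^sup>+t. ennreal ((sinc t)\<^sup>2) * indicator {0..} t
          + ennreal ((sinc t)\<^sup>2) * indicator {0..} (- t) \<partial>lborel)"
    by (rule nn_integral_cong_AE, use AE_lborel_singleton[of "0::real"] in eventually_elim)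
       (auto simp: indicator_def)
  also have "\<dots> = ennreal (pi / 2) + ennreal (pi / 2)"
    using half half' by (subst nn_integral_add) simp_all
  also have "\<dots> = ennreal pi" by (subst ennreal_plus[symmetric]) auto
  finally show ?thesis .
qed

lemma L1_fourier_interval:
  assumes "a \<le> b" "\<xi> \<noteq> 0"
  shows "L1_fourier (indicator {a<..b}) \<xi> =
    (fourier_char \<xi> a - fourier_char \<xi> b) / (2 * of_real pi * \<i> * of_real \<xi>)"
proof -
  let ?e = "fourier_char \<xi>"
  let ?c = "- 2 * of_real pi * \<i> * of_real \<xi> :: complex"
  have "?c \<noteq> 0" using assms by simp
  have e: "?e x = exp (?c * of_real x)" for x by (simp add: fourier_char_def cis_conv_exp mult_ac)
  have "L1_fourier (indicator {a<..b}) \<xi> = (LINT x|lebesgue. indicator {a..b} x *\<^sub>R ?e x)"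
    unfolding L1_fourier_eq
  proof (rule integral_cong_AE)
    have "AE x in lebesgue. x \<noteq> a" by (rule AE_completion) (rule AE_lborel_singleton)
    then show "AE x in lebesgue. indicator {a<..b} x * ?e x = indicator {a..b} x *\<^sub>R ?e x"
      by eventually_elim (auto simp: indicator_def)
    show "(\<lambda>x. indicator {a<..b} x * ?e x) \<in> borel_measurable lebesgue"
      by (intro borel_measurable_times borel_measurable_indicator measurable_fourier_char) auto
    show "(\<lambda>x. indicator {a..b} x *\<^sub>R ?e x) \<in> borel_measurable lebesgue"
      by (intro borel_measurable_scaleR borel_measurable_indicator measurable_fourier_char) auto
  qed
  also have "\<dots> = (LINT x|lborel. indicator {a..b} x *\<^sub>R ?e x)"
  proof (rule integral_completion)
    have "?e \<in> borel_measurable borel"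
      by (intro borel_measurable_continuous_onI continuous_fourier_char)
    then show "(\<lambda>x. indicator {a..b} x *\<^sub>R ?e x) \<in> lborel \<rightarrow>\<^sub>M borel"
      by (intro borel_measurable_scaleR borel_measurable_indicator) auto
  qed
  also have "\<dots> = ?e b / ?c - ?e a / ?c"
  proof (rule integral_FTC_Icc[OF assms(1)])
    show "((\<lambda>x. ?e x / ?c) has_vector_derivative ?e x) (at x within {a..b})" for x
    proof -
      have "((\<lambda>z. exp (?c * z) / ?c) has_field_derivative exp (?c * of_real x)) (at (of_real x))"
        using \<open>?c \<noteq> 0\<close> by (auto intro!: derivative_eq_intros)
      then have "((\<lambda>x. exp (?c * of_real x) / ?c) has_vector_derivative exp (?c * of_real x))
          (at x within {a..b})"
        by (rule has_vector_derivative_real_field)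
      then show ?thesis unfolding e .
    qed
    show "continuous_on {a..b} ?e" by (rule continuous_fourier_char)
  qed
  also have "\<dots> = (?e a - ?e b) / (2 * of_real pi * \<i> * of_real \<xi>)"
    using assms(2) by (simp add: divide_simps)
  finally show ?thesis .
qed

lemma cmod_L1_fourier_interval:
  assumes "a < b" "\<xi> \<noteq> 0"
  shows "cmod (L1_fourier (indicator {a<..b}) \<xi>) = (b - a) * \<bar>sinc (pi * (b - a) * \<xi>)\<bar>"
proof -
  let ?t = "pi * (b - a) * \<xi>"
  have "fourier_char \<xi> a - fourier_char \<xi> b
      = fourier_char \<xi> b * (exp (\<i> * of_real (2 * ?t)) - 1)"
    unfolding cis_conv_exp[symmetric] right_diff_distrib fourier_char_def cis_mult
    by (simp add: algebra_simps)
  then have "cmod (fourier_char \<xi> a - fourier_char \<xi> b) = cmod (exp (\<i> * of_real (2 * ?t)) - 1)"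
    by (simp only: norm_mult norm_fourier_char mult_1_left)
  also have "\<dots> = 2 * \<bar>sin ?t\<bar>"
    by (subst dist_exp_i_1) simp
  finally have "cmod (L1_fourier (indicator {a<..b}) \<xi>) = (2 * \<bar>sin ?t\<bar>) / (2 * pi * \<bar>\<xi>\<bar>)"
    using assms by (simp add: L1_fourier_interval norm_divide norm_mult)
  also have "\<dots> = (b - a) * \<bar>sin ?t / ?t\<bar>"
    using assms by (simp add: abs_mult)
  also have "sin ?t / ?t = sinc ?t" using assms by simp
  finally show ?thesis .
qed

lemma integrable_step_indicators:
  assumes "f \<in> step_indicators"
  shows "integrable lebesgue f"
proof -
  obtain a b where "f = indicator {a<..b}" using assms by (auto simp: step_indicators_def)
  then have "f = (\<lambda>x. of_real (indicator {a<..b} x))" by (auto simp: indicator_def)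
  moreover have "integrable lebesgue (indicator {a<..b} :: real \<Rightarrow> real)"
    by (cases "a \<le> b") auto
  ultimately show ?thesis by (metis integrable_of_real)
qed

text \<open>
  The only explicit integral behind the Plancherel theorem: up to scaling it is the integral of
  the square of \<open>sin t / t\<close>.
\<close>

lemma L1_fourier_interval_L2:
  assumes "a \<le> b"
  shows "L1_fourier (indicator {a<..b}) \<in> L2"
    and "(L2_norm (L1_fourier (indicator {a<..b})))\<^sup>2 = b - a"
proof -
  let ?F = "L1_fourier (indicator {a<..b})"
  have meas [measurable]: "?F \<in> borel_measurable lebesgue"
    by (intro measurable_L1_fourier borel_measurable_indicator) auto
  have nn: "(\<integral>\<^sup>+\<xi>. ennreal ((cmod (?F \<xi>))\<^sup>2) \<partial>lebesgue) = ennreal (b - a)"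
  proof (cases "a = b")
    case True
    then have "?F \<xi> = 0" for \<xi> by (simp add: L1_fourier_eq)
    then show ?thesis using True by simp
  next
    case False
    then have ab: "a < b" using assms by simp
    have "(\<integral>\<^sup>+\<xi>. ennreal ((cmod (?F \<xi>))\<^sup>2) \<partial>lebesgue)
        = (\<integral>\<^sup>+\<xi>. ennreal ((b - a)\<^sup>2) * ennreal ((sinc (0 + (pi * (b - a)) * \<xi>))\<^sup>2) \<partial>lebesgue)"
    proof (rule nn_integral_cong_AE)
      have "AE \<xi> in lebesgue. \<xi> \<noteq> (0::real)" by (rule AE_completion) (rule AE_lborel_singleton)
      then show "AE \<xi> in lebesgue. ennreal ((cmod (?F \<xi>))\<^sup>2)
          = ennreal ((b - a)\<^sup>2) * ennreal ((sinc (0 + (pi * (b - a)) * \<xi>))\<^sup>2)"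
      proof eventually_elim
        case (elim \<xi>)
        show ?case
          by (subst cmod_L1_fourier_interval[OF ab elim], subst ennreal_mult[symmetric])
             (simp_all only: power_mult_distrib power2_abs zero_le_power2 add_0)
      qed
    qed
    also have "\<dots> = (\<integral>\<^sup>+\<xi>. ennreal ((b - a)\<^sup>2) * ennreal ((sinc (0 + (pi * (b - a)) * \<xi>))\<^sup>2) \<partial>lborel)"
      by (rule nn_integral_completion)
    also have "\<dots> = ennreal ((b - a)\<^sup>2)
        * (\<integral>\<^sup>+\<xi>. ennreal ((sinc (0 + (pi * (b - a)) * \<xi>))\<^sup>2) \<partial>lborel)"
      by (rule nn_integral_cmult) measurable
    also have "(\<integral>\<^sup>+\<xi>. ennreal ((sinc (0 + (pi * (b - a)) * \<xi>))\<^sup>2) \<partial>lborel) = ennreal (1 / (b - a))"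
      (is "?I = _")
    proof -
      have "ennreal pi = ennreal \<bar>pi * (b - a)\<bar> * ?I"
        unfolding nn_integral_sinc_squared[symmetric]
        by (rule nn_integral_real_affine) (use ab in auto)
      then have "ennreal (1 / (pi * (b - a))) * ennreal pi
          = ennreal (1 / (pi * (b - a))) * ennreal (pi * (b - a)) * ?I"
        using ab by (simp add: mult.assoc)
      then show ?thesis
        using ab by (simp add: ennreal_mult[symmetric] mult.assoc[symmetric])
    qed
    also have "ennreal ((b - a)\<^sup>2) * ennreal (1 / (b - a)) = ennreal (b - a)"
      using ab by (simp add: ennreal_mult[symmetric] power2_eq_square)
    finally show ?thesis .
  qed
  then have int: "integrable lebesgue (\<lambda>\<xi>. (cmod (?F \<xi>))\<^sup>2)"
    by (intro integrableI_nonneg) auto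
  then show "?F \<in> L2" using meas by (simp add: L2_def)
  show "(L2_norm ?F)\<^sup>2 = b - a"
    unfolding L2_norm_power2
    by (subst integral_eq_nn_integral) (use int assms in \<open>auto simp: nn\<close>)
qed

section \<open>Plancherel's theorem\<close>

lemma indicator_Ioc_L2:
  fixes a b :: real
  shows "(indicator {a<..b} :: real \<Rightarrow> complex) \<in> L2"
    and "a \<le> b \<Longrightarrow> (L2_norm (indicator {a<..b}))\<^sup>2 = b - a"
proof -
  have sub: "{a<..b} \<subseteq> {a..b}" by auto
  show "(indicator {a<..b} :: real \<Rightarrow> complex) \<in> L2"
    by (rule L2_indicator(1)[OF _ sub]) auto
  show "(L2_norm (indicator {a<..b}))\<^sup>2 = b - a" if "a \<le> b"
    using that by (subst L2_indicator(2)[OF _ sub]) auto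
qed

text \<open>
  The inner product of the transforms of two overlapping intervals with a common left end is
  found by polarization: the difference of two such indicators is again the indicator of an
  interval, so the real part comes from the norms of three interval transforms.  The imaginary
  part vanishes because the transform of a real function is conjugated by the reflection.
\<close>

lemma L1_fourier_inner_same_left:
  fixes p s t :: real
  assumes "p \<le> s" "p \<le> t"
  shows "L2_inner (L1_fourier (indicator {p<..s})) (L1_fourier (indicator {p<..t}))
    = L2_inner (indicator {p<..s}) (indicator {p<..t})"
proof -
  have *: "L2_inner (L1_fourier (indicator {p<..s})) (L1_fourier (indicator {p<..t}))
    = L2_inner (indicator {p<..s}) (indicator {p<..t})" if "p \<le> s" "s \<le> t" for s t
  proof -
    define u v w :: "real \<Rightarrow> complex"
      where "u = indicator {p<..s}" and "v = indicator {p<..t}" and "w = indicator {s<..t}"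
    have w: "w = (\<lambda>x. v x - u x)" using that by (auto simp: u_def v_def w_def indicator_def fun_eq_iff)
    have gen: "u \<in> step_indicators" "v \<in> step_indicators" "w \<in> step_indicators"
      by (auto simp: u_def v_def w_def step_indicators_def)
    have L2: "u \<in> L2" "v \<in> L2" using gen step_indicators_L2 by auto
    have norms: "(L2_norm f)\<^sup>2 = (L2_norm (L1_fourier f))\<^sup>2" if "f \<in> {u, v, w}" for f
    proof -
      have "(L2_norm (indicator {a<..b}))\<^sup>2 = (L2_norm (L1_fourier (indicator {a<..b})))\<^sup>2"
        if "a \<le> b" for a b :: real
        using that by (simp add: indicator_Ioc_L2(2) L1_fourier_interval_L2(2))
      then show ?thesis using that \<open>p \<le> s\<close> \<open>s \<le> t\<close> unfolding u_def v_def w_def by auto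
    qed
    have FL2: "L1_fourier u \<in> L2" "L1_fourier v \<in> L2"
      using that L1_fourier_interval_L2(1) by (auto simp: u_def v_def)
    have "L1_fourier w = (\<lambda>\<xi>. L1_fourier v \<xi> - L1_fourier u \<xi>)"
      unfolding w by (intro L1_fourier_diff integrable_step_indicators gen)
    then have re: "Re (L2_inner (L1_fourier v) (L1_fourier u)) = Re (L2_inner v u)"
      using L2_norm_diff_power2[OF FL2(2,1)] L2_norm_diff_power2[OF L2(2,1)]
        norms[of u] norms[of v] norms[of w] w by simp
    have real: "cnj (u x) = u x" "cnj (v x) = v x" for x by (auto simp: u_def v_def indicator_def)
    have "cnj (L1_fourier u \<xi>) = L1_fourier u (- \<xi>)" "cnj (L1_fourier v \<xi>) = L1_fourier v (- \<xi>)" for \<xi>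
      using L1_fourier_cnj[of u "- \<xi>"] L1_fourier_cnj[of v "- \<xi>"] by (simp_all add: real)
    then have "cnj (L2_inner (L1_fourier v) (L1_fourier u))
        = (LINT \<xi>|lebesgue. L1_fourier v (- \<xi>) * cnj (L1_fourier u (- \<xi>)))"
      unfolding L2_inner_def by (subst Bochner_Integration.integral_cnj[symmetric]) simp
    also have "\<dots> = L2_inner (L1_fourier v) (L1_fourier u)"
      unfolding L2_inner_def
      using lebesgue_integral_real_affine[of "-1" "\<lambda>\<xi>. L1_fourier v \<xi> * cnj (L1_fourier u \<xi>)" 0]
      by simp
    finally have "Im (L2_inner (L1_fourier v) (L1_fourier u)) = 0"
      by (metis Reals_cnj_iff complex_is_Real_iff)
    moreover have "cnj (L2_inner v u) = L2_inner v u"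
      unfolding L2_inner_def by (subst Bochner_Integration.integral_cnj[symmetric]) (simp add: real)
    then have "Im (L2_inner v u) = 0"
      by (metis Reals_cnj_iff complex_is_Real_iff)
    ultimately have "L2_inner (L1_fourier v) (L1_fourier u) = L2_inner v u"
      using re by (simp add: complex_eq_iff)
    then have "cnj (L2_inner (L1_fourier v) (L1_fourier u)) = cnj (L2_inner v u)" by simp
    then show ?thesis by (simp add: L2_inner_cnj u_def v_def)
  qed
  show ?thesis
  proof (cases "s \<le> t")
    case True
    then show ?thesis using * assms by blast
  next
    case False
    then have "L2_inner (L1_fourier (indicator {p<..t})) (L1_fourier (indicator {p<..s}))
        = L2_inner (indicator {p<..t}) (indicator {p<..s})"
      using * assms by simp
    from arg_cong[OF this, of cnj] show ?thesis by (simp add: L2_inner_cnj)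
  qed
qed

text \<open>
  Two arbitrary intervals are differences of intervals that start at the smaller left end.
\<close>

lemma L1_fourier_inner_step_indicators:
  assumes "f \<in> step_indicators" "g \<in> step_indicators"
  shows "L2_inner (L1_fourier f) (L1_fourier g) = L2_inner f g"
proof -
  have nonempty: "\<exists>a b. a \<le> b \<and> f = indicator {a<..b}" if mem: "f \<in> step_indicators" for f
  proof -
    obtain a b where f: "f = indicator {a<..b}" using mem by (auto simp: step_indicators_def)
    show ?thesis
    proof (cases "a \<le> b")
      case False
      then show ?thesis unfolding f by (intro exI[of _ a] exI[of _ a]) simp
    qed (use f in blast)
  qed
  obtain a b where f: "a \<le> b" "f = indicator {a<..b}" using nonempty[OF assms(1)] by auto
  obtain c d where g: "c \<le> d" "g = indicator {c<..d}" using nonempty[OF assms(2)] by auto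
  define p where "p = min a c"
  define u where "u s = (indicator {p<..s} :: real \<Rightarrow> complex)" for s
  have p: "p \<le> a" "p \<le> b" "p \<le> c" "p \<le> d" using f g by (auto simp: p_def)
  have u: "u s \<in> step_indicators" for s by (auto simp: u_def step_indicators_def)
  have uL2: "u s \<in> L2" for s using u step_indicators_L2 by auto
  have int: "integrable lebesgue (u s)" for s using u integrable_step_indicators by auto
  have F: "L1_fourier (u s) \<in> L2" if "p \<le> s" for s
    unfolding u_def by (rule L1_fourier_interval_L2(1)[OF that])
  have fu: "f = (\<lambda>x. u b x - u a x)" and gu: "g = (\<lambda>x. u d x - u c x)"
    using f g p by (auto simp: u_def indicator_def fun_eq_iff)
  have "L2_inner (L1_fourier (u s)) (L1_fourier (u t)) = L2_inner (u s) (u t)"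
    if "p \<le> s" "p \<le> t" for s t
    unfolding u_def by (rule L1_fourier_inner_same_left[OF that])
  then show ?thesis
    unfolding fu gu L1_fourier_diff[OF int int]
    using p by (simp add: L2_inner_diff_left L2_inner_diff_right uL2 F L2_diff)
qed

lemma L1_fourier_lin_span:
  assumes "f \<in> lin_span step_indicators"
  shows "integrable lebesgue f \<and> L1_fourier f \<in> L2"
  using assms
proof induction
  case (base f)
  then obtain a b where f: "f = indicator {a<..b}" by (auto simp: step_indicators_def)
  have "L1_fourier f \<in> L2"
  proof (cases "a \<le> b")
    case True
    then show ?thesis unfolding f by (rule L1_fourier_interval_L2(1))
  next
    case False
    then have "f = indicator {a<..a}" by (simp add: f)
    then show ?thesis by (simp only: L1_fourier_interval_L2(1))
  qed
  with base integrable_step_indicators show ?case by blast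
next
  case zero
  have "L1_fourier (\<lambda>_. 0) = (\<lambda>_. 0)" by (auto simp: L1_fourier_def)
  then show ?case by simp
next
  case (add f g)
  then show ?case by (simp add: L1_fourier_add L2_add)
next
  case (cmult f c)
  then show ?case by (simp add: L1_fourier_cmult L2_cmult)
qed

lemma L1_fourier_inner_lin_span:
  assumes "f \<in> lin_span step_indicators" "g \<in> lin_span step_indicators"
  shows "L2_inner (L1_fourier f) (L1_fourier g) = L2_inner f g"
proof -
  have L2: "h \<in> L2" if "h \<in> lin_span step_indicators" for h
    using lin_span_L2[OF step_indicators_L2] that by auto
  have *: "L2_inner (L1_fourier f) (L1_fourier g) = L2_inner f g"
    if "f \<in> lin_span step_indicators" "g \<in> step_indicators" for f g
    using that(1)
  proof induction
    case (base f)
    then show ?case using that(2) by (intro L1_fourier_inner_step_indicators)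
  next
    case zero
    then show ?case by (simp add: L2_inner_def L1_fourier_def)
  next
    case (add f h)
    then show ?case
      using L1_fourier_lin_span[of f] L1_fourier_lin_span[of h]
        L1_fourier_lin_span[OF lin_span.base[OF that(2)]] L2[OF lin_span.base[OF that(2)]]
      by (simp add: L1_fourier_add L2_inner_add_left L2)
  next
    case (cmult f c)
    then show ?case by (simp add: L1_fourier_cmult L2_inner_cmult_left)
  qed
  show ?thesis
    using assms(2)
  proof induction
    case (base g)
    then show ?case using * assms(1) by blast
  next
    case zero
    then show ?case by (simp add: L2_inner_def L1_fourier_def)
  next
    case (add g h)
    then show ?case
      using L1_fourier_lin_span[of g] L1_fourier_lin_span[of h] L1_fourier_lin_span[OF assms(1)]
      by (simp add: L1_fourier_add L2_inner_add_right L2 assms(1))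
  next
    case (cmult g c)
    then show ?case by (simp add: L1_fourier_cmult L2_inner_cmult_right)
  qed
qed

lemma L1_fourier_norm_lin_span:
  assumes "f \<in> lin_span step_indicators"
  shows "L2_norm (L1_fourier f) = L2_norm f"
proof -
  have "complex_of_real ((L2_norm (L1_fourier f))\<^sup>2) = of_real ((L2_norm f)\<^sup>2)"
    using L1_fourier_inner_lin_span[OF assms assms] by (simp only: L2_inner_self)
  then have "(L2_norm (L1_fourier f))\<^sup>2 = (L2_norm f)\<^sup>2" by (simp only: of_real_eq_iff)
  then show ?thesis by (simp add: L2_norm_nonneg power2_eq_iff_nonneg)
qed

text \<open>
  The working domain of the transform: it is dense, closed under linear combinations, and its
  members are both integrable and square-integrable.
\<close>

definition L2_bounded_support :: "(real \<Rightarrow> complex) set" where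
  "L2_bounded_support = {f \<in> L2. \<exists>N. \<forall>x. N < \<bar>x\<bar> \<longrightarrow> f x = 0}"

lemma L2_bounded_supportI:
  "f \<in> L2 \<Longrightarrow> (\<And>x. N < \<bar>x\<bar> \<Longrightarrow> f x = 0) \<Longrightarrow> f \<in> L2_bounded_support"
  by (auto simp: L2_bounded_support_def)

lemma L2_bounded_support_L2: "f \<in> L2_bounded_support \<Longrightarrow> f \<in> L2"
  by (simp add: L2_bounded_support_def)

lemma L2_bounded_support_obtain:
  assumes "f \<in> L2_bounded_support"
  obtains N where "N > 0" "\<And>x. x \<notin> {- N<..N} \<Longrightarrow> f x = 0"
proof -
  obtain M where M: "\<And>x. M < \<bar>x\<bar> \<Longrightarrow> f x = 0" using assms by (auto simp: L2_bounded_support_def)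
  show ?thesis by (rule that[of "\<bar>M\<bar> + 1"]) (auto intro: M)
qed

lemma L2_bounded_support_add:
  assumes "f \<in> L2_bounded_support" "g \<in> L2_bounded_support"
  shows "(\<lambda>x. f x + g x) \<in> L2_bounded_support"
proof -
  obtain M N where "\<And>x. M < \<bar>x\<bar> \<Longrightarrow> f x = 0" "\<And>x. N < \<bar>x\<bar> \<Longrightarrow> g x = 0"
    using assms by (auto simp: L2_bounded_support_def)
  then show ?thesis
    using assms by (intro L2_bounded_supportI[where N = "max M N"])
      (auto intro: L2_add L2_bounded_support_L2)
qed

lemma L2_bounded_support_cmult:
  "f \<in> L2_bounded_support \<Longrightarrow> (\<lambda>x. c * f x) \<in> L2_bounded_support"
  by (auto simp: L2_bounded_support_def L2_cmult)

lemma L2_truncate: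
  assumes "f \<in> L2" "A \<in> sets lebesgue"
  shows "(\<lambda>x. f x * indicator A x) \<in> L2"
proof (rule L2_dominated[OF assms(1)])
  show "(\<lambda>x. f x * indicator A x) \<in> borel_measurable lebesgue"
    using assms by (intro borel_measurable_times borel_measurable_indicator L2_measurable)
qed (auto simp: indicator_def)

text \<open>
  The Cauchy-Schwarz inequality against the indicator of the support.  It turns approximation in
  \<open>L\<^sup>2\<close> into uniform approximation of the transforms.
\<close>

lemma integral_cmod_le_L2_norm:
  assumes "f \<in> L2" "N > 0" "\<And>x. x \<notin> {- N<..N} \<Longrightarrow> f x = 0"
  shows "integrable lebesgue f" "(LINT x|lebesgue. cmod (f x)) \<le> L2_norm f * sqrt (2 * N)"
proof -
  have eq: "f x * cnj (indicator {- N<..N} x) = f x"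
    "cmod (f x) * cmod (indicator {- N<..N} x) = cmod (f x)" for x
    using assms(3)[of x] by (auto simp: indicator_def)
  show "integrable lebesgue f"
    using L2_inner_integrable[OF assms(1) indicator_Ioc_L2(1)[of "- N" N]] by (simp add: eq)
  have "(L2_norm (indicator {- N<..N}))\<^sup>2 = 2 * N"
    using indicator_Ioc_L2(2)[of "- N" N] assms(2) by simp
  then have "L2_norm (indicator {- N<..N}) = sqrt (2 * N)"
    by (metis L2_norm_nonneg real_sqrt_abs abs_of_nonneg)
  with L2_Cauchy_Schwarz_integral[OF assms(1) indicator_Ioc_L2(1)[of "- N" N]]
  show "(LINT x|lebesgue. cmod (f x)) \<le> L2_norm f * sqrt (2 * N)" by (simp add: eq)
qed

lemma L2_bounded_support_integrable:
  "f \<in> L2_bounded_support \<Longrightarrow> integrable lebesgue f"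
  by (metis L2_bounded_support_obtain integral_cmod_le_L2_norm(1) L2_bounded_support_L2)

lemma lin_span_truncate:
  assumes "f \<in> lin_span step_indicators"
  shows "(\<lambda>x. f x * indicator {- N<..N} x) \<in> lin_span step_indicators"
  using assms
proof induction
  case (base f)
  then obtain a b where "f = indicator {a<..b}" by (auto simp: step_indicators_def)
  then have "(\<lambda>x. f x * indicator {- N<..N} x) = indicator {max a (- N)<..min b N}"
    by (auto simp: indicator_def fun_eq_iff)
  then show ?case by (auto simp: step_indicators_def intro!: lin_span.base)
next
  case zero
  show ?case using lin_span.zero[of step_indicators] by simp
next
  case (add f g)
  then show ?case using lin_span.add[OF add.IH] by (simp add: distrib_right)
next
  case (cmult f c)
  then show ?case using lin_span.cmult[OF cmult.IH, of c] by (simp add: mult.assoc)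
qed

text \<open>
  Approximate by step functions.  The approximants, cut off to the support, converge both in
  \<open>L\<^sup>2\<close> and in \<open>L\<^sup>1\<close>, hence their transforms converge uniformly, and Fatou's lemma bounds the
  norm of the limit.
\<close>

lemma L1_fourier_norm_le:
  assumes "f \<in> L2_bounded_support"
  shows "L1_fourier f \<in> L2 \<and> L2_norm (L1_fourier f) \<le> L2_norm f"
proof -
  obtain N where N: "N > 0" "\<And>x. x \<notin> {- N<..N} \<Longrightarrow> f x = 0"
    using L2_bounded_support_obtain[OF assms] by metis
  have f: "f \<in> L2" by (rule L2_bounded_support_L2[OF assms])
  have "\<exists>g\<in>lin_span step_indicators. (\<forall>x. x \<notin> {- N<..N} \<longrightarrow> g x = 0) \<and>
      L2_norm (\<lambda>x. f x - g x) < \<epsilon>" if \<epsilon>: "\<epsilon> > 0" for \<epsilon>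
  proof -
    obtain g where g: "g \<in> lin_span step_indicators" "L2_norm (\<lambda>x. f x - g x) < \<epsilon>"
      using closed_span_approx[of f step_indicators \<epsilon>] f \<epsilon> step_indicators_dense by auto
    let ?g = "\<lambda>x. g x * indicator {- N<..N} x"
    have span: "?g \<in> lin_span step_indicators" by (rule lin_span_truncate[OF g(1)])
    then have gL2: "g \<in> L2" "?g \<in> L2" using g lin_span_L2[OF step_indicators_L2] by blast+
    have "L2_norm (\<lambda>x. f x - ?g x) \<le> L2_norm (\<lambda>x. f x - g x)"
      by (rule L2_norm_mono[OF L2_measurable])
         (use N(2) in \<open>auto intro!: L2_diff f gL2 split: split_indicator\<close>)
    with g span show ?thesis by (intro bexI[of _ ?g]) auto
  qed
  then have "\<forall>n. \<exists>g\<in>lin_span step_indicators. (\<forall>x. x \<notin> {- N<..N} \<longrightarrow> g x = 0) \<and>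
      L2_norm (\<lambda>x. f x - g x) < inverse (real (Suc n))" by simp
  then obtain g where g: "\<And>n. g n \<in> lin_span step_indicators"
    "\<And>n x. x \<notin> {- N<..N} \<Longrightarrow> g n x = 0"
    "\<And>n. L2_norm (\<lambda>x. f x - g n x) < inverse (real (Suc n))" by metis
  have gL2: "g n \<in> L2" for n using g(1) lin_span_L2[OF step_indicators_L2] by blast
  have lim0: "(\<lambda>n. L2_norm (\<lambda>x. f x - g n x)) \<longlonglongrightarrow> 0"
    by (rule tendsto_sandwich[OF _ _ tendsto_const LIMSEQ_inverse_real_of_nat])
       (use g(3) in \<open>auto simp: L2_norm_nonneg less_imp_le\<close>)
  have fint: "integrable lebesgue f" by (rule L2_bounded_support_integrable[OF assms])
  have gint: "integrable lebesgue (g n)" for n using L1_fourier_lin_span[OF g(1)] by blast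
  have pointwise: "(\<lambda>n. L1_fourier (g n) \<xi>) \<longlonglongrightarrow> L1_fourier f \<xi>" for \<xi>
  proof (rule LIM_zero_cancel, rule Lim_null_comparison)
    have "cmod (L1_fourier (g n) \<xi> - L1_fourier f \<xi>) \<le> L2_norm (\<lambda>x. f x - g n x) * sqrt (2 * N)" for n
    proof -
      have "L1_fourier (g n) \<xi> - L1_fourier f \<xi> = L1_fourier (\<lambda>x. g n x - f x) \<xi>"
        by (simp add: L1_fourier_diff[OF gint fint])
      also have "cmod \<dots> \<le> (LINT x|lebesgue. cmod (g n x - f x))" by (rule L1_fourier_bound)
      also have "\<dots> \<le> L2_norm (\<lambda>x. g n x - f x) * sqrt (2 * N)"
        by (rule integral_cmod_le_L2_norm(2)[OF L2_diff[OF gL2 f] N(1)]) (simp add: g(2) N(2))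
      finally show ?thesis by (simp add: L2_norm_minus_commute)
    qed
    then show "\<forall>\<^sub>F n in sequentially. cmod (L1_fourier (g n) \<xi> - L1_fourier f \<xi>)
        \<le> L2_norm (\<lambda>x. f x - g n x) * sqrt (2 * N)" by simp
    show "(\<lambda>n. L2_norm (\<lambda>x. f x - g n x) * sqrt (2 * N)) \<longlonglongrightarrow> 0"
      using tendsto_mult_right[OF lim0, of "sqrt (2 * N)"] by simp
  qed
  have FL2: "L1_fourier (g n) \<in> L2" for n using L1_fourier_lin_span[OF g(1)] by blast
  have meas: "L1_fourier f \<in> borel_measurable lebesgue"
    by (rule measurable_L1_fourier[OF L2_measurable[OF f]])
  have meas_sq: "(\<lambda>\<xi>. ennreal ((cmod (L1_fourier (g n) \<xi>))\<^sup>2)) \<in> borel_measurable lebesgue" for n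
    by (intro measurable_compose[OF _ measurable_ennreal] borel_measurable_power
        measurable_compose[OF _ borel_measurable_norm] L2_measurable FL2)
  have nn: "(\<integral>\<^sup>+\<xi>. ennreal ((cmod (L1_fourier (g n) \<xi>))\<^sup>2) \<partial>lebesgue) = ennreal ((L2_norm (g n))\<^sup>2)" for n
    unfolding L1_fourier_norm_lin_span[OF g(1), symmetric] L2_norm_power2
    by (rule nn_integral_eq_integral[OF L2_integrable[OF FL2]]) simp
  have norm_lim: "(\<lambda>n. ennreal ((L2_norm (g n))\<^sup>2)) \<longlonglongrightarrow> ennreal ((L2_norm f)\<^sup>2)"
  proof -
    have "(\<lambda>n. L2_norm (g n)) \<longlonglongrightarrow> L2_norm f"
    proof (rule LIM_zero_cancel, rule Lim_null_comparison[OF _ lim0])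
      show "\<forall>\<^sub>F n in sequentially. norm (L2_norm (g n) - L2_norm f) \<le> L2_norm (\<lambda>x. f x - g n x)"
        using L2_norm_le_add_diff[OF f gL2] L2_norm_le_add_diff[OF gL2 f]
        by (auto simp: L2_norm_minus_commute[of _ f] abs_le_iff algebra_simps)
    qed
    then show ?thesis by (intro tendsto_intros)
  qed
  have "(\<integral>\<^sup>+\<xi>. ennreal ((cmod (L1_fourier f \<xi>))\<^sup>2) \<partial>lebesgue)
      = (\<integral>\<^sup>+\<xi>. liminf (\<lambda>n. ennreal ((cmod (L1_fourier (g n) \<xi>))\<^sup>2)) \<partial>lebesgue)"
  proof (rule nn_integral_cong)
    fix \<xi>
    have "(\<lambda>n. ennreal ((cmod (L1_fourier (g n) \<xi>))\<^sup>2)) \<longlonglongrightarrow> ennreal ((cmod (L1_fourier f \<xi>))\<^sup>2)"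
      by (intro tendsto_intros pointwise)
    then show "ennreal ((cmod (L1_fourier f \<xi>))\<^sup>2)
        = liminf (\<lambda>n. ennreal ((cmod (L1_fourier (g n) \<xi>))\<^sup>2))"
      by (rule lim_imp_Liminf[symmetric, rotated]) simp
  qed
  also have "\<dots> \<le> liminf (\<lambda>n. \<integral>\<^sup>+\<xi>. ennreal ((cmod (L1_fourier (g n) \<xi>))\<^sup>2) \<partial>lebesgue)"
    by (rule nn_integral_liminf) (rule meas_sq)
  also have "\<dots> = ennreal ((L2_norm f)\<^sup>2)"
    unfolding nn by (rule lim_imp_Liminf[OF _ norm_lim]) simp
  finally have le: "(\<integral>\<^sup>+\<xi>. ennreal ((cmod (L1_fourier f \<xi>))\<^sup>2) \<partial>lebesgue) \<le> ennreal ((L2_norm f)\<^sup>2)" .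
  then have int: "integrable lebesgue (\<lambda>\<xi>. (cmod (L1_fourier f \<xi>))\<^sup>2)"
    using meas by (intro integrableI_nonneg) (auto simp: le_less_trans)
  then have "ennreal ((L2_norm (L1_fourier f))\<^sup>2) \<le> ennreal ((L2_norm f)\<^sup>2)"
    using le nn_integral_eq_integral[OF int] by (simp add: L2_norm_power2)
  then have "(L2_norm (L1_fourier f))\<^sup>2 \<le> (L2_norm f)\<^sup>2" by simp
  then have "L2_norm (L1_fourier f) \<le> L2_norm f"
    by (rule power2_le_imp_le) (rule L2_norm_nonneg)
  with int meas show ?thesis by (simp add: L2_def)
qed

lemma L2_contraction_fourier: "L2_contraction L2_bounded_support L1_fourier"
  unfolding L2_contraction_def
  using L1_fourier_norm_le L2_bounded_support_add L2_bounded_support_cmult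
  by (auto simp: L2_bounded_support_L2 L1_fourier_add L1_fourier_cmult L2_bounded_support_integrable)

lemma step_lin_span_bounded_support: "lin_span step_indicators \<subseteq> L2_bounded_support"
proof
  fix f assume "f \<in> lin_span step_indicators"
  then show "f \<in> L2_bounded_support"
  proof induction
    case (base f)
    then obtain a b where f: "f = indicator {a<..b}" by (auto simp: step_indicators_def)
    show ?case unfolding f
      by (rule L2_bounded_supportI[where N = "max \<bar>a\<bar> \<bar>b\<bar>"])
         (auto intro: indicator_Ioc_L2(1) split: split_indicator)
  next
    case zero
    show ?case by (auto simp: L2_bounded_support_def)
  qed (auto intro: L2_bounded_support_add L2_bounded_support_cmult)
qed

text \<open>
  The bound on the norm, applied to the difference of \<open>f\<close> and a step function, carries the
  equality over from step functions.
\<close>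

theorem plancherel_norm:
  assumes "f \<in> L2_bounded_support"
  shows "L2_norm (L1_fourier f) = L2_norm f"
proof (rule antisym)
  show "L2_norm (L1_fourier f) \<le> L2_norm f" using L1_fourier_norm_le[OF assms] by blast
  have f: "f \<in> L2" by (rule L2_bounded_support_L2[OF assms])
  show "L2_norm f \<le> L2_norm (L1_fourier f)"
  proof (rule field_le_epsilon)
    fix \<epsilon> :: real assume "\<epsilon> > 0"
    then obtain g where g: "g \<in> lin_span step_indicators" "L2_norm (\<lambda>x. f x - g x) < \<epsilon> / 2"
      using closed_span_approx[of f step_indicators "\<epsilon> / 2"] f step_indicators_dense by auto
    have gB: "g \<in> L2_bounded_support" using g step_lin_span_bounded_support by blast
    have "L2_norm f \<le> L2_norm g + \<epsilon> / 2"
      using L2_norm_le_add_diff[OF f L2_bounded_support_L2[OF gB]] g(2) by simp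
    also have "L2_norm g = L2_norm (L1_fourier g)"
      by (rule L1_fourier_norm_lin_span[OF g(1), symmetric])
    also have "\<dots> \<le> L2_norm (L1_fourier f) + L2_norm (\<lambda>\<xi>. L1_fourier g \<xi> - L1_fourier f \<xi>)"
      using L1_fourier_norm_le assms gB by (intro L2_norm_le_add_diff) auto
    also have "L2_norm (\<lambda>\<xi>. L1_fourier g \<xi> - L1_fourier f \<xi>) \<le> L2_norm (\<lambda>x. f x - g x)"
      using L1_fourier_norm_le[OF L2_contraction_diff(1)[OF L2_contraction_fourier assms gB]]
        L2_contraction_diff(2)[OF L2_contraction_fourier assms gB]
      by (simp add: L2_norm_minus_commute[of "L1_fourier g"])
    also have "\<dots> \<le> \<epsilon> / 2" using g(2) by simp
    finally show "L2_norm f \<le> L2_norm (L1_fourier f) + \<epsilon>" by simp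
  qed
qed

lemma L2_reflect:
  assumes "f \<in> L2"
  shows "(\<lambda>x. f (- x)) \<in> L2" "L2_norm (\<lambda>x. f (- x)) = L2_norm f"
  using L2_affine[OF assms, of "-1" 0] by (auto simp: L2_norm_nonneg power2_eq_iff_nonneg)

lemma L2_contraction_inverse_fourier: "L2_contraction L2_bounded_support inverse_fourier"
proof -
  have "inverse_fourier f \<in> L2 \<and> L2_norm (inverse_fourier f) \<le> L2_norm f"
    if "f \<in> L2_bounded_support" for f
    using L2_reflect[of "L1_fourier f"] L1_fourier_norm_le[OF that]
    by (auto simp: inverse_fourier_def[abs_def])
  then show ?thesis
    using L2_contraction_fourier
    by (auto simp: L2_contraction_def inverse_fourier_def[abs_def])
qed

lemma inverse_fourier_norm:
  assumes "f \<in> L2_bounded_support"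
  shows "L2_norm (inverse_fourier f) = L2_norm f"
  using L2_reflect(2)[of "L1_fourier f"] L1_fourier_norm_le[OF assms] plancherel_norm[OF assms]
  by (auto simp: inverse_fourier_def[abs_def])

lemma inverse_fourier_inner:
  assumes "f \<in> L2_bounded_support" "g \<in> L2_bounded_support"
  shows "L2_inner (inverse_fourier f) (inverse_fourier g) = L2_inner f g"
  by (rule L2_isometry_inner[OF L2_contraction_inverse_fourier inverse_fourier_norm assms])

lemma L2_cutoff:
  assumes "f \<in> L2"
  shows "(\<lambda>x. f x * indicator {- real n<..real n} x) \<in> L2_bounded_support"
    and "L2_converges (\<lambda>n x. f x * indicator {- real n<..real n} x) f"
proof -
  show *: "(\<lambda>x. f x * indicator {- real n<..real n} x) \<in> L2_bounded_support" for n
    by (rule L2_bounded_supportI[where N = "real n"])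
       (auto intro!: L2_truncate assms split: split_indicator)
  have "(\<lambda>n. f x * indicator {- real n<..real n} x) \<longlonglongrightarrow> f x" for x
  proof -
    obtain k :: nat where k: "\<bar>x\<bar> < real k" using reals_Archimedean2 by blast
    have "eventually (\<lambda>n. f x = f x * indicator {- real n<..real n} x) sequentially"
      using eventually_ge_at_top[of k]
      by eventually_elim (use k in \<open>auto simp: indicator_def\<close>)
    then show ?thesis by (rule Lim_transform_eventually[OF tendsto_const])
  qed
  then show "L2_converges (\<lambda>n x. f x * indicator {- real n<..real n} x) f"
    by (intro L2_dominated_convergence[OF assms] L2_measurable L2_bounded_support_L2[OF *] assms)
       (auto simp: indicator_def)
qed

text \<open>
  Write \<open>h\<close> for the transform of \<open>g\<close> and \<open>h\<^sub>n\<close> for its truncations.  By Plancherel the inverse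
  transform of \<open>h\<^sub>n\<close> has the norm of \<open>h\<^sub>n\<close>, and by duality its inner product with \<open>g\<close> is that
  of \<open>h\<^sub>n\<close> with \<open>h\<close>, so its distance to \<open>g\<close> is exactly the distance of \<open>h\<^sub>n\<close> to \<open>h\<close>.
\<close>

theorem fourier_inversion:
  assumes "g \<in> L2_bounded_support"
  shows "L2_converges
    (\<lambda>n. inverse_fourier (\<lambda>\<xi>. L1_fourier g \<xi> * indicator {- real n<..real n} \<xi>)) g"
proof -
  define h where "h = L1_fourier g"
  define hn where "hn n = (\<lambda>\<xi>. h \<xi> * indicator {- real n<..real n} \<xi>)" for n
  have g: "g \<in> L2" by (rule L2_bounded_support_L2[OF assms])
  have h: "h \<in> L2" using L1_fourier_norm_le[OF assms] by (simp add: h_def)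
  have hn: "hn n \<in> L2_bounded_support" for n unfolding hn_def by (rule L2_cutoff(1)[OF h])
  have hnL2: "hn n \<in> L2" for n by (rule L2_bounded_support_L2[OF hn])
  have inv: "inverse_fourier (hn n) \<in> L2" for n
    by (rule L2_contractionD(2)[OF L2_contraction_inverse_fourier hn])
  have "L2_norm (\<lambda>x. inverse_fourier (hn n) x - g x) = L2_norm (\<lambda>\<xi>. hn n \<xi> - h \<xi>)" for n
  proof -
    have "L2_inner (inverse_fourier (hn n)) g = L2_inner (hn n) h"
      unfolding h_def by (intro inverse_fourier_adjoint L2_bounded_support_integrable hn assms)
    then have "(L2_norm (\<lambda>x. inverse_fourier (hn n) x - g x))\<^sup>2 = (L2_norm (\<lambda>\<xi>. hn n \<xi> - h \<xi>))\<^sup>2"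
      using L2_norm_diff_power2[OF inv g, of n] L2_norm_diff_power2[OF hnL2 h, of n]
        inverse_fourier_norm[OF hn, of n] plancherel_norm[OF assms] by (simp add: h_def)
    then show ?thesis by (simp add: L2_norm_nonneg power2_eq_iff_nonneg)
  qed
  moreover have "(\<lambda>n. L2_norm (\<lambda>\<xi>. hn n \<xi> - h \<xi>)) \<longlonglongrightarrow> 0"
    using L2_cutoff(2)[OF h] by (simp add: L2_converges_def hn_def)
  ultimately show ?thesis
    using inv g by (simp add: L2_converges_def hn_def h_def)
qed

text \<open>
  Truncations of the inverse transform of \<open>g\<close> serve as the integrable approximants.  That their
  transforms converge to \<open>g\<close> is the inversion theorem for the reflection of \<open>g\<close>, because the
  inverse transform of \<open>g\<close> is the transform of that reflection.
\<close>

lemma has_fourier_transform_inverse_fourier: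
  assumes g: "g \<in> L2_bounded_support"
  shows "has_fourier_transform (inverse_fourier g) g"
proof -
  define \<psi> where "\<psi> = inverse_fourier g"
  define F where "F n = (\<lambda>x. \<psi> x * indicator {- real n<..real n} x)" for n
  let ?g = "\<lambda>x. g (- x)"
  have g': "?g \<in> L2_bounded_support"
    using g L2_reflect(1)[of g] by (auto simp: L2_bounded_support_def) (metis abs_minus_cancel)
  have \<psi>: "\<psi> \<in> L2" unfolding \<psi>_def by (rule L2_contractionD(2)[OF L2_contraction_inverse_fourier g])
  have \<psi>_eq: "\<psi> = L1_fourier ?g" by (auto simp: \<psi>_def inverse_fourier_def L1_fourier_reflect)
  have F: "F n \<in> L2_bounded_support" for n unfolding F_def by (rule L2_cutoff(1)[OF \<psi>])
  have "L2_converges (\<lambda>n. inverse_fourier (F n)) ?g"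
    unfolding F_def \<psi>_eq by (rule fourier_inversion[OF g'])
  then have "(\<lambda>n. L2_norm (\<lambda>x. inverse_fourier (F n) x - ?g x)) \<longlonglongrightarrow> 0"
    by (simp add: L2_converges_def)
  moreover have "L2_norm (\<lambda>x. inverse_fourier (F n) x - ?g x)
      = L2_norm (\<lambda>\<xi>. L1_fourier (F n) \<xi> - g \<xi>)" for n
    using L2_reflect(2)[of "\<lambda>\<xi>. L1_fourier (F n) \<xi> - g \<xi>"] L1_fourier_norm_le[OF F[of n]]
    by (simp add: inverse_fourier_def L2_diff L2_bounded_support_L2[OF g])
  ultimately have "L2_converges (\<lambda>n. L1_fourier (F n)) g"
    using L1_fourier_norm_le[OF F] by (simp add: L2_converges_def L2_bounded_support_L2[OF g])
  moreover have "L2_converges F \<psi>" unfolding F_def by (rule L2_cutoff(2)[OF \<psi>])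
  moreover have "integrable lebesgue (F n)" for n by (rule L2_bounded_support_integrable[OF F])
  ultimately show ?thesis unfolding has_fourier_transform_def \<psi>_def by blast
qed

text \<open>
  By inversion every function of bounded support is a limit of inverse transforms of truncated
  functions.
\<close>

lemma inverse_fourier_dense: "closed_span (inverse_fourier ` L2_bounded_support) = L2"
proof (intro equalityI closed_span_L2 subsetI)
  let ?E = "inverse_fourier ` L2_bounded_support"
  have E: "?E \<subseteq> L2" using L2_contractionD(2)[OF L2_contraction_inverse_fourier] by blast
  have bounded: "f \<in> closed_span ?E" if f: "f \<in> L2_bounded_support" for f
  proof (rule closed_span_converges[OF E fourier_inversion[OF f]])
    fix n
    have "(\<lambda>\<xi>. L1_fourier f \<xi> * indicator {- real n<..real n} \<xi>) \<in> L2_bounded_support"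
      using L1_fourier_norm_le[OF f] by (intro L2_cutoff(1)) blast
    then show "inverse_fourier (\<lambda>\<xi>. L1_fourier f \<xi> * indicator {- real n<..real n} \<xi>) \<in> closed_span ?E"
      using lin_span_subset_closed_span[OF E] lin_span.base by blast
  qed
  fix f assume "f \<in> L2"
  then show "f \<in> closed_span ?E"
    using closed_span_converges[OF E L2_cutoff(2) bounded[OF L2_cutoff(1)]] by blast
qed

section \<open>Trigonometric polynomials on the unit interval\<close>

definition unit_exponentials :: "(real \<Rightarrow> complex) set" where
  "unit_exponentials = range (\<lambda>(k::int) x. fourier_char (of_int k) x * indicator {0<..1} x)"

lemma fourier_char_restrict_L2:
  assumes "A \<in> sets lebesgue" "A \<subseteq> {a..b}"
  shows "(\<lambda>x. fourier_char \<xi> x * indicator A x) \<in> L2"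
  by (rule L2_dominated[OF L2_indicator(1)[OF assms]])
     (use assms(1) in \<open>auto intro!: borel_measurable_times borel_measurable_indicator
        measurable_fourier_char simp: norm_mult\<close>)

lemma unit_exponentials_L2: "unit_exponentials \<subseteq> L2"
proof -
  have "{0<..1::real} \<subseteq> {0..1}" by auto
  then show ?thesis
    unfolding unit_exponentials_def by (auto intro!: fourier_char_restrict_L2[where a = 0 and b = 1])
qed

abbreviation trig_polys :: "(real \<Rightarrow> complex) set" where
  "trig_polys \<equiv> lin_span (range (\<lambda>k::int. fourier_char (of_int k)))"

lemma trig_polys_const: "(\<lambda>_. c) \<in> trig_polys"
proof -
  have "fourier_char (of_int 0) = (\<lambda>_. 1)" by auto
  then have "(\<lambda>_. 1) \<in> trig_polys" by (metis lin_span.base rangeI)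
  from lin_span.cmult[OF this, of c] show ?thesis by simp
qed

text \<open>
  Closure under products is what lets ordinary polynomials in a trigonometric polynomial replace
  an approximation theorem on the circle.
\<close>

lemma trig_polys_mult:
  assumes "f \<in> trig_polys" "g \<in> trig_polys"
  shows "(\<lambda>x. f x * g x) \<in> trig_polys"
proof -
  have *: "(\<lambda>x. fourier_char (of_int k) x * g x) \<in> trig_polys" for k :: int
    using assms(2)
  proof induction
    case (base g)
    then obtain l :: int where "g = fourier_char (of_int l)" by auto
    then have "(\<lambda>x. fourier_char (of_int k) x * g x) = fourier_char (of_int (k + l))"
      by (auto simp: fourier_char_add_left)
    then show ?case by (metis lin_span.base rangeI)
  next
    case zero
    show ?case using lin_span.zero by simp
  next
    case (add g h)
    then show ?case using lin_span.add[OF add.IH] by (simp add: distrib_left)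
  next
    case (cmult g c)
    then show ?case using lin_span.cmult[OF cmult.IH, of c] by (simp add: mult_ac)
  qed
  show ?thesis
    using assms(1)
  proof induction
    case (base f)
    then show ?case using * by auto
  next
    case zero
    show ?case using lin_span.zero by simp
  next
    case (add f h)
    then show ?case using lin_span.add[OF add.IH] by (simp add: distrib_right)
  next
    case (cmult f c)
    then show ?case using lin_span.cmult[OF cmult.IH, of c] by (simp add: mult_ac)
  qed
qed

lemma trig_polys_power: "f \<in> trig_polys \<Longrightarrow> (\<lambda>x. f x ^ n) \<in> trig_polys"
  by (induction n) (auto intro: trig_polys_const trig_polys_mult)

lemma trig_polys_restrict:
  assumes "f \<in> trig_polys"
  shows "(\<lambda>x. f x * indicator {0<..1} x) \<in> lin_span unit_exponentials"
  using assms
proof induction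
  case (base f)
  then show ?case by (auto simp: unit_exponentials_def intro!: lin_span.base)
next
  case zero
  show ?case using lin_span.zero[of unit_exponentials] by simp
next
  case (add f g)
  then show ?case using lin_span.add[OF add.IH] by (simp add: distrib_right)
next
  case (cmult f c)
  then show ?case using lin_span.cmult[OF cmult.IH, of c] by (simp add: mult.assoc)
qed

text \<open>
  A trigonometric polynomial with values in \<open>[0, 1]\<close> that decreases with the distance from \<open>m\<close>
  on the circle: composed with it, functions of one real variable become periodic.
\<close>

definition bump :: "real \<Rightarrow> real \<Rightarrow> real" where
  "bump m x = (1 + cos (2 * pi * (x - m))) / 2"

lemma bump_bounds: "bump m x \<in> {0..1}"
  unfolding bump_def by (auto simp: cos_le_one) (use cos_ge_minus_one[of "2 * pi * (x - m)"] in linarith)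

lemma continuous_bump: "continuous_on A (bump m)"
  unfolding bump_def by (auto intro!: continuous_intros)

lemma bump_trig_poly: "(\<lambda>x. complex_of_real (bump m x)) \<in> trig_polys"
proof -
  define c where "c = cis (- 2 * pi * m)"
  have "complex_of_real (bump m x) = 1 / 2 + ((c / 4) * fourier_char (of_int (-1)) x
      + (cnj c / 4) * fourier_char (of_int 1) x)" for x
  proof -
    have e: "c * fourier_char (of_int (-1)) x = cis (2 * pi * (x - m))"
      by (simp add: c_def fourier_char_def cis_mult algebra_simps)
    have "cnj c * fourier_char (of_int 1) x = cnj (cis (2 * pi * (x - m)))"
      by (simp add: c_def fourier_char_def cis_mult cis_cnj algebra_simps)
    with e have "(c / 4) * fourier_char (of_int (-1)) x + (cnj c / 4) * fourier_char (of_int 1) x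
        = (cis (2 * pi * (x - m)) + cnj (cis (2 * pi * (x - m)))) / 4"
      by (simp add: add_divide_distrib)
    then show ?thesis
      by (simp add: complex_add_cnj bump_def complex_eq_iff)
  qed
  then have eq: "(\<lambda>x. complex_of_real (bump m x)) = (\<lambda>x. 1 / 2 +
      ((c / 4) * fourier_char (of_int (-1)) x + (cnj c / 4) * fourier_char (of_int 1) x))"
    by (rule ext)
  show ?thesis unfolding eq
    by (rule lin_span.add[OF trig_polys_const lin_span.add])
       (rule lin_span.cmult[OF lin_span.base[OF rangeI]])+
qed

text \<open>
  A continuous function of the bump is a uniform limit of trigonometric polynomials, namely of
  its Bernstein polynomials in the bump.
\<close>

lemma continuous_bump_in_closed_span:
  fixes \<phi> :: "real \<Rightarrow> real"
  assumes "continuous_on {0..1} \<phi>"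
  shows "(\<lambda>x. of_real (\<phi> (bump m x)) * indicator {0<..1} x) \<in> closed_span unit_exponentials"
proof (rule closed_spanI)
  let ?f = "\<lambda>x. complex_of_real (\<phi> (bump m x)) * indicator {0<..1} x"
  have cont: "continuous_on UNIV (\<lambda>x. \<phi> (bump m x))"
  proof (rule continuous_on_compose2[OF assms continuous_bump[of UNIV m]])
    show "bump m ` UNIV \<subseteq> {0..1}" using bump_bounds[of m] by blast
  qed
  have "(\<lambda>x. \<phi> (bump m x)) \<in> borel_measurable lebesgue"
    by (rule borel_measurable_lebesgueI[OF borel_measurable_continuous_onI[OF cont]])
  then have meas: "?f \<in> borel_measurable lebesgue"
    by (intro borel_measurable_times borel_measurable_indicator borel_measurable_of_real) auto
  obtain B where "\<forall>y\<in>{0..1}. \<bar>\<phi> y\<bar> \<le> B"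
    using compact_imp_bounded[OF compact_continuous_image[OF assms compact_Icc]]
    by (auto simp: bounded_iff)
  then have B: "\<bar>\<phi> (bump m x)\<bar> \<le> \<bar>B\<bar>" for x
    using bump_bounds[of m x] by (auto dest!: bspec)
  show L2: "?f \<in> L2"
    by (rule L2_dominated[OF L2_cmult[OF indicator_Ioc_L2(1)[of 0 1], of "of_real B"] meas])
       (use B in \<open>auto simp: norm_mult split: split_indicator\<close>)
  fix \<epsilon> :: real assume "\<epsilon> > 0"
  then obtain N where N: "\<And>n y. N \<le> n \<Longrightarrow> y \<in> {0..1} \<Longrightarrow>
      \<bar>\<phi> y - (\<Sum>k\<le>n. \<phi> (k / n) * Bernstein n k y)\<bar> < \<epsilon> / 2"
    using Bernstein_Weierstrass[OF assms, of "\<epsilon> / 2"] by auto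
  define p where "p x = (\<Sum>k\<le>N. of_real (\<phi> (k / N) * (N choose k))
      * ((complex_of_real (bump m x)) ^ k * (1 - complex_of_real (bump m x)) ^ (N - k)))" for x
  have p: "p x = of_real (\<Sum>k\<le>N. \<phi> (k / N) * Bernstein N k (bump m x))" for x
    by (simp add: p_def Bernstein_def mult_ac)
  have "(\<lambda>x. 1 - complex_of_real (bump m x)) \<in> trig_polys"
    using lin_span.add[OF trig_polys_const lin_span.cmult[OF bump_trig_poly, of "-1"], of 1] by simp
  then have "p \<in> trig_polys"
    unfolding p_def
    by (intro lin_span_sum lin_span.cmult trig_polys_mult trig_polys_power bump_trig_poly) auto
  then have span: "(\<lambda>x. p x * indicator {0<..1} x) \<in> lin_span unit_exponentials"
    by (rule trig_polys_restrict)
  have "L2_norm (\<lambda>x. ?f x - p x * indicator {0<..1} x)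
      \<le> L2_norm (\<lambda>x. of_real (\<epsilon> / 2) * indicator {0<..1} x)"
  proof (rule L2_norm_mono)
    show "(\<lambda>x. ?f x - p x * indicator {0<..1} x) \<in> borel_measurable lebesgue"
      using L2 span lin_span_L2[OF unit_exponentials_L2] by (intro L2_measurable L2_diff) auto
    show "(\<lambda>x. of_real (\<epsilon> / 2) * indicator {0<..1} x) \<in> L2"
      by (intro L2_cmult indicator_Ioc_L2)
    have "cmod (of_real (\<phi> (bump m x)) - p x) \<le> \<epsilon> / 2" for x
      unfolding p of_real_diff[symmetric] norm_of_real
      using N[OF order.refl bump_bounds[of m x]] by simp
    then show "AE x in lebesgue. cmod (?f x - p x * indicator {0<..1} x)
        \<le> cmod (of_real (\<epsilon> / 2) * indicator {0<..1} x)"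
      using \<open>\<epsilon> > 0\<close> by (auto simp: indicator_def)
  qed
  also have "\<dots> = \<epsilon> / 2"
  proof -
    have "(L2_norm (indicator {0<..1::real}))\<^sup>2 = 1\<^sup>2" using indicator_Ioc_L2(2)[of 0 1] by simp
    then have "L2_norm (indicator {0<..1::real}) = 1"
      by (simp only: power2_eq_iff_nonneg L2_norm_nonneg zero_le_one)
    then show ?thesis unfolding L2_norm_cmult using \<open>\<epsilon> > 0\<close> by simp
  qed
  also have "\<dots> < \<epsilon>" using \<open>\<epsilon> > 0\<close> by simp
  finally show "\<exists>g\<in>lin_span unit_exponentials. L2_norm (\<lambda>x. ?f x - g x) < \<epsilon>"
    using span by (intro bexI[of _ "\<lambda>x. p x * indicator {0<..1} x"]) simp
qed

text \<open>
  An interval inside the unit interval is a superlevel set of the bump at its midpoint, because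
  its complement in the circle lies farther from the midpoint.
\<close>

lemma bump_superlevel:
  assumes "0 \<le> c" "c \<le> d" "d \<le> 1" "0 < x" "x < 1"
  shows "bump ((c + d) / 2) c \<le> bump ((c + d) / 2) x \<longleftrightarrow> x \<in> {c..d}"
proof -
  define r where "r = (d - c) / 2"
  define u where "u = \<bar>x - (c + d) / 2\<bar>"
  have r: "0 \<le> r" "r \<le> 1 / 2" using assms by (auto simp: r_def)
  have u: "0 \<le> u" "u < 1" "u < 1 - r"
    using assms by (auto simp: u_def r_def abs_if field_simps)
  have cu: "cos (2 * pi * (x - (c + d) / 2)) = cos (2 * pi * u)"
    unfolding u_def abs_if by (auto simp: minus_mult_right[symmetric] simp del: minus_diff_eq)
  have "2 * pi * (c - (c + d) / 2) = - (2 * pi * r)" by (simp add: r_def field_simps)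
  then have cr: "cos (2 * pi * (c - (c + d) / 2)) = cos (2 * pi * r)" by (simp only: cos_minus)
  have mono: "cos (2 * pi * s) \<le> cos (2 * pi * t) \<longleftrightarrow> t \<le> s"
    if "0 \<le> s" "s \<le> 1 / 2" "0 \<le> t" "t \<le> 1 / 2" for s t
  proof -
    have "2 * pi * s \<le> 2 * pi * (1 / 2)" "2 * pi * t \<le> 2 * pi * (1 / 2)"
      using that by (intro mult_left_mono; simp)+
    then show ?thesis using that by (subst cos_mono_le_eq) auto
  qed
  have "cos (2 * pi * r) \<le> cos (2 * pi * u) \<longleftrightarrow> u \<le> r"
  proof (cases "u \<le> 1 / 2")
    case True
    then show ?thesis using mono r u by auto
  next
    case False
    have "cos (2 * pi * u) = cos (2 * pi * (1 - u))"
      using cos_2pi_minus[of "2 * pi * u"] by (simp add: right_diff_distrib)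
    moreover have "cos (2 * pi * r) \<le> cos (2 * pi * (1 - u)) \<longleftrightarrow> 1 - u \<le> r"
      using False u r by (intro mono) auto
    ultimately show ?thesis using False u r by auto
  qed
  then have "bump ((c + d) / 2) c \<le> bump ((c + d) / 2) x \<longleftrightarrow> u \<le> r"
    unfolding bump_def cu cr by simp
  also have "\<dots> \<longleftrightarrow> x \<in> {c..d}" by (auto simp: u_def r_def abs_le_iff field_simps)
  finally show ?thesis .
qed

lemma unit_interval_indicator_in_closed_span:
  assumes "0 \<le> c" "c \<le> d" "d \<le> 1"
  shows "indicator {c<..d} \<in> closed_span unit_exponentials"
proof -
  define m where "m = (c + d) / 2"
  define \<phi> where "\<phi> n y = max 0 (min 1 (1 - real n * (bump m c - y)))" for n y
  define F where "F n x = complex_of_real (\<phi> n (bump m x)) * indicator {0<..1} x" for n x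
  have F: "F n \<in> closed_span unit_exponentials" for n
    unfolding F_def[abs_def] \<phi>_def
    by (rule continuous_bump_in_closed_span) (intro continuous_intros)
  have lim: "(\<lambda>n. \<phi> n y) \<longlonglongrightarrow> (if bump m c \<le> y then 1 else 0)" for y
  proof (cases "bump m c \<le> y")
    case True
    then have "real n * (bump m c - y) \<le> 0" for n by (simp add: mult_nonneg_nonpos)
    then show ?thesis using True by (simp add: \<phi>_def min_def)
  next
    case False
    then have pos: "bump m c - y > 0" by simp
    obtain k :: nat where k: "1 / (bump m c - y) < real k" using reals_Archimedean2 by blast
    have "eventually (\<lambda>n. 0 = \<phi> n y) sequentially"
      using eventually_ge_at_top[of k]
    proof eventually_elim
      case (elim n)
      then have "1 / (bump m c - y) \<le> real n" using k by linarith
      then have "1 \<le> real n * (bump m c - y)" using pos by (simp add: pos_divide_le_eq)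
      then show ?case by (simp add: \<phi>_def)
    qed
    then have "(\<lambda>n. \<phi> n y) \<longlonglongrightarrow> 0" by (rule Lim_transform_eventually[OF tendsto_const])
    then show ?thesis using False by simp
  qed
  have "L2_converges F (indicator {c<..d})"
  proof (rule L2_dominated_convergence[OF indicator_Ioc_L2(1)[of 0 1]])
    show "F n \<in> borel_measurable lebesgue" for n using F closed_span_L2 L2_measurable by blast
    show "AE x in lebesgue. cmod (F n x) \<le> cmod (indicator {0<..1} x)" for n
      by (auto simp: F_def \<phi>_def norm_mult indicator_def)
    have "AE x in lebesgue. x \<noteq> (1::real)" "AE x in lebesgue. x \<noteq> c"
      by (rule AE_completion, rule AE_lborel_singleton)+
    then show "AE x in lebesgue. (\<lambda>n. F n x) \<longlonglongrightarrow> indicator {c<..d} x"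
    proof eventually_elim
      case (elim x)
      have "(\<lambda>n. F n x) \<longlonglongrightarrow> of_real (if bump m c \<le> bump m x then 1 else 0) * indicator {0<..1} x"
        unfolding F_def by (intro tendsto_intros lim)
      also have "of_real (if bump m c \<le> bump m x then 1 else 0) * indicator {0<..1} x
          = (indicator {c<..d} x :: complex)"
        using bump_superlevel[OF assms, of x] elim assms by (auto simp: m_def indicator_def)
      finally show ?case .
    qed
  qed (auto intro!: borel_measurable_indicator)
  then show ?thesis by (rule closed_span_converges[OF unit_exponentials_L2 _ F])
qed

lemma L2_contraction_restrict:
  assumes "A \<in> sets lebesgue"
  shows "L2_contraction L2 (\<lambda>f x. f x * indicator A x)"
proof -
  have "L2_norm (\<lambda>x. f x * indicator A x) \<le> L2_norm f" if "f \<in> L2" for f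
    by (rule L2_norm_mono[OF L2_measurable[OF L2_truncate[OF that assms]] that])
       (auto split: split_indicator)
  then show ?thesis
    by (auto simp: L2_contraction_def L2_add L2_cmult L2_truncate assms distrib_right mult.assoc)
qed

text \<open>
  Restriction to the unit interval is a contraction, so only step functions need to be
  approximated, and a restricted interval is again an interval inside the unit interval.
\<close>

theorem unit_exponentials_dense:
  assumes "f \<in> L2"
  shows "(\<lambda>x. f x * indicator {0<..1} x) \<in> closed_span unit_exponentials"
proof -
  let ?U = "\<lambda>f x. f x * indicator {0<..1::real} x :: complex"
  have "?U f \<in> closed_span (?U ` step_indicators)"
    by (rule closed_span_contraction[OF L2_contraction_restrict step_indicators_L2 assms])
       (use assms step_indicators_dense in auto)
  moreover have "closed_span (?U ` step_indicators) \<subseteq> closed_span unit_exponentials"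
  proof (rule closed_span_minimal[OF unit_exponentials_L2], rule image_subsetI)
    fix f assume "f \<in> step_indicators"
    then obtain a b where f: "f = indicator {a<..b}" by (auto simp: step_indicators_def)
    have eq: "?U f = indicator {max a 0<..max (max a 0) (min b 1)}"
      unfolding f by (rule ext) (auto split: split_indicator)
    show "?U f \<in> closed_span unit_exponentials"
    proof (cases "max a 0 \<le> 1")
      case True
      then show ?thesis unfolding eq by (intro unit_interval_indicator_in_closed_span) auto
    next
      case False
      then have "?U f = (\<lambda>_. 0)" unfolding f by (intro ext) (auto split: split_indicator)
      then show ?thesis using closed_span_zero[OF unit_exponentials_L2] by simp
    qed
  qed
  ultimately show ?thesis by blast
qed

lemma unit_exponentials_inner:
  "L2_inner (\<lambda>x. fourier_char (of_int k) x * indicator {0<..1} x)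
     (\<lambda>x. fourier_char (of_int l) x * indicator {0<..1} x) = (if k = l then 1 else 0)"
proof -
  have "L2_inner (\<lambda>x. fourier_char (of_int k) x * indicator {0<..1} x)
     (\<lambda>x. fourier_char (of_int l) x * indicator {0<..1} x)
     = L1_fourier (indicator {0<..1}) (of_int (k - l))"
    unfolding L2_inner_def L1_fourier_eq
  proof (rule Bochner_Integration.integral_cong)
    fix x
    show "fourier_char (of_int k) x * indicator {0<..1} x * cnj (fourier_char (of_int l) x * indicator {0<..1} x)
        = indicator {0<..1} x * fourier_char (of_int (k - l)) x"
      using fourier_char_add_left[of "of_int k" "- of_int l" x]
      by (auto simp: cnj_fourier_char split: split_indicator)
  qed simp
  also have "\<dots> = (if k = l then 1 else 0)"
  proof (cases "k = l")
    case True
    then have "L1_fourier (indicator {0<..1}) (of_int (k - l))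
        = L2_inner (indicator {0<..1}) (indicator {0<..1})"
      unfolding L2_inner_def L1_fourier_eq
      by (intro Bochner_Integration.integral_cong) (auto split: split_indicator)
    then show ?thesis using True indicator_Ioc_L2(2)[of 0 1] by (simp add: L2_inner_self)
  next
    case False
    then have "L1_fourier (indicator {0<..1}) (of_int (k - l))
        = (fourier_char (of_int (k - l)) (of_int 0) - fourier_char (of_int (k - l)) (of_int 1))
          / (2 * of_real pi * \<i> * of_real (of_int (k - l)))"
      using L1_fourier_interval[of 0 1 "of_int (k - l)"] by simp
    then show ?thesis using False by (simp only: fourier_char_of_int) simp
  qed
  finally show ?thesis .
qed

section \<open>Sets that tile by translations\<close>

lemma L2_sum: "(\<And>i. i \<in> S \<Longrightarrow> f i \<in> L2) \<Longrightarrow> (\<lambda>x. \<Sum>i\<in>S. f i x) \<in> L2"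
  by (induction S rule: infinite_finite_induct) (auto intro: L2_add)

definition unit_supported :: "(real \<Rightarrow> complex) set" where
  "unit_supported = {F \<in> L2. \<forall>x. x \<notin> {0<..1} \<longrightarrow> F x = 0}"

text \<open>
  For \<open>F\<close> supported in the unit interval, this is the 1-periodic extension of \<open>F\<close> restricted to
  \<open>K\<close>.  The sum is cut off at \<open>M\<close> to keep it finite; for a bounded set \<open>K\<close> and large \<open>M\<close> no
  term is lost.
\<close>

definition transplant :: "real set \<Rightarrow> int \<Rightarrow> (real \<Rightarrow> complex) \<Rightarrow> real \<Rightarrow> complex" where
  "transplant K M F \<xi> = (\<Sum>k\<in>{- M..M}. F (\<xi> - of_int k) * indicator K \<xi>)"

lemma unit_supported_shift:
  assumes "F \<in> unit_supported" "k \<noteq> \<lceil>\<xi>\<rceil> - 1"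
  shows "F (\<xi> - of_int k) = 0"
proof -
  have "\<xi> - of_int k \<notin> {0<..1}"
  proof
    assume "\<xi> - of_int k \<in> {0<..1}"
    then have "\<lceil>\<xi>\<rceil> = k + 1" by (intro ceiling_unique) auto
    with assms(2) show False by simp
  qed
  then show ?thesis using assms(1) by (auto simp: unit_supported_def)
qed

lemma transplant_eq:
  assumes "F \<in> unit_supported" "K \<subseteq> {- of_int (M - 1)<..of_int (M - 1)}"
  shows "transplant K M F \<xi> = F (\<xi> - of_int (\<lceil>\<xi>\<rceil> - 1)) * indicator K \<xi>"
proof (cases "\<xi> \<in> K")
  case True
  then have "of_int (- (M - 1)) < \<xi>" "\<xi> \<le> of_int (M - 1)" using assms(2) by auto
  then have "- (M - 1) < \<lceil>\<xi>\<rceil>" "\<lceil>\<xi>\<rceil> \<le> M - 1"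
    by (simp_all only: less_ceiling_iff ceiling_le_iff)
  then have k: "\<lceil>\<xi>\<rceil> - 1 \<in> {- M..M}" by simp
  have "transplant K M F \<xi>
      = (\<Sum>k\<in>{- M..M}. if k = \<lceil>\<xi>\<rceil> - 1 then F (\<xi> - of_int k) * indicator K \<xi> else 0)"
    unfolding transplant_def
  proof (rule sum.cong)
    show "F (\<xi> - of_int k) * indicator K \<xi>
        = (if k = \<lceil>\<xi>\<rceil> - 1 then F (\<xi> - of_int k) * indicator K \<xi> else 0)" for k
      using unit_supported_shift[OF assms(1), of k \<xi>] by auto
  qed simp
  then show ?thesis using k by simp
qed (simp add: transplant_def)

text \<open>
  If \<open>K\<close> meets almost every class modulo 1 exactly once, moving the values of a function on the
  unit interval to the congruent points of \<open>K\<close> preserves the norm: the square of the result is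
  integrated one translate of the unit interval at a time.
\<close>

lemma transplant_isometry:
  assumes K: "K \<in> sets lebesgue" "K \<subseteq> {- of_int (M - 1)<..of_int (M - 1)}"
    and tile: "AE x in lebesgue. \<exists>!k::int. x + of_int k \<in> K"
    and F: "F \<in> unit_supported"
  shows "transplant K M F \<in> L2" "L2_norm (transplant K M F) = L2_norm F"
proof -
  define f where "f k \<xi> = F (\<xi> - of_int k) * indicator K \<xi>" for k :: int and \<xi>
  have FL2: "F \<in> L2" and F0: "\<And>x. x \<notin> {0<..1} \<Longrightarrow> F x = 0"
    using F by (auto simp: unit_supported_def)
  have fL2: "f k \<in> L2" for k
    unfolding f_def using L2_truncate[OF L2_affine(1)[OF FL2, of 1 "- of_int k"] K(1)] by simp
  have T: "transplant K M F = (\<lambda>\<xi>. \<Sum>k\<in>{- M..M}. f k \<xi>)"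
    by (simp add: transplant_def[abs_def] f_def)
  show "transplant K M F \<in> L2" unfolding T by (intro L2_sum fL2)
  have sq: "(cmod (transplant K M F \<xi>))\<^sup>2 = (\<Sum>k\<in>{- M..M}. (cmod (f k \<xi>))\<^sup>2)" for \<xi>
  proof -
    define k0 where "k0 = \<lceil>\<xi>\<rceil> - 1"
    have z: "f k \<xi> = 0" if "k \<noteq> k0" for k
      using unit_supported_shift[OF F, of k \<xi>] that by (simp add: f_def k0_def)
    have "(\<Sum>k\<in>{- M..M}. (cmod (f k \<xi>))\<^sup>2) = (\<Sum>k\<in>{- M..M}. if k = k0 then (cmod (f k \<xi>))\<^sup>2 else 0)"
      by (rule sum.cong) (use z in auto)
    moreover have "(\<Sum>k\<in>{- M..M}. f k \<xi>) = (\<Sum>k\<in>{- M..M}. if k = k0 then f k \<xi> else 0)"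
      by (rule sum.cong) (use z in auto)
    ultimately show ?thesis unfolding T by simp
  qed
  have shift: "(LINT \<xi>|lebesgue. (cmod (f k \<xi>))\<^sup>2)
      = (LINT x|lebesgue. (cmod (F x))\<^sup>2 * indicator K (x + of_int k))"
    and shift_int: "integrable lebesgue (\<lambda>x. (cmod (F x))\<^sup>2 * indicator K (x + of_int k))" for k
  proof -
    have eq: "(cmod (f k (of_int k + 1 * x)))\<^sup>2 = (cmod (F x))\<^sup>2 * indicator K (x + of_int k)" for x
      by (simp add: f_def norm_mult power_mult_distrib add.commute split: split_indicator)
    show "(LINT \<xi>|lebesgue. (cmod (f k \<xi>))\<^sup>2)
      = (LINT x|lebesgue. (cmod (F x))\<^sup>2 * indicator K (x + of_int k))"
      using lebesgue_integral_real_affine[of 1 "\<lambda>\<xi>. (cmod (f k \<xi>))\<^sup>2" "of_int k"]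
      unfolding eq by simp
    show "integrable lebesgue (\<lambda>x. (cmod (F x))\<^sup>2 * indicator K (x + of_int k))"
      using L2_integrable[OF fL2[of k]]
        lebesgue_integrable_real_affine_iff[of 1 "\<lambda>\<xi>. (cmod (f k \<xi>))\<^sup>2" "of_int k"]
      unfolding eq by simp
  qed
  have "(L2_norm (transplant K M F))\<^sup>2 = (\<Sum>k\<in>{- M..M}. (LINT \<xi>|lebesgue. (cmod (f k \<xi>))\<^sup>2))"
    unfolding L2_norm_power2 sq
    by (rule Bochner_Integration.integral_sum) (rule L2_integrable[OF fL2])
  also have "\<dots> = (LINT x|lebesgue. (\<Sum>k\<in>{- M..M}. (cmod (F x))\<^sup>2 * indicator K (x + of_int k)))"
    unfolding shift by (rule Bochner_Integration.integral_sum[symmetric]) (rule shift_int)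
  also have "\<dots> = (LINT x|lebesgue. (cmod (F x))\<^sup>2)"
  proof (rule integral_cong_AE)
    show "(\<lambda>x. \<Sum>k\<in>{- M..M}. (cmod (F x))\<^sup>2 * indicator K (x + of_int k)) \<in> borel_measurable lebesgue"
      by (intro borel_measurable_sum borel_measurable_integrable shift_int)
    show "(\<lambda>x. (cmod (F x))\<^sup>2) \<in> borel_measurable lebesgue"
      by (rule borel_measurable_integrable[OF L2_integrable[OF FL2]])
    show "AE x in lebesgue. (\<Sum>k\<in>{- M..M}. (cmod (F x))\<^sup>2 * indicator K (x + of_int k)) = (cmod (F x))\<^sup>2"
      using tile
    proof eventually_elim
      case (elim x)
      then obtain k0 :: int where k0: "x + of_int k0 \<in> K" "\<And>k::int. x + of_int k \<in> K \<Longrightarrow> k = k0" by blast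
      show ?case
      proof (cases "x \<in> {0<..1}")
        case True
        have "- of_int (M - 1) < x + of_int k0" "x + of_int k0 \<le> of_int (M - 1)" using K(2) k0(1) by auto
        then have "of_int (- M) < (of_int k0 :: real)" "(of_int k0 :: real) < of_int M" using True by auto
        then have "k0 \<in> {- M..M}" by (simp only: of_int_less_iff) auto
        moreover have "indicator K (x + of_int k) = (if k = k0 then 1 else 0 :: real)" for k :: int
          using k0(1) k0(2)[of k] by (cases "k = k0") (auto simp: indicator_def)
        ultimately show ?thesis by (simp add: if_distrib[of "(*) _"] cong: if_cong)
      qed (simp add: F0)
    qed
  qed
  finally show "L2_norm (transplant K M F) = L2_norm F"
    by (simp add: L2_norm_power2[symmetric] L2_norm_nonneg power2_eq_iff_nonneg)
qed

definition restricted_exponential :: "real set \<Rightarrow> int \<Rightarrow> real \<Rightarrow> complex" where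
  "restricted_exponential K k x = fourier_char (of_int k) x * indicator K x"

lemma unit_exponentials_eq: "unit_exponentials = range (restricted_exponential {0<..1})"
  by (simp add: unit_exponentials_def restricted_exponential_def[abs_def])

lemma unit_exponential_supported: "restricted_exponential {0<..1} k \<in> unit_supported"
  using unit_exponentials_L2
  by (auto simp: unit_exponentials_eq unit_supported_def restricted_exponential_def)

lemma transplant_exponential:
  assumes "K \<subseteq> {- of_int (M - 1)<..of_int (M - 1)}"
  shows "transplant K M (restricted_exponential {0<..1} k) = restricted_exponential K k"
proof
  fix \<xi> :: real
  let ?y = "\<xi> - of_int (\<lceil>\<xi>\<rceil> - 1)"
  have "?y \<in> {0<..1}" by (simp add: algebra_simps) linarith
  moreover have "fourier_char (of_int k) ?y = fourier_char (of_int k) \<xi>"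
    using fourier_char_add[of "of_int k" \<xi> "of_int (- (\<lceil>\<xi>\<rceil> - 1))"]
    unfolding fourier_char_of_int by (simp add: algebra_simps)
  ultimately show "transplant K M (restricted_exponential {0<..1} k) \<xi> = restricted_exponential K k \<xi>"
    unfolding transplant_eq[OF unit_exponential_supported assms] restricted_exponential_def
    by (simp split: split_indicator)
qed

lemma L2_contraction_transplant:
  assumes K: "K \<in> sets lebesgue" "K \<subseteq> {- of_int (M - 1)<..of_int (M - 1)}"
    and tile: "AE x in lebesgue. \<exists>!k::int. x + of_int k \<in> K"
  shows "L2_contraction unit_supported (transplant K M)"
  using transplant_isometry[OF assms]
  by (auto simp: L2_contraction_def unit_supported_def L2_add L2_cmult transplant_def[abs_def]
      distrib_right sum.distrib sum_distrib_left mult.assoc)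

lemma restricted_exponential_inner:
  assumes K: "K \<in> sets lebesgue" "K \<subseteq> {- of_int (M - 1)<..of_int (M - 1)}"
    and tile: "AE x in lebesgue. \<exists>!k::int. x + of_int k \<in> K"
  shows "L2_inner (restricted_exponential K k) (restricted_exponential K l) = (if k = l then 1 else 0)"
proof -
  have "L2_inner (restricted_exponential K k) (restricted_exponential K l)
      = L2_inner (restricted_exponential {0<..1} k) (restricted_exponential {0<..1} l)"
    unfolding transplant_exponential[OF K(2), symmetric]
    by (rule L2_isometry_inner[OF L2_contraction_transplant[OF assms]
          transplant_isometry(2)[OF assms] unit_exponential_supported unit_exponential_supported])
  then show ?thesis
    using unit_exponentials_inner[of k l] by (simp add: restricted_exponential_def[abs_def])
qed

lemma restricted_exponential_L2:
  "K \<in> sets lebesgue \<Longrightarrow> K \<subseteq> {a..b} \<Longrightarrow> restricted_exponential K k \<in> L2"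
  unfolding restricted_exponential_def[abs_def] by (rule fourier_char_restrict_L2)

text \<open>
  Every function on \<open>K\<close> is transplanted from the unit interval, where the exponentials are
  dense, and transplanting an exponential only restricts it to \<open>K\<close>.
\<close>

lemma restricted_exponentials_dense:
  assumes K: "K \<in> sets lebesgue" "K \<subseteq> {- of_int (M - 1)<..of_int (M - 1)}"
    and tile: "AE x in lebesgue. \<exists>!k::int. x + of_int k \<in> K"
    and f: "f \<in> L2" "\<And>x. x \<notin> K \<Longrightarrow> f x = 0"
  shows "f \<in> closed_span (range (restricted_exponential K))"
proof -
  \<comment> \<open>Sum the values of \<open>f\<close> over each class modulo 1; only one of them can be nonzero.\<close>
  define F where "F x = (\<Sum>l\<in>{- M..M}. f (x + of_int l)) * indicator {0<..1} x" for x
  have "(\<lambda>x. f (x + of_int l)) \<in> L2" for l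
    using L2_affine(1)[OF f(1), of 1 "of_int l"] by (simp add: add.commute)
  then have FL2: "F \<in> L2" unfolding F_def[abs_def] by (intro L2_truncate L2_sum) auto
  then have F: "F \<in> unit_supported" by (auto simp: unit_supported_def F_def)
  have "F = (\<lambda>x. F x * indicator {0<..1} x)" by (auto simp: F_def split: split_indicator)
  then have "F \<in> closed_span unit_exponentials" using unit_exponentials_dense[OF FL2] by simp
  then have "transplant K M F \<in> closed_span (transplant K M ` unit_exponentials)"
    by (intro closed_span_contraction[OF L2_contraction_transplant[OF K tile] _ F])
       (auto simp: unit_exponentials_eq unit_exponential_supported)
  also have "transplant K M ` unit_exponentials = range (restricted_exponential K)"
    unfolding unit_exponentials_eq by (simp add: image_image transplant_exponential[OF K(2)])
  finally have cs: "transplant K M F \<in> closed_span (range (restricted_exponential K))" .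
  have "K \<subseteq> {- of_int (M - 1)..of_int (M - 1)}" using K(2) by auto
  then have L2: "range (restricted_exponential K) \<subseteq> L2"
    using restricted_exponential_L2[OF K(1)] by blast
  have "AE \<xi> in lebesgue. f \<xi> = transplant K M F \<xi>"
    using tile
  proof eventually_elim
    case (elim \<xi>)
    define k0 where "k0 = \<lceil>\<xi>\<rceil> - 1"
    have cell: "\<xi> - of_int k0 \<in> {0<..1}" by (simp add: k0_def algebra_simps) linarith
    show ?case
    proof (cases "\<xi> \<in> K")
      case True
      then have "of_int (- (M - 1)) < \<xi>" "\<xi> \<le> of_int (M - 1)" using K(2) by auto
      then have "- (M - 1) < \<lceil>\<xi>\<rceil>" "\<lceil>\<xi>\<rceil> \<le> M - 1"
        by (simp_all only: less_ceiling_iff ceiling_le_iff)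
      then have k: "k0 \<in> {- M..M}" by (simp add: k0_def)
      have z: "f (\<xi> - of_int k0 + of_int l) = (if l = k0 then f \<xi> else 0)" for l
      proof (cases "l = k0")
        case False
        have "\<xi> + of_int 0 \<in> K" using True by simp
        then have "\<xi> + of_int (l - k0) \<notin> K" using elim False by (metis right_minus_eq)
        then show ?thesis using False f(2) by (simp add: algebra_simps)
      qed simp
      have "F (\<xi> - of_int k0) = (\<Sum>l\<in>{- M..M}. if l = k0 then f \<xi> else 0)"
        using cell by (simp only: F_def z) simp
      then show ?thesis
        using True k transplant_eq[OF F K(2), of \<xi>] by (simp add: k0_def)
    next
      case False
      then show ?thesis using f(2) by (simp add: transplant_def)
    qed
  qed
  then show ?thesis by (rule closed_span_cong_AE[OF L2 cs L2_measurable[OF f(1)]])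
qed

section \<open>Dilations and wavelets\<close>

text \<open>
  The factor makes the dilation an isometry.
\<close>

definition dilate :: "int \<Rightarrow> (real \<Rightarrow> complex) \<Rightarrow> real \<Rightarrow> complex" where
  "dilate j f \<xi> = of_real (2 powr (- of_int j / 2)) * f (2 powi (- j) * \<xi>)"

lemma dilate_isometry:
  assumes "f \<in> L2"
  shows "dilate j f \<in> L2" "L2_norm (dilate j f) = L2_norm f"
proof -
  let ?c = "2 powi (- j) :: real"
  have c: "?c > 0" by simp
  have D: "dilate j f = (\<lambda>\<xi>. of_real (2 powr (- of_int j / 2)) * f (0 + ?c * \<xi>))"
    by (simp add: dilate_def[abs_def])
  show "dilate j f \<in> L2" unfolding D using c by (intro L2_cmult L2_affine(1) assms) simp
  have "(2 powr (- of_int j / 2))\<^sup>2 = (2 :: real) powr (- of_int j)"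
    by (simp add: power2_eq_square powr_add[symmetric])
  also have "\<dots> = 2 powr of_int (- j)" by simp
  also have "\<dots> = ?c" by (rule powr_real_of_int') simp_all
  finally have "(L2_norm (dilate j f))\<^sup>2 = (L2_norm f)\<^sup>2"
    unfolding D L2_norm_cmult power_mult_distrib L2_affine(2)[OF assms less_imp_neq[OF c, symmetric]]
    using c by simp
  then show "L2_norm (dilate j f) = L2_norm f"
    by (simp add: L2_norm_nonneg power2_eq_iff_nonneg)
qed

lemma L2_contraction_dilate: "L2_contraction L2 (dilate j)"
  using dilate_isometry
  by (auto simp: L2_contraction_def L2_add L2_cmult dilate_def[abs_def] distrib_left mult_ac)

text \<open>
  A modulation by an integer frequency becomes an integer translation, and a dilation becomes the
  inverse dilation: the right-hand side is a member of the wavelet system.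
\<close>

lemma inverse_fourier_dilated_exponential:
  "inverse_fourier (dilate j (restricted_exponential K k)) x
    = of_real (2 powr (of_int j / 2)) * inverse_fourier (indicator K) (2 powi j * x - of_int k)"
proof -
  let ?c = "2 powi j :: real" and ?s = "complex_of_real (2 powr (- of_int j / 2))"
  have c: "?c > 0" by simp
  have "(2::real) powr of_int j = ?c" by (simp add: powr_real_of_int')
  then have "?c * 2 powr (- of_int j / 2) = (2::real) powr (of_int j / 2)"
    by (metis (no_types) add.commute add_diff_cancel_right' field_sum_of_halves minus_divide_left
        powr_add uminus_add_conv_diff)
  then have cs: "of_real ?c * ?s = complex_of_real (2 powr (of_int j / 2))"
    by (metis of_real_mult)
  have "inverse_fourier (dilate j (restricted_exponential K k)) x
      = ?c *\<^sub>R (LINT \<xi>|lebesgue. dilate j (restricted_exponential K k) (0 + ?c * \<xi>)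
          * fourier_char (- x) (0 + ?c * \<xi>))"
    unfolding inverse_fourier_def L1_fourier_eq
    by (subst lebesgue_integral_real_affine[of ?c _ 0]) simp_all
  also have "\<dots> = ?c *\<^sub>R (LINT \<xi>|lebesgue. ?s * (indicator K \<xi> * fourier_char (- (?c * x - of_int k)) \<xi>))"
  proof -
    have "dilate j (restricted_exponential K k) (0 + ?c * \<xi>) * fourier_char (- x) (0 + ?c * \<xi>)
        = ?s * (indicator K \<xi> * fourier_char (- (?c * x - of_int k)) \<xi>)" for \<xi>
    proof -
      have y: "2 powi (- j) * (0 + ?c * \<xi>) = \<xi>" by (simp add: power_int_minus)
      have char: "fourier_char (of_int k) \<xi> * fourier_char (- x) (0 + ?c * \<xi>)
          = fourier_char (- (?c * x - of_int k)) \<xi>"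
        using fourier_char_add_left[of "of_int k" "?c * - x" \<xi>] fourier_char_mult_right[of "- x" ?c \<xi>]
        by simp
      show ?thesis
        unfolding dilate_def restricted_exponential_def y char[symmetric] by (simp only: mult_ac)
    qed
    then show ?thesis by simp
  qed
  also have "\<dots> = (of_real ?c * ?s) * inverse_fourier (indicator K) (?c * x - of_int k)"
    by (simp add: inverse_fourier_def L1_fourier_eq scaleR_conv_of_real)
  finally show ?thesis unfolding cs .
qed

text \<open>
  The pieces of a function on the dilates of \<open>K\<close> are dilates of functions on \<open>K\<close>, so
  exponentials approximate each of them, and together the pieces exhaust the function.
\<close>

lemma dilated_exponentials_dense:
  assumes K: "K \<in> sets lebesgue" "K \<subseteq> {- of_int (M - 1)<..of_int (M - 1)}"
    and trans: "AE x in lebesgue. \<exists>!k::int. x + of_int k \<in> K"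
    and dil: "AE x in lebesgue. \<exists>!j::int. 2 powi j * x \<in> K"
  shows "closed_span (range (\<lambda>(j, k). dilate j (restricted_exponential K k))) = L2"
proof (intro equalityI closed_span_L2 subsetI)
  let ?E = "range (\<lambda>(j, k). dilate j (restricted_exponential K k))"
  have "K \<subseteq> {- of_int (M - 1)..of_int (M - 1)}" using K(2) by auto
  then have eL2: "restricted_exponential K k \<in> L2" for k
    using restricted_exponential_L2[OF K(1)] by blast
  then have E: "?E \<subseteq> L2" using dilate_isometry(1) by auto
  fix f assume f: "f \<in> L2"
  define S where "S j = {x. 2 powi (- j) * x \<in> K}" for j :: int
  have S: "S j \<in> sets lebesgue" for j
  proof -
    have "(\<lambda>x. 0 + 2 powi (- j) * x) -` K \<inter> space lebesgue \<in> sets lebesgue"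
      by (rule measurable_sets[OF measurable_lebesgue_real_affine K(1)]) simp
    then show ?thesis by (simp add: S_def vimage_def)
  qed
  have piece: "(\<lambda>x. f x * indicator (S j) x) \<in> closed_span ?E" for j
  proof -
    define h where "h x = of_real (2 powr (of_int j / 2)) * f (0 + 2 powi j * x) * indicator K x" for x
    have h: "h \<in> L2"
      unfolding h_def[abs_def] by (intro L2_truncate L2_cmult L2_affine(1) f K) simp
    have "h \<in> closed_span (range (restricted_exponential K))"
      by (rule restricted_exponentials_dense[OF K trans h]) (simp add: h_def)
    then have "dilate j h \<in> closed_span (dilate j ` range (restricted_exponential K))"
      by (intro closed_span_contraction[OF L2_contraction_dilate _ h]) (use eL2 in auto)
    moreover have "closed_span (dilate j ` range (restricted_exponential K)) \<subseteq> closed_span ?E"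
    proof (rule closed_span_minimal[OF E])
      have "dilate j ` range (restricted_exponential K) \<subseteq> ?E" by auto
      then show "dilate j ` range (restricted_exponential K) \<subseteq> closed_span ?E"
        using lin_span_subset_closed_span[OF E] lin_span.base by blast
    qed
    moreover have "dilate j h = (\<lambda>x. f x * indicator (S j) x)"
    proof
      fix x :: real
      have one: "complex_of_real (2 powr (- of_int j / 2)) * of_real (2 powr (of_int j / 2)) = 1"
        by (simp add: of_real_mult[symmetric] powr_add[symmetric] del: of_real_mult)
      have y: "0 + 2 powi j * (2 powi (- j) * x) = x" by (simp add: power_int_minus)
      have ind: "indicator K (2 powi (- j) * x) = (indicator (S j) x :: complex)"
        by (simp add: S_def indicator_def)
      show "dilate j h x = f x * indicator (S j) x"
        unfolding dilate_def h_def y ind unfolding mult.assoc[symmetric] one by simp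
    qed
    ultimately show ?thesis by auto
  qed
  define F where "F n x = (\<Sum>j\<in>{- int n..int n}. f x * indicator (S j) x)" for n x
  have F: "F n \<in> closed_span ?E" for n
    unfolding F_def[abs_def] by (intro closed_span_sum E piece) auto
  have ex: "AE x in lebesgue. \<exists>j0. \<forall>n. F n x = (if j0 \<in> {- int n..int n} then f x else 0)"
    using dil
  proof eventually_elim
    case (elim x)
    then obtain i where i: "2 powi i * x \<in> K" "\<And>j. 2 powi j * x \<in> K \<Longrightarrow> j = i" by blast
    have "indicator (S j) x = (if j = - i then 1 else 0 :: complex)" for j
    proof (cases "j = - i")
      case True
      then show ?thesis using i(1) by (simp add: S_def indicator_def)
    next
      case False
      then have "2 powi (- j) * x \<notin> K" using i(2)[of "- j"] by linarith
      then show ?thesis using False by (simp add: S_def indicator_def)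
    qed
    then have "F n x = (\<Sum>j\<in>{- int n..int n}. if j = - i then f x else 0)" for n
      unfolding F_def by (intro sum.cong) auto
    then show ?case by (intro exI[of _ "- i"]) simp
  qed
  have "L2_converges F f"
  proof (rule L2_dominated_convergence[OF f])
    show "F n \<in> borel_measurable lebesgue" for n using F closed_span_L2 L2_measurable by blast
    show "f \<in> borel_measurable lebesgue" by (rule L2_measurable[OF f])
    show "AE x in lebesgue. cmod (F n x) \<le> cmod (f x)" for n
      using ex by eventually_elim auto
    show "AE x in lebesgue. (\<lambda>n. F n x) \<longlonglongrightarrow> f x"
      using ex
    proof eventually_elim
      case (elim x)
      then obtain j0 where j0: "\<And>n. F n x = (if j0 \<in> {- int n..int n} then f x else 0)" by blast
      have "eventually (\<lambda>n. f x = F n x) sequentially"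
        using eventually_ge_at_top[of "nat \<bar>j0\<bar>"] by eventually_elim (auto simp: j0)
      then show ?case by (rule Lim_transform_eventually[OF tendsto_const])
    qed
  qed
  then show "f \<in> closed_span ?E" by (rule closed_span_converges[OF E _ F])
qed

text \<open>
  On the same scale this is orthonormality on \<open>K\<close>; on different scales the supports are almost
  disjoint because almost no point has two dilates in \<open>K\<close>.
\<close>

lemma dilated_exponentials_inner:
  assumes K: "K \<in> sets lebesgue" "K \<subseteq> {- of_int (M - 1)<..of_int (M - 1)}"
    and trans: "AE x in lebesgue. \<exists>!k::int. x + of_int k \<in> K"
    and dil: "AE x in lebesgue. \<exists>!j::int. 2 powi j * x \<in> K"
  shows "L2_inner (dilate j (restricted_exponential K k)) (dilate i (restricted_exponential K l))
    = (if (j, k) = (i, l) then 1 else 0)"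
proof (cases "j = i")
  case True
  have "K \<subseteq> {- of_int (M - 1)..of_int (M - 1)}" using K(2) by auto
  then have eL2: "restricted_exponential K k \<in> L2" for k
    using restricted_exponential_L2[OF K(1)] by blast
  have "L2_inner (dilate j (restricted_exponential K k)) (dilate j (restricted_exponential K l))
      = L2_inner (restricted_exponential K k) (restricted_exponential K l)"
    by (rule L2_isometry_inner[OF L2_contraction_dilate dilate_isometry(2) eL2 eL2])
  then show ?thesis using True restricted_exponential_inner[OF K trans, of k l] by simp
next
  case False
  have "AE x in lebesgue. dilate j (restricted_exponential K k) x
      * cnj (dilate i (restricted_exponential K l) x) = 0"
    using dil
  proof eventually_elim
    case (elim x)
    then have "2 powi (- j) * x \<notin> K \<or> 2 powi (- i) * x \<notin> K" using False by (metis neg_equal_iff_equal)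
    then show ?case by (auto simp: dilate_def restricted_exponential_def)
  qed
  then have "L2_inner (dilate j (restricted_exponential K k)) (dilate i (restricted_exponential K l)) = 0"
    unfolding L2_inner_def by (rule integral_eq_zero_AE)
  then show ?thesis using False by simp
qed

text \<open>
  The inverse Fourier transform preserves inner products and has dense image on functions of
  bounded support, so it maps the orthonormal basis of dilated exponentials to one in time.
\<close>

theorem wavelet_set_if_tiles:
  assumes K: "K \<in> sets lebesgue" and bounded: "bounded K"
    and trans: "AE x in lebesgue. \<exists>!k::int. x + of_int k \<in> K"
    and dil: "AE x in lebesgue. \<exists>!j::int. 2 powi j * x \<in> K"
  shows "wavelet_set K"
proof -
  obtain B where B: "\<And>x. x \<in> K \<Longrightarrow> \<bar>x\<bar> \<le> B"
    using bounded by (auto simp: bounded_iff)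
  define M where "M = \<lceil>B\<rceil> + 2"
  have KM: "K \<subseteq> {- of_int (M - 1)<..of_int (M - 1)}"
  proof
    fix x assume "x \<in> K"
    then have "\<bar>x\<bar> < of_int (M - 1)"
    proof -
      have "of_int (M - 1) = of_int \<lceil>B\<rceil> + (1::real)" by (simp add: M_def)
      then show ?thesis using B[OF \<open>x \<in> K\<close>] le_of_int_ceiling[of B] by linarith
    qed
    then show "x \<in> {- of_int (M - 1)<..of_int (M - 1)}" by auto
  qed
  note hyps = K KM trans dil
  define \<psi> where "\<psi> = inverse_fourier (indicator K)"
  define e where "e = (\<lambda>(j, k). dilate j (restricted_exponential K k))"
  define w where "w = (\<lambda>(j::int, k::int) x. of_real (2 powr (of_int j / 2)) * \<psi> (2 powi j * x - of_int k))"
  have "K \<subseteq> {- of_int (M - 1)..of_int (M - 1)}" using KM by auto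
  then have eL2: "restricted_exponential K k \<in> L2" and KL2: "(indicator K :: real \<Rightarrow> complex) \<in> L2" for k
    using restricted_exponential_L2[OF K] L2_indicator(1)[OF K] by blast+
  have KB: "indicator K \<in> L2_bounded_support"
    by (rule L2_bounded_supportI[OF KL2, of B]) (use B in \<open>force simp: indicator_def\<close>)
  have eB: "e p \<in> L2_bounded_support" for p
  proof -
    obtain j k where p: "p = (j, k)" by force
    show ?thesis
    proof (rule L2_bounded_supportI[where N = "2 powi j * B"])
      show "e p \<in> L2" using dilate_isometry(1)[OF eL2] by (simp add: p e_def)
      fix x :: real assume x: "2 powi j * B < \<bar>x\<bar>"
      have "2 powi (- j) * x \<notin> K"
      proof
        assume "2 powi (- j) * x \<in> K"
        then have "2 powi (- j) * \<bar>x\<bar> \<le> B" using B by (fastforce simp: abs_mult)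
        then have "2 powi j * (2 powi (- j) * \<bar>x\<bar>) \<le> 2 powi j * B" by (intro mult_left_mono) auto
        moreover have "2 powi j * (2 powi (- j) * \<bar>x\<bar>) = \<bar>x\<bar>" by (simp add: power_int_minus)
        ultimately show False using x by simp
      qed
      then show "e p x = 0" by (simp add: p e_def dilate_def restricted_exponential_def)
    qed
  qed
  have w: "w p = inverse_fourier (e p)" for p
    by (cases p) (auto simp: w_def e_def \<psi>_def inverse_fourier_dilated_exponential)
  have wL2: "w p \<in> L2" for p
    unfolding w by (rule L2_contractionD(2)[OF L2_contraction_inverse_fourier eB])
  have inner: "L2_inner (w p) (w q) = (if p = q then 1 else 0)" for p q
    unfolding w inverse_fourier_inner[OF eB eB]
    by (cases p, cases q) (simp only: e_def prod.case dilated_exponentials_inner[OF hyps])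
  have dense: "closed_span (range w) = L2"
  proof (intro equalityI closed_span_L2 subsetI)
    have rw: "range w = inverse_fourier ` range e" by (auto simp: w)
    have rL2: "range w \<subseteq> L2" using wL2 by auto
    have "inverse_fourier ` L2_bounded_support \<subseteq> closed_span (range w)"
    proof (rule image_subsetI)
      fix g assume g: "g \<in> L2_bounded_support"
      have "g \<in> closed_span (range e)"
        using dilated_exponentials_dense[OF hyps] L2_bounded_support_L2[OF g] by (simp add: e_def)
      then show "inverse_fourier g \<in> closed_span (range w)"
        unfolding rw
        by (intro closed_span_contraction[OF L2_contraction_inverse_fourier _ g]) (use eB in auto)
    qed
    from closed_span_minimal[OF rL2 this] show "f \<in> closed_span (range w)" if "f \<in> L2" for f
      using that inverse_fourier_dense by auto
  qed
  have basis: "L2_orthonormal_basis w"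
    unfolding L2_orthonormal_basis_def
  proof (intro conjI allI ballI impI wL2 inner)
    fix f :: "real \<Rightarrow> complex" and \<epsilon> :: real assume "f \<in> L2" "\<epsilon> > 0"
    then obtain g where g: "g \<in> lin_span (range w)" "L2_norm (\<lambda>x. f x - g x) < \<epsilon>"
      using closed_span_approx[of f "range w" \<epsilon>] dense by auto
    obtain S c where "finite S" "g = (\<lambda>x. \<Sum>i\<in>S. c i * w i x)"
      using lin_span_range_sum[OF g(1)] by blast
    with g(2) show "\<exists>S c. finite S \<and> L2_norm (\<lambda>x. f x - (\<Sum>i\<in>S. c i * w i x)) < \<epsilon>" by blast
  qed
  have "\<psi> \<in> L2" unfolding \<psi>_def by (rule L2_contractionD(2)[OF L2_contraction_inverse_fourier KB])
  with basis have "orthonormal_wavelet \<psi>" unfolding orthonormal_wavelet_def w_def by blast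
  moreover have "has_fourier_transform \<psi> (indicator K)"
    unfolding \<psi>_def by (rule has_fourier_transform_inverse_fourier[OF KB])
  moreover have "AE \<xi> in lebesgue. cmod (indicator K \<xi>) = indicator K \<xi>"
    by (simp add: indicator_def)
  ultimately show ?thesis unfolding wavelet_set_def using K by blast
qed

section \<open>MSF polygonals\<close>

lemma strictly_increasing_le:
  fixes c :: "nat \<Rightarrow> real"
  assumes "\<And>j. j < n \<Longrightarrow> c j < c (Suc j)" "i \<le> j" "j \<le> n"
  shows "c i \<le> c j"
  using assms(2,3)
proof (induction j)
  case (Suc j)
  then show ?case using assms(1)[of j] by (cases "i = Suc j") force+
qed simp

lemma strictly_increasing_locate:
  fixes c :: "nat \<Rightarrow> real"
  assumes "c 0 < y" "y < c n" "y \<notin> c ` {..n}"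
  obtains j where "1 \<le> j" "j \<le> n" "c (j - 1) < y" "y < c j"
proof -
  define j where "j = (LEAST j. y < c j)"
  have yj: "y < c j" unfolding j_def by (rule LeastI[of _ n]) (rule assms)
  have jn: "j \<le> n" unfolding j_def by (rule Least_le) (rule assms)
  have j0: "j \<noteq> 0" using yj assms(1) by (intro notI) simp
  then have "\<not> y < c (j - 1)" unfolding j_def by (intro not_less_Least) simp
  moreover have "y \<noteq> c (j - 1)" using assms(3) jn by auto
  ultimately show ?thesis using that[of j] yj jn j0 by simp
qed

lemma strictly_increasing_cell_unique:
  fixes c :: "nat \<Rightarrow> real"
  assumes inc: "\<And>j. j < n \<Longrightarrow> c j < c (Suc j)"
    and i: "1 \<le> i" "i \<le> n" "c (i - 1) \<le> y" "y \<le> c i"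
    and j: "1 \<le> j" "j \<le> n" "c (j - 1) < y" "y < c j"
  shows "i = j"
proof (rule ccontr)
  assume "i \<noteq> j"
  then consider "i \<le> j - 1" | "j \<le> i - 1" using i(1) j(1) by linarith
  then show False
  proof cases
    case 1
    then have "c i \<le> c (j - 1)"
      using j(2) strictly_increasing_le[of n c i "j - 1"] inc by fastforce
    then show False using i j by simp
  next
    case 2
    then have "c j \<le> c (i - 1)"
      using i(2) strictly_increasing_le[of n c j "i - 1"] inc by fastforce
    then show False using i j by simp
  qed
qed

lemma AE_lebesgue_countable:
  fixes E :: "real set"
  assumes "countable E"
  shows "AE x in lebesgue. x \<notin> E"
  by (rule AE_completion, rule AE_not_in) (rule countable_imp_null_set_lborel[OF assms])

lemma power_int_two_eq_iff: "(2::real) powi i = 2 powi j \<longleftrightarrow> i = j"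
proof -
  have "(2::real) powi i < 2 powi j" if "i < j" for i j :: int
    using that by (rule power_int_strict_increasing) simp
  then show ?thesis by (metis less_irrefl linorder_neqE)
qed

lemma dyadic_annulus:
  fixes x c :: real
  assumes "0 < x" "0 < c"
  obtains q :: int where "c \<le> 2 powi q * x" "2 powi q * x < 2 * c"
proof -
  define q where "q = \<lceil>log 2 (c / x)\<rceil>"
  have pw: "2 powr of_int q = (2 powi q :: real)" by (rule powr_real_of_int') simp_all
  have "log 2 (c / x) \<le> of_int q" "of_int q < log 2 (c / x) + 1"
    unfolding q_def by linarith+
  then have "2 powr log 2 (c / x) \<le> 2 powr of_int q" "2 powr of_int q < 2 powr (log 2 (c / x) + 1)"
    by simp_all
  then have "c / x \<le> 2 powi q" "2 powi q < c / x * 2"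
    using assms by (simp_all add: pw powr_add)
  then show ?thesis using assms by (intro that[of q]) (simp_all add: field_simps)
qed

locale msf =
  fixes ps :: "(real \<times> real) list"
  assumes msf: "msf_polygonal ps"
begin

abbreviation "n \<equiv> length ps"
abbreviation "a \<equiv> knot ps"
abbreviation "m \<equiv> pt_m ps"
abbreviation "l \<equiv> pt_lambda ps"

lemma n_pos: "1 \<le> n" using msf by (simp add: msf_polygonal_def)

lemma a_0: "a 0 = 0" by (simp add: knot_def)

lemma nonempty: "ps \<noteq> []" using n_pos by auto

lemma a_n: "a n = 1 / 2" using nonempty by (simp add: knot_def)

lemma a_inc: "j < n \<Longrightarrow> a j < a (Suc j)"
  using msf by (simp add: msf_polygonal_def)

lemma a_mono: "i \<le> j \<Longrightarrow> j \<le> n \<Longrightarrow> a i \<le> a j"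
  by (rule strictly_increasing_le[of n a]) (auto intro: a_inc)

lemma a_cell: "1 \<le> j \<Longrightarrow> j \<le> n \<Longrightarrow> a (j - 1) < a j"
  using a_inc[of "j - 1"] by simp

lemma a_bounds: "j \<le> n \<Longrightarrow> a j \<in> {0..1/2}"
  using a_mono[of 0 j] a_mono[of j n] by (simp add: a_0 a_n)

lemma a_bounds_pred: "j \<le> n \<Longrightarrow> a (j - 1) \<in> {0..1/2}"
  by (rule a_bounds) simp

lemma a_pos: "1 \<le> j \<Longrightarrow> j \<le> n \<Longrightarrow> 0 < a j"
  using a_cell[of j] a_bounds_pred[of j] by simp

lemma l_1: "l 1 = 0" using msf by (simp add: msf_polygonal_def)

lemma closing: "4 * real (m 1) = 2 powi (- l n) * (2 * real (m n) + 1)"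
  using msf by (simp add: msf_polygonal_def)

text \<open>
  The closing condition keeps the set away from 0, so that its two halves are disjoint.
\<close>

lemma m_1_pos: "1 \<le> m 1"
proof -
  have "0 < 4 * real (m 1)" unfolding closing by (intro mult_pos_pos) auto
  then show ?thesis by simp
qed

text \<open>
  The vertices are dual to lines: \<open>a\<^sub>j\<close> is the abscissa at which the graphs of
  \<open>2 powi (- l j) * (x + m j)\<close> and \<open>2 powi (- l (j + 1)) * (x + m (j + 1))\<close> intersect.
\<close>

lemma scaled_ends_agree:
  assumes "1 \<le> j" "j < n"
  shows "2 powi (- l j) * (a j + m j) = 2 powi (- l (j + 1)) * (a j + m (j + 1))"
proof -
  let ?p = "2 powi (- l j) :: real" and ?q = "2 powi (- l (j + 1)) :: real"
  have "l j \<noteq> l (j + 1)" using msf assms by (simp add: msf_polygonal_def)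
  then have "?p - ?q \<noteq> 0" by (simp add: power_int_two_eq_iff)
  moreover have "a j = - ((m j * ?p - m (j + 1) * ?q) / (?p - ?q))"
    using assms by (simp add: knot_def)
  ultimately have "a j * (?p - ?q) = - (m j * ?p - m (j + 1) * ?q)"
    by simp
  then show ?thesis by (simp add: algebra_simps)
qed

text \<open>
  Equal translates would make the scaled ends agree only for equal scales.
\<close>

lemma m_neq_Suc:
  assumes "1 \<le> j" "j < n"
  shows "m j \<noteq> m (j + 1)"
proof
  assume eq: "m j = m (j + 1)"
  have "0 < a j + m j" using a_pos[of j] assms by (intro add_pos_nonneg) auto
  then have "2 powi (- l j) = (2 powi (- l (j + 1)) :: real)"
    using scaled_ends_agree[OF assms] by (simp add: eq)
  then have "l j = l (j + 1)" by (simp add: power_int_two_eq_iff)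
  then show False using msf assms by (simp add: msf_polygonal_def)
qed

text \<open>The common ends of the scaled intervals.\<close>

definition b :: "nat \<Rightarrow> real" where
  "b j = (if j = 0 then real (m 1) else 2 powi (- l j) * (a j + m j))"

lemma b_left: "1 \<le> j \<Longrightarrow> j \<le> n \<Longrightarrow> 2 powi (- l j) * (a (j - 1) + m j) = b (j - 1)"
  using scaled_ends_agree[of "j - 1"] l_1
  by (cases "j = 1") (auto simp: b_def a_0)

lemma b_right: "1 \<le> j \<Longrightarrow> 2 powi (- l j) * (a j + m j) = b j"
  by (simp add: b_def)

lemma b_inc: "j < n \<Longrightarrow> b j < b (Suc j)"
proof -
  assume "j < n"
  then have "2 powi (- l (Suc j)) * (a j + m (Suc j)) < 2 powi (- l (Suc j)) * (a (Suc j) + m (Suc j))"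
    using a_inc[of j] by (intro mult_strict_left_mono) auto
  then show ?thesis using b_left[of "Suc j"] b_right[of "Suc j"] \<open>j < n\<close> by simp
qed

lemma b_0: "b 0 = m 1" by (simp add: b_def)

lemma b_n: "b n = 2 * m 1"
  using closing nonempty by (simp add: b_def a_n algebra_simps)

lemma b_bounds: "j \<le> n \<Longrightarrow> b j \<in> {real (m 1)..2 * real (m 1)}"
  using strictly_increasing_le[of n b 0 j] strictly_increasing_le[of n b j n] b_inc
  by (auto simp: b_0 b_n)

lemma b_bounds_pred: "j \<le> n \<Longrightarrow> b (j - 1) \<in> {real (m 1)..2 * real (m 1)}"
  by (rule b_bounds) simp

lemma interval_eq: "msf_interval ps j = {a (j - 1) + m j..a j + m j}"
  by (simp add: msf_interval_def)

lemma pos_iff: "x \<in> msf_set_pos ps \<longleftrightarrow> (\<exists>j\<in>{1..n}. a (j - 1) \<le> x - m j \<and> x - m j \<le> a j)"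
  by (auto simp: msf_set_pos_def interval_eq algebra_simps)

lemma interval_pos:
  assumes "1 \<le> j" "j \<le> n" "x \<in> msf_interval ps j"
  shows "0 < x"
proof (cases "j = 1")
  case True
  then show ?thesis using assms m_1_pos by (auto simp: interval_eq a_0)
next
  case False
  then have "0 < a (j - 1)" using assms by (intro a_pos) auto
  then show ?thesis using assms by (auto simp: interval_eq)
qed

lemma pos_positive: "x \<in> msf_set_pos ps \<Longrightarrow> 0 < x"
  unfolding msf_set_pos_def using interval_pos by auto

lemma set_iff: "x \<in> msf_set ps \<longleftrightarrow> x \<in> msf_set_pos ps \<or> - x \<in> msf_set_pos ps"
  by (force simp: msf_set_def)

lemma set_minus: "- x \<in> msf_set ps \<longleftrightarrow> x \<in> msf_set ps"
  by (auto simp: set_iff)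

lemma pos_eq: "msf_set_pos ps = msf_set ps \<inter> {0<..}"
proof (rule set_eqI)
  fix x
  show "x \<in> msf_set_pos ps \<longleftrightarrow> x \<in> msf_set ps \<inter> {0<..}"
    using pos_positive[of x] pos_positive[of "- x"] by (auto simp: set_iff)
qed

text \<open>
  All cells lie in \<open>[0, 1/2]\<close>, which contains no two distinct points that differ by an integer.
\<close>

lemma translate_pos_iff:
  assumes j: "1 \<le> j" "j \<le> n" and z: "a (j - 1) < z" "z < a j"
  shows "z + of_int k \<in> msf_set_pos ps \<longleftrightarrow> k = int (m j)"
proof
  have zb: "0 < z" "z < 1 / 2" using z a_bounds_pred[of j] a_bounds[of j] j by auto
  assume "z + of_int k \<in> msf_set_pos ps"
  then obtain i where i: "i \<in> {1..n}" "a (i - 1) \<le> z + of_int k - m i" "z + of_int k - m i \<le> a i"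
    by (auto simp: pos_iff)
  then have "0 \<le> z + of_int k - m i" "z + of_int k - m i \<le> 1 / 2"
    using a_bounds_pred[of i] a_bounds[of i] by auto
  then have "\<bar>of_int (k - int (m i))\<bar> < (1::real)" using zb by auto
  then have "\<bar>k - int (m i)\<bar> < 1" by linarith
  then have k: "k = int (m i)" by simp
  then have "i = j"
    using strictly_increasing_cell_unique[of n a i z j] a_inc i j z by auto
  then show "k = int (m j)" using k by simp
next
  assume "k = int (m j)"
  then show "z + of_int k \<in> msf_set_pos ps" using j z by (auto simp: pos_iff intro!: bexI[of _ j])
qed

text \<open>
  Modulo 1 the negative half of the set lies in \<open>[-1/2, 0]\<close>, so it contributes no translate of a
  point of \<open>(0, 1/2)\<close>.
\<close>

lemma translate_set_iff:
  assumes j: "1 \<le> j" "j \<le> n" and z: "a (j - 1) < z" "z < a j"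
  shows "z + of_int k \<in> msf_set ps \<longleftrightarrow> k = int (m j)"
proof -
  have zb: "0 < z" "z < 1 / 2" using z a_bounds_pred[of j] a_bounds[of j] j by auto
  have "- (z + of_int k) \<notin> msf_set_pos ps"
  proof
    assume "- (z + of_int k) \<in> msf_set_pos ps"
    then obtain i where i: "i \<in> {1..n}" "a (i - 1) \<le> - (z + of_int k) - m i" "- (z + of_int k) - m i \<le> a i"
      by (auto simp: pos_iff)
    define d where "d = - k - int (m i)"
    have "0 \<le> of_int d - z" "of_int d - z \<le> 1 / 2"
      using i a_bounds_pred[of i] a_bounds[of i] by (auto simp: d_def)
    then have "0 < (of_int d :: real)" "(of_int d :: real) < 1" using zb by auto
    then show False by simp
  qed
  then show ?thesis using translate_pos_iff[OF assms] by (simp add: set_iff)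
qed

lemma translation_tiling: "AE x in lebesgue. \<exists>!k::int. x + of_int k \<in> msf_set ps"
proof -
  \<comment> \<open>The exceptional set consists of the integer translates of the ends of all cells.\<close>
  define E where "E = (\<Union>k::int. \<Union>j\<in>{..n}. {a j + of_int k, - a j + of_int k})"
  have "countable E" unfolding E_def by (intro countable_UN) auto
  then have "AE x in lebesgue. x \<notin> E" by (rule AE_lebesgue_countable)
  then show ?thesis
  proof eventually_elim
    case (elim x)
    define k0 where "k0 = \<lfloor>x + 1 / 2\<rfloor>"
    define y where "y = x - of_int k0"
    have yb: "- (1 / 2) \<le> y" "y < 1 / 2" unfolding y_def k0_def by linarith+
    have yE: "y \<noteq> a j" "y \<noteq> - a j" if "j \<le> n" for j
      using elim that by (fastforce simp: E_def y_def algebra_simps)+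
    have loc: "\<exists>j. 1 \<le> j \<and> j \<le> n \<and> a (j - 1) < \<bar>y\<bar> \<and> \<bar>y\<bar> < a j"
    proof -
      have "\<bar>y\<bar> \<noteq> a j" if "j \<le> n" for j using yE[OF that] by (auto simp: abs_if)
      moreover from this[of 0] this[of n] have "a 0 < \<bar>y\<bar>" "\<bar>y\<bar> < a n"
        using yb by (auto simp: a_0 a_n)
      ultimately show ?thesis using strictly_increasing_locate[of a "\<bar>y\<bar>" n] by (metis atMost_iff imageE)
    qed
    then obtain j where j: "1 \<le> j" "j \<le> n" "a (j - 1) < \<bar>y\<bar>" "\<bar>y\<bar> < a j" by blast
    have x: "x + of_int k = y + of_int (k + k0)" for k by (simp add: y_def)
    show ?case
    proof (cases "0 \<le> y")
      case True
      then have "x + of_int k \<in> msf_set ps \<longleftrightarrow> k = int (m j) - k0" for k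
        using translate_set_iff[of j y "k + k0"] j unfolding x by auto
      then show ?thesis by simp
    next
      case False
      have "x + of_int k \<in> msf_set ps \<longleftrightarrow> k = - int (m j) - k0" for k
      proof -
        have "x + of_int k \<in> msf_set ps \<longleftrightarrow> - y + of_int (- (k + k0)) \<in> msf_set ps"
          unfolding x using set_minus[of "y + of_int (k + k0)"] by simp
        also have "\<dots> \<longleftrightarrow> - (k + k0) = int (m j)"
          using False j by (intro translate_set_iff) auto
        finally show ?thesis by auto
      qed
      then show ?thesis by simp
    qed
  qed
qed

text \<open>
  The scaled intervals are consecutive and fill one dyadic annulus, from \<open>m 1\<close> to \<open>2 * m 1\<close>.
  Hence a dilate of \<open>y\<close> in the \<open>i\<close>-th interval, scaled back, is \<open>y\<close> itself, and then \<open>i = j\<close>.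
\<close>

lemma dilate_pos_iff:
  assumes j: "1 \<le> j" "j \<le> n" and y: "b (j - 1) < y" "y < b j"
    and generic: "\<And>i s. i \<le> n \<Longrightarrow> y \<noteq> 2 powi s * b i"
  shows "2 powi q * y \<in> msf_set_pos ps \<longleftrightarrow> q = l j"
proof -
  have scale: "a (i - 1) \<le> 2 powi q * y - m i \<and> 2 powi q * y - m i \<le> a i \<longleftrightarrow>
      b (i - 1) \<le> 2 powi (q - l i) * y \<and> 2 powi (q - l i) * y \<le> b i" if "1 \<le> i" "i \<le> n" for i
  proof -
    let ?c = "2 powi (- l i) :: real"
    have c: "?c > 0" by simp
    have "2 powi (q - l i) * y = ?c * (2 powi q * y)"
      using power_int_add[of "2::real" "- l i" q] by (simp add: mult_ac)
    then have "b (i - 1) \<le> 2 powi (q - l i) * y \<longleftrightarrow> a (i - 1) + m i \<le> 2 powi q * y"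
      "2 powi (q - l i) * y \<le> b i \<longleftrightarrow> 2 powi q * y \<le> a i + m i"
      unfolding b_left[OF that, symmetric] b_right[OF that(1), symmetric]
      by (simp_all only: mult_le_cancel_left_pos[OF c])
    then show ?thesis by (auto simp: algebra_simps)
  qed
  have yb: "real (m 1) < y" "y < 2 * real (m 1)"
    using y b_bounds_pred[of j] b_bounds[of j] j by auto
  show ?thesis
  proof
    assume "2 powi q * y \<in> msf_set_pos ps"
    then obtain i where i: "1 \<le> i" "i \<le> n" "b (i - 1) \<le> 2 powi (q - l i) * y"
      "2 powi (q - l i) * y \<le> b i" using scale by (auto simp: pos_iff)
    then have s: "real (m 1) \<le> 2 powi (q - l i) * y" "2 powi (q - l i) * y \<le> 2 * real (m 1)"
      using b_bounds_pred[of i] b_bounds[of i] by auto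
    define s where "s = q - l i"
    have "s = 0"
    proof (rule ccontr)
      assume "s \<noteq> 0"
      then consider "1 \<le> s" | "s \<le> - 1" by linarith
      then show False
      proof cases
        case 1
        then have "2 powi 1 \<le> (2 powi s :: real)" by (intro power_int_increasing) auto
        then have "2 * y \<le> 2 powi s * y" using yb by (intro mult_right_mono) auto
        then show False using s yb unfolding s_def by linarith
      next
        case 2
        then have "2 powi s \<le> (2 powi (- 1) :: real)" by (intro power_int_increasing) auto
        then have "2 powi s * y \<le> 2 powi (- 1) * y" using yb by (intro mult_right_mono) auto
        also have "2 powi (- 1) * y = y / 2" by simp
        finally show False using s yb unfolding s_def by linarith
      qed
    qed
    then have "i = j"
      using strictly_increasing_cell_unique[of n b i y j] b_inc i j y by (simp add: s_def)
    then show "q = l j" using \<open>s = 0\<close> by (simp add: s_def)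
  next
    assume "q = l j"
    then have "b (j - 1) \<le> 2 powi (q - l j) * y \<and> 2 powi (q - l j) * y \<le> b j" using y by simp
    then show "2 powi q * y \<in> msf_set_pos ps"
      unfolding pos_iff scale[OF j, symmetric] using j by (intro bexI[of _ j]) auto
  qed
qed

lemma dilation_tiling: "AE x in lebesgue. \<exists>!q::int. 2 powi q * x \<in> msf_set ps"
proof -
  \<comment> \<open>The exceptional set consists of 0 and the dilates of the ends of the scaled intervals.\<close>
  define E where "E = insert 0 (\<Union>s::int. \<Union>j\<in>{..n}. {2 powi s * b j, - (2 powi s * b j)})"
  have "countable E" unfolding E_def by (intro countable_insert countable_UN) auto
  then have "AE x in lebesgue. x \<notin> E" by (rule AE_lebesgue_countable)
  then show ?thesis
  proof eventually_elim
    case (elim x)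
    have x0: "\<bar>x\<bar> > 0" using elim by (auto simp: E_def)
    have xE: "\<bar>x\<bar> \<noteq> 2 powi s * b j" if "j \<le> n" for j s
    proof
      assume "\<bar>x\<bar> = 2 powi s * b j"
      then have "x \<in> {2 powi s * b j, - (2 powi s * b j)}" by (auto simp: abs_if split: if_splits)
      then have "x \<in> E" using that unfolding E_def by blast
      with elim show False by simp
    qed
    have "0 < real (m 1)" using m_1_pos by simp
    with x0 obtain q0 :: int where q0: "real (m 1) \<le> 2 powi q0 * \<bar>x\<bar>" "2 powi q0 * \<bar>x\<bar> < 2 * real (m 1)"
      by (rule dyadic_annulus)
    define y where "y = 2 powi q0 * \<bar>x\<bar>"
    have generic: "y \<noteq> 2 powi s * b i" if "i \<le> n" for i s
    proof
      assume "y = 2 powi s * b i"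
      moreover have "2 powi (- q0) * y = \<bar>x\<bar>" by (simp add: y_def power_int_minus)
      moreover have "2 powi (- q0) * (2 powi s * b i) = 2 powi (- q0 + s) * b i"
        using power_int_add[of "2::real" "- q0" s] by simp
      ultimately show False using xE[OF that] by metis
    qed
    have "y \<noteq> b i" if "i \<le> n" for i using generic[OF that, of 0] by simp
    moreover from this[of 0] have "b 0 < y" "y < b n" using q0 by (auto simp: y_def b_0 b_n)
    ultimately obtain j where j: "1 \<le> j" "j \<le> n" "b (j - 1) < y" "y < b j"
      using strictly_increasing_locate[of b y n] by (metis atMost_iff imageE)
    have xy: "2 powi q * \<bar>x\<bar> = 2 powi (q - q0) * y" for q
      using power_int_add[of "2::real" "q - q0" q0] by (simp add: y_def)
    have "2 powi q * x \<in> msf_set ps \<longleftrightarrow> q = l j + q0" for q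
    proof -
      have pos: "2 powi q * \<bar>x\<bar> > 0" using x0 by simp
      have "2 powi q * x \<in> msf_set ps \<longleftrightarrow> 2 powi q * \<bar>x\<bar> \<in> msf_set ps"
        using set_minus[of "2 powi q * x"] by (simp add: abs_if)
      also have "\<dots> \<longleftrightarrow> 2 powi q * \<bar>x\<bar> \<in> msf_set_pos ps" using pos by (simp add: pos_eq)
      also have "\<dots> \<longleftrightarrow> q - q0 = l j"
        unfolding xy by (rule dilate_pos_iff[OF j generic])
      finally show ?thesis by auto
    qed
    then show ?case by simp
  qed
qed

lemma wavelet: "wavelet_set (msf_set ps)"
proof (rule wavelet_set_if_tiles[OF _ _ translation_tiling dilation_tiling])
  have eq: "msf_set ps = (\<Union>j\<in>{1..n}. msf_interval ps j) \<union> (\<Union>j\<in>{1..n}. {- (a j + m j)..- (a (j - 1) + m j)})"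
    by (simp add: msf_set_def msf_set_pos_def image_UN interval_eq)
  show "msf_set ps \<in> sets lebesgue"
    unfolding eq interval_eq by (intro sets.Un sets.finite_UN) auto
  show "bounded (msf_set ps)"
    unfolding eq interval_eq by (auto intro!: bounded_UN)
qed

lemma symmetric: "symmetric_set (msf_set ps)"
  unfolding symmetric_set_def
proof (intro equalityI subsetI)
  fix x assume x: "x \<in> msf_set ps \<inter> {..0}"
  then have "- x \<in> msf_set ps \<inter> {0..}" using set_minus by auto
  then show "x \<in> uminus ` (msf_set ps \<inter> {0..})" by (intro image_eqI[of _ _ "- x"]) auto
next
  fix x assume "x \<in> uminus ` (msf_set ps \<inter> {0..})"
  then show "x \<in> msf_set ps \<inter> {..0}" using set_minus by auto
qed

text \<open>
  Two intervals that meet have the same translate, so their cells meet and must be neighbours,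
  but neighbours have different translates.
\<close>

lemma intervals_disjoint:
  assumes "1 \<le> i" "i < j" "j \<le> n"
  shows "msf_interval ps i \<inter> msf_interval ps j = {}"
proof (rule ccontr)
  assume "msf_interval ps i \<inter> msf_interval ps j \<noteq> {}"
  then obtain x where "x \<in> msf_interval ps i" "x \<in> msf_interval ps j" by blast
  then have x: "a (i - 1) \<le> x - m i" "x - m i \<le> a i" "a (j - 1) \<le> x - m j" "x - m j \<le> a j"
    by (auto simp: interval_eq)
  then have "\<bar>of_int (int (m i) - int (m j))\<bar> < (1::real)"
    using a_bounds_pred[of i] a_bounds[of i] a_bounds_pred[of j] a_bounds[of j] assms by auto
  then have "\<bar>int (m i) - int (m j)\<bar> < 1" by linarith
  then have m: "m i = m j" by simp
  have "j = i + 1"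
  proof (rule ccontr)
    assume "j \<noteq> i + 1"
    then have "a i < a (Suc i)" "a (Suc i) \<le> a (j - 1)" using assms by (auto intro: a_inc a_mono)
    then show False using x m by simp
  qed
  then show False using m m_neq_Suc[of i] assms by simp
qed

lemma interval_inj:
  assumes "i \<in> {1..n}" "j \<in> {1..n}" "i \<noteq> j"
  shows "msf_interval ps i \<inter> msf_interval ps j = {}"
  using intervals_disjoint[of i j] intervals_disjoint[of j i] assms by (cases "i < j") auto

lemma interval_nonempty: "j \<in> {1..n} \<Longrightarrow> msf_interval ps j \<noteq> {}"
  using a_cell[of j] by (simp add: interval_eq)

lemma interval_minus_disjoint:
  assumes "i \<in> {1..n}" "j \<in> {1..n}"
  shows "msf_interval ps i \<inter> uminus ` msf_interval ps j = {}"
  using interval_pos[of i] interval_pos[of j] assms by force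

lemma intervals_pairwise: "disjoint (msf_intervals ps)"
proof (rule disjointI)
  fix X Y assume XY: "X \<in> msf_intervals ps" "Y \<in> msf_intervals ps" "X \<noteq> Y"
  have neg: "uminus ` msf_interval ps i \<inter> uminus ` msf_interval ps j = {}"
    if "i \<in> {1..n}" "j \<in> {1..n}" "i \<noteq> j" for i j
    using interval_inj[OF that] by auto
  show "X \<inter> Y = {}"
    using XY interval_inj neg interval_minus_disjoint
    unfolding msf_intervals_def by (elim UnE imageE) blast+
qed

lemma intervals_card: "card (msf_intervals ps) = 2 * n"
proof -
  let ?P = "msf_interval ps ` {1..n}" and ?N = "(\<lambda>j. uminus ` msf_interval ps j) ` {1..n}"
  have inj: "inj_on (msf_interval ps) {1..n}"
    using interval_inj interval_nonempty by (intro inj_onI) blast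
  have injN: "inj_on (\<lambda>j. uminus ` msf_interval ps j) {1..n}"
  proof (rule inj_onI)
    fix i j assume ij: "i \<in> {1..n}" "j \<in> {1..n}"
      and "uminus ` msf_interval ps i = uminus ` msf_interval ps j"
    then have "msf_interval ps i = msf_interval ps j" by (simp add: inj_image_eq_iff)
    then show "i = j" using inj ij by (simp add: inj_on_eq_iff)
  qed
  have "?P \<inter> ?N = {}"
  proof (rule ccontr)
    assume "?P \<inter> ?N \<noteq> {}"
    then obtain X where "X \<in> ?P" "X \<in> ?N" by (meson disjoint_iff)
    then obtain i j where ij: "i \<in> {1..n}" "j \<in> {1..n}"
      and eq: "msf_interval ps i = uminus ` msf_interval ps j" by (elim imageE) simp
    show False
      using interval_minus_disjoint[OF ij] interval_nonempty[OF ij(1)] unfolding eq[symmetric] by simp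
  qed
  then have "card (msf_intervals ps) = card ?P + card ?N"
    unfolding msf_intervals_def by (intro card_Un_disjoint) auto
  also have "\<dots> = 2 * n" unfolding card_image[OF inj] card_image[OF injN] by simp
  finally show ?thesis .
qed

lemma intervals_Union: "\<Union> (msf_intervals ps) = msf_set ps"
  by (auto simp: msf_intervals_def msf_set_def msf_set_pos_def)

lemma intervals_form:
  assumes "J \<in> msf_intervals ps"
  shows "\<exists>a b. a < b \<and> J = {a..b}"
proof -
  obtain j where j: "j \<in> {1..n}" "J = msf_interval ps j \<or> J = uminus ` msf_interval ps j"
    using assms by (auto simp: msf_intervals_def)
  have "a (j - 1) < a j" using j a_cell by auto
  moreover have "J = {a (j - 1) + m j..a j + m j} \<or> J = {- (a j + m j)..- (a (j - 1) + m j)}"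
    using j(2) by (auto simp: interval_eq)
  ultimately show ?thesis by (elim disjE) (rule exI, rule exI, rule conjI[rotated], assumption, simp)+
qed

end

section \<open>Recovering the polygonal\<close>

text \<open>
  At a point inside overlapping cells of two polygonals, the positive half of the set shows the
  translate of either cell.
\<close>

lemma next_translate_eq:
  assumes "msf ps" "msf qs" and eq: "msf_set_pos ps = msf_set_pos qs"
    and j: "1 \<le> j" "j \<le> length ps" "1 \<le> i" "i \<le> length qs"
    and overlap: "max (knot ps (j - 1)) (knot qs (i - 1)) < min (knot ps j) (knot qs i)"
  shows "pt_m ps j = pt_m qs i"
proof -
  interpret P: msf ps by fact
  interpret Q: msf qs by fact
  obtain z where "max (knot ps (j - 1)) (knot qs (i - 1)) < z" "z < min (knot ps j) (knot qs i)"
    using dense[OF overlap] by blast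
  then show ?thesis
    using P.translate_pos_iff[OF j(1,2), of z "int (P.m j)"]
      Q.translate_pos_iff[OF j(3,4), of z "int (P.m j)"] eq by auto
qed

text \<open>
  If the next knot of \<open>ps\<close> came first, the translate of \<open>ps\<close> would change there, while the cell
  of \<open>qs\<close> goes on with one translate.
\<close>

lemma next_knot_le:
  assumes "msf ps" "msf qs" and eq: "msf_set_pos ps = msf_set_pos qs"
    and j: "j < length ps" "j < length qs" and knot: "knot ps j = knot qs j"
  shows "knot qs (Suc j) \<le> knot ps (Suc j)"
proof (rule ccontr)
  interpret P: msf ps by fact
  interpret Q: msf qs by fact
  assume less: "\<not> knot qs (Suc j) \<le> knot ps (Suc j)"
  have "knot qs (Suc j) \<le> 1 / 2" using Q.a_bounds[of "Suc j"] j by simp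
  then have "Suc j \<noteq> length ps" using less P.a_n by auto
  then have j': "Suc j < length ps" using j by simp
  have "pt_m ps (Suc j) = pt_m qs (Suc j)"
    by (rule next_translate_eq[OF assms(1,2) eq]) (use j knot P.a_inc[of j] Q.a_inc[of j] in auto)
  moreover have "pt_m ps (Suc (Suc j)) = pt_m qs (Suc j)"
    by (rule next_translate_eq[OF assms(1,2) eq])
       (use j j' knot less P.a_inc[of j] P.a_inc[of "Suc j"] Q.a_inc[of j] in auto)
  ultimately show False using P.m_neq_Suc[of "Suc j"] j' by simp
qed

text \<open>
  The set determines the knots one after the other; since the last knot is \<open>1/2\<close> and the knots
  increase, it determines their number, then the translates, and finally the scales.
\<close>

lemma msf_set_inj:
  assumes ps: "msf_polygonal ps" and qs: "msf_polygonal qs" and eq: "msf_set ps = msf_set qs"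
  shows "ps = qs"
proof -
  interpret P: msf ps by unfold_locales (rule ps)
  interpret Q: msf qs by unfold_locales (rule qs)
  have pos: "msf_set_pos ps = msf_set_pos qs" by (simp add: P.pos_eq Q.pos_eq eq)
  have knots: "knot ps j = knot qs j" if "j \<le> length ps" "j \<le> length qs" for j
    using that
  proof (induction j)
    case 0
    then show ?case by (simp add: P.a_0 Q.a_0)
  next
    case (Suc j)
    then have "j < length ps" "j < length qs" "knot ps j = knot qs j" by auto
    then show ?case
      using next_knot_le[OF P.msf_axioms Q.msf_axioms pos]
        next_knot_le[OF Q.msf_axioms P.msf_axioms pos[symmetric]]
      by (metis antisym)
  qed
  have len: "length ps = length qs"
  proof (rule ccontr)
    assume "length ps \<noteq> length qs"
    then consider "length ps < length qs" | "length qs < length ps" by linarith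
    then show False
    proof cases
      case 1
      then show False
        using knots[of "length ps"] Q.a_inc[OF 1] Q.a_bounds[of "Suc (length ps)"] by (simp add: P.a_n)
    next
      case 2
      then show False
        using knots[of "length qs"] P.a_inc[OF 2] P.a_bounds[of "Suc (length qs)"] by (simp add: Q.a_n)
    qed
  qed
  have ms: "pt_m ps j = pt_m qs j" if "1 \<le> j" "j \<le> length ps" for j
    by (rule next_translate_eq[OF P.msf_axioms Q.msf_axioms pos])
       (use that len knots[of j] knots[of "j - 1"] P.a_cell[of j] in auto)
  have ls: "pt_lambda ps j = pt_lambda qs j" if "1 \<le> j" "j \<le> length ps" for j
    using that
  proof (induction j rule: dec_induct)
    case base
    show ?case using P.l_1 Q.l_1 by simp
  next
    case (step j)
    have "0 < knot ps j + pt_m ps (j + 1)"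
      using P.a_pos[of j] step by (intro add_pos_nonneg) auto
    then have "2 powi (- pt_lambda ps (j + 1)) = (2 powi (- pt_lambda qs (j + 1)) :: real)"
      using P.scaled_ends_agree[of j] Q.scaled_ends_agree[of j] step len
        knots[of j] ms[of j] ms[of "j + 1"] by auto
    then show ?case by (simp add: power_int_two_eq_iff)
  qed
  show ?thesis
  proof (rule nth_equalityI[OF len])
    fix i assume i: "i < length ps"
    have "set ps \<subseteq> dyadic_points" "set qs \<subseteq> dyadic_points"
      using ps qs by (simp_all add: msf_polygonal_def)
    then show "ps ! i = qs ! i"
      using dyadic_point_parameters[of ps "i + 1"] dyadic_point_parameters[of qs "i + 1"]
        ms[of "i + 1"] ls[of "i + 1"] i len by simp
  qed
qed

theorem theorem3:
  "(\<forall>ps. msf_polygonal ps \<longrightarrow>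
      wavelet_set (msf_set ps) \<and> symmetric_set (msf_set ps) \<and>
      \<Union> (msf_intervals ps) = msf_set ps \<and> disjoint (msf_intervals ps) \<and>
      card (msf_intervals ps) = 2 * length ps \<and>
      (\<forall>J\<in>msf_intervals ps. \<exists>a b. a < b \<and> J = {a..b})) \<and>
   (\<forall>ps qs. msf_polygonal ps \<and> msf_polygonal qs \<and> ps \<noteq> qs \<longrightarrow> msf_set ps \<noteq> msf_set qs)"
proof (intro conjI allI impI ballI)
  fix ps assume "msf_polygonal ps"
  then interpret msf ps by unfold_locales
  show "wavelet_set (msf_set ps)" by (rule wavelet)
  show "symmetric_set (msf_set ps)" by (rule symmetric)
  show "\<Union> (msf_intervals ps) = msf_set ps" by (rule intervals_Union)
  show "disjoint (msf_intervals ps)" by (rule intervals_pairwise)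
  show "card (msf_intervals ps) = 2 * length ps" by (rule intervals_card)
  show "\<exists>a b. a < b \<and> J = {a..b}" if "J \<in> msf_intervals ps" for J
    using that by (rule intervals_form)
next
  fix ps qs
  assume "msf_polygonal ps \<and> msf_polygonal qs \<and> ps \<noteq> qs"
  then show "msf_set ps \<noteq> msf_set qs" using msf_set_inj by blast
qed


end
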